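(* Let $\mathcal{M}$ be a Riemannian manifold modeled on a Hilbert space, let $\Omega\subset\mathcal{M}$ and $p\in\operatorname{cl}\Omega$. For $r>0$ denote $\Omega_r:=\Omega\cap\mathbb{B}(p,r)$. Then for all sufficiently small $r>0$ and each $u\in\mathbb{B}(p,r)$, $$\frac{\operatorname{dist}(\exp_p^{-1}u;\ \exp_p^{-1}\Omega_r)}{1+|o(r)|}\ \le\ \operatorname{dist}(u;\Omega_r)\ \le\ (1+|o(r)|)\,\operatorname{dist}(\exp_p^{-1}u;\ \exp_p^{-1}\Omega_r),$$ where $o(r)$ denotes a quantity depending only on $r$ (for the given $p$ and $\Omega$, and not on $u$) with $o(r)/r\to 0$ as $r\downarrow 0$.
   Context: A Riemannian manifold $\mathcal{M}$ here is a $C^\infty$ manifold modeled on a (possibly infinite-dimensional) real Hilbert space, with a smooth Riemannian metric $g$ such that for each $p$ the norm $\|x\|_p=g_p(x,x)^{1/2}$ on $T_p\mathcal{M}$ is equivalent to the model norm. $d$ is the Riemannian distance and $\mathbb{B}(p,r)=\{q\in\mathcal{M}: d(p,q)\le r\}$ is the closed ball. $\exp_p$ is the exponential map restricted to a sufficiently small neighborhood of $0$ in $T_p\mathcal{M}$, on which it is a diffeomorphism onto a neighborhood of $p$; $r$ is taken small enough that $\exp_p^{-1}$ is defined on $\mathbb{B}(p,r)$. In any metric space, $\operatorname{dist}(x;A):=\inf_{a\in A}d(x,a)$; in $\mathcal{M}$ it is taken with respect to the Riemannian distance, and in $T_p\mathcal{M}$ with respect to the norm $\|\cdot\|_p$.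 *)

theory Defs
  imports "HOL-Analysis.Analysis"
begin

text \<open>
  \<open>C\<^sup>\<infinity>\<close> in the Frechet sense.  The \<open>n\<close>-th derivative at \<open>x\<close> is the bounded \<open>n\<close>-linear map
  \<open>D x\<close> restricted to lists of length \<open>n\<close>.  Each \<open>n\<close>-th derivative is Frechet differentiable with
  respect to the operator norm on \<open>n\<close>-linear maps, and its derivative in direction \<open>h\<close> is the
  map taking \<open>vs\<close> to \<open>D x (h # vs)\<close>.  Lists are used because the type of iterated
  derivatives depends on \<open>n\<close>.
\<close>

definition smooth_on ::
  "'a::real_normed_vector set \<Rightarrow> ('a \<Rightarrow> 'b::real_normed_vector) \<Rightarrow> bool" where
  "smooth_on S f \<longleftrightarrow> open S \<and>
     (\<exists>D :: 'a \<Rightarrow> 'a list \<Rightarrow> 'b.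
        (\<forall>x\<in>S. D x [] = f x) \<and>
        (\<forall>x\<in>S. \<forall>us vs. linear (\<lambda>h. D x (us @ h # vs))) \<and>
        (\<forall>n. \<forall>x\<in>S. \<exists>K. \<forall>vs. length vs = n \<longrightarrow>
           norm (D x vs) \<le> K * prod_list (map norm vs)) \<and>
        (\<forall>n. \<forall>x\<in>S. \<forall>e>0. \<exists>d>0. \<forall>y\<in>S. norm (y - x) < d \<longrightarrow>
           (\<forall>vs. length vs = n \<longrightarrow>
              norm (D y vs - D x vs - D x ((y - x) # vs))
                \<le> e * norm (y - x) * prod_list (map norm vs))))"


section \<open>Manifolds modeled on a Hilbert space\<close>

text \<open>The Hilbert space is a type of sort \<open>{real_inner, banach}\<close>, of arbitrary dimension.\<close>

type_synonym ('m, 'h) chart = "'m set \<times> ('m \<Rightarrow> 'h)"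

abbreviation chart_dom :: "('m, 'h) chart \<Rightarrow> 'm set" where
  "chart_dom \<equiv> fst"

abbreviation chart_map :: "('m, 'h) chart \<Rightarrow> 'm \<Rightarrow> 'h" where
  "chart_map \<equiv> snd"

definition chart_range :: "('m, 'h) chart \<Rightarrow> 'h set" where
  "chart_range c = chart_map c ` chart_dom c"

definition chart_inv :: "('m, 'h) chart \<Rightarrow> 'h \<Rightarrow> 'm" where
  "chart_inv c = inv_into (chart_dom c) (chart_map c)"

definition charts_at :: "('m, 'h) chart set \<Rightarrow> 'm \<Rightarrow> ('m, 'h) chart set" where
  "charts_at A p = {c \<in> A. p \<in> chart_dom c}"

definition transition :: "('m, 'h) chart \<Rightarrow> ('m, 'h) chart \<Rightarrow> 'h \<Rightarrow> 'h" where
  "transition c c' = chart_map c' \<circ> chart_inv c"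

text \<open>The atlas need not be maximal; all notions below depend only on the smooth structure
  that it generates.\<close>

locale hilbert_manifold =
  fixes A :: "('m::t2_space, 'h::{real_inner, banach}) chart set"
  assumes charts_cover: "(\<Union>c\<in>A. chart_dom c) = UNIV"
    and chart_dom_open: "c \<in> A \<Longrightarrow> open (chart_dom c)"
    and chart_range_open: "c \<in> A \<Longrightarrow> open (chart_range c)"
    and chart_homeomorphism:
      "c \<in> A \<Longrightarrow> homeomorphism (chart_dom c) (chart_range c) (chart_map c) (chart_inv c)"
    and transition_smooth:
      "c \<in> A \<Longrightarrow> c' \<in> A \<Longrightarrow>
         smooth_on (chart_map c ` (chart_dom c \<inter> chart_dom c')) (transition c c')"


section \<open>Tangent spaces\<close>

text \<open>A tangent vector at \<open>p\<close> is the family of its coordinates in all charts at \<open>p\<close>, related by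
  the derivatives of the transition maps; coordinates in irrelevant charts are set to \<open>0\<close>.  The
  vector space operations are pointwise.\<close>

type_synonym ('m, 'h) tvec = "('m, 'h) chart \<Rightarrow> 'h"

definition tangent_space ::
  "('m, 'h::real_normed_vector) chart set \<Rightarrow> 'm \<Rightarrow> ('m, 'h) tvec set" where
  "tangent_space A p =
     {v. (\<forall>c. c \<notin> charts_at A p \<longrightarrow> v c = 0) \<and>
         (\<forall>c\<in>charts_at A p. \<forall>c'\<in>charts_at A p.
            v c' = frechet_derivative (transition c c') (at (chart_map c p)) (v c))}"

text \<open>The tangent vector at \<open>p\<close> whose coordinate in the chart \<open>c\<close> is \<open>a\<close>.\<close>

definition tvec_of ::
  "('m, 'h::real_normed_vector) chart set \<Rightarrow> 'm \<Rightarrow> ('m, 'h) chart \<Rightarrow> 'h \<Rightarrow> ('m, 'h) tvec" where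
  "tvec_of A p c a =
     (\<lambda>c'. if c' \<in> charts_at A p
            then frechet_derivative (transition c c') (at (chart_map c p)) a else 0)"

definition velocity ::
  "('m, 'h::real_normed_vector) chart set \<Rightarrow> (real \<Rightarrow> 'm) \<Rightarrow> real \<Rightarrow> ('m, 'h) tvec" where
  "velocity A \<gamma> t =
     (\<lambda>c. if c \<in> charts_at A (\<gamma> t)
           then vector_derivative (chart_map c \<circ> \<gamma>) (at t) else 0)"


section \<open>Riemannian metrics\<close>

type_synonym ('m, 'h) metric = "'m \<Rightarrow> ('m, 'h) tvec \<Rightarrow> ('m, 'h) tvec \<Rightarrow> real"

definition rnorm :: "('m, 'h) metric \<Rightarrow> 'm \<Rightarrow> ('m, 'h) tvec \<Rightarrow> real" where
  "rnorm g p v = sqrt (g p v v)"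

text \<open>The metric in the chart \<open>c\<close>, as a map into the bounded bilinear forms on the model.\<close>

definition metric_rep ::
  "('m, 'h::real_normed_vector) chart set \<Rightarrow> ('m, 'h) metric \<Rightarrow> ('m, 'h) chart \<Rightarrow>
     'h \<Rightarrow> 'h \<Rightarrow>\<^sub>L 'h \<Rightarrow>\<^sub>L real" where
  "metric_rep A g c x =
     (let p = chart_inv c x in
      Blinfun (\<lambda>a. Blinfun (\<lambda>b. g p (tvec_of A p c a) (tvec_of A p c b))))"

locale riemannian_manifold = hilbert_manifold A
  for A :: "('m::t2_space, 'h::{real_inner, banach}) chart set" +
  fixes g :: "('m, 'h) metric"
  assumes metric_sym:
      "v \<in> tangent_space A p \<Longrightarrow> w \<in> tangent_space A p \<Longrightarrow> g p v w = g p w v"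
    and metric_linear:
      "v \<in> tangent_space A p \<Longrightarrow> w \<in> tangent_space A p \<Longrightarrow> z \<in> tangent_space A p \<Longrightarrow>
         g p (\<lambda>c. s *\<^sub>R v c + t *\<^sub>R w c) z = s * g p v z + t * g p w z"
    and metric_pos:
      "v \<in> tangent_space A p \<Longrightarrow> v \<noteq> (\<lambda>c. 0) \<Longrightarrow> g p v v > 0"
    and metric_norm_equivalent:
      "c \<in> charts_at A p \<Longrightarrow>
         \<exists>k>0. \<exists>K. \<forall>v\<in>tangent_space A p.
           k * norm (v c) \<le> rnorm g p v \<and> rnorm g p v \<le> K * norm (v c)"
    and metric_smooth:
      "c \<in> A \<Longrightarrow> smooth_on (chart_range c) (metric_rep A g c)"


section \<open>Riemannian distance\<close>

definition C1_curve_on ::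
  "('m::topological_space, 'h::real_normed_vector) chart set \<Rightarrow> real set \<Rightarrow> (real \<Rightarrow> 'm) \<Rightarrow> bool"
  where
  "C1_curve_on A I \<gamma> \<longleftrightarrow> continuous_on I \<gamma> \<and>
     (\<forall>c\<in>A. \<exists>x'. continuous_on {t\<in>I. \<gamma> t \<in> chart_dom c} x' \<and>
        (\<forall>t\<in>{t\<in>I. \<gamma> t \<in> chart_dom c}.
           (chart_map c \<circ> \<gamma> has_vector_derivative x' t) (at t within I)))"

text \<open>Each piece is \<open>C\<^sup>1\<close> up to and including its end points, so that the speed is bounded and
  the length integral below exists.\<close>

inductive piecewise_C1_curve ::
  "('m::topological_space, 'h::real_normed_vector) chart set \<Rightarrow> (real \<Rightarrow> 'm) \<Rightarrow> real \<Rightarrow> real \<Rightarrow> bool"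
  for A \<gamma> where
    piece: "a < b \<Longrightarrow> C1_curve_on A {a..b} \<gamma> \<Longrightarrow> piecewise_C1_curve A \<gamma> a b"
  | join: "piecewise_C1_curve A \<gamma> a b \<Longrightarrow> piecewise_C1_curve A \<gamma> b c \<Longrightarrow>
             piecewise_C1_curve A \<gamma> a c"

definition curve_length ::
  "('m, 'h::real_normed_vector) chart set \<Rightarrow> ('m, 'h) metric \<Rightarrow> (real \<Rightarrow> 'm) \<Rightarrow> real" where
  "curve_length A g \<gamma> = integral {0..1} (\<lambda>t. rnorm g (\<gamma> t) (velocity A \<gamma> t))"

text \<open>Extended-real valued: the distance between different components is \<open>\<infinity>\<close>.\<close>

definition rdist ::
  "('m::topological_space, 'h::real_normed_vector) chart set \<Rightarrow> ('m, 'h) metric \<Rightarrow>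
     'm \<Rightarrow> 'm \<Rightarrow> ereal" where
  "rdist A g p q =
     (INF \<gamma>\<in>{\<gamma>. piecewise_C1_curve A \<gamma> 0 1 \<and> \<gamma> 0 = p \<and> \<gamma> 1 = q}.
        ereal (curve_length A g \<gamma>))"

definition rcball ::
  "('m::topological_space, 'h::real_normed_vector) chart set \<Rightarrow> ('m, 'h) metric \<Rightarrow>
     'm \<Rightarrow> real \<Rightarrow> 'm set" where
  "rcball A g p r = {q. rdist A g p q \<le> ereal r}"

definition tdist :: "('m, 'h::real_normed_vector) metric \<Rightarrow> 'm \<Rightarrow>
    ('m, 'h) tvec \<Rightarrow> ('m, 'h) tvec \<Rightarrow> ereal" where
  "tdist g p v w = ereal (rnorm g p (\<lambda>c. v c - w c))"

definition set_dist :: "('a \<Rightarrow> 'a \<Rightarrow> ereal) \<Rightarrow> 'a \<Rightarrow> 'a set \<Rightarrow> ereal" where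
  "set_dist d x S = (INF a\<in>S. d x a)"


section \<open>Geodesics and the exponential map\<close>

text \<open>Christoffel symbols of the first kind, i.e. the inner product of
  \<open>\<Gamma>(u, v)\<close> with \<open>w\<close>, for the Levi-Civita connection in the chart \<open>c\<close>.\<close>

definition christoffel1 ::
  "('m, 'h::real_normed_vector) chart set \<Rightarrow> ('m, 'h) metric \<Rightarrow> ('m, 'h) chart \<Rightarrow>
     'h \<Rightarrow> 'h \<Rightarrow> 'h \<Rightarrow> 'h \<Rightarrow> real" where
  "christoffel1 A g c x u v w =
     (let DG = frechet_derivative (metric_rep A g c) (at x) in
      (blinfun_apply (blinfun_apply (DG u) v) w
       + blinfun_apply (blinfun_apply (DG v) u) w
       - blinfun_apply (blinfun_apply (DG w) u) v) / 2)"

text \<open>The geodesic equation \<open>x'' + \<Gamma>(x', x') = 0\<close>, paired with an arbitrary \<open>w\<close>.\<close>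

definition geodesic_on ::
  "('m::topological_space, 'h::real_normed_vector) chart set \<Rightarrow> ('m, 'h) metric \<Rightarrow>
     real set \<Rightarrow> (real \<Rightarrow> 'm) \<Rightarrow> bool" where
  "geodesic_on A g I \<gamma> \<longleftrightarrow> continuous_on I \<gamma> \<and>
     (\<forall>c\<in>A. \<exists>x' x''. \<forall>t\<in>{t\<in>I. \<gamma> t \<in> chart_dom c}.
        (chart_map c \<circ> \<gamma> has_vector_derivative x' t) (at t within I) \<and>
        (x' has_vector_derivative x'' t) (at t within I) \<and>
        (\<forall>w. blinfun_apply (blinfun_apply (metric_rep A g c (chart_map c (\<gamma> t))) (x'' t)) w
              + christoffel1 A g c (chart_map c (\<gamma> t)) (x' t) (x' t) w = 0))"

definition geodesic_from ::
  "('m::topological_space, 'h::real_normed_vector) chart set \<Rightarrow> ('m, 'h) metric \<Rightarrow>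
     'm \<Rightarrow> ('m, 'h) tvec \<Rightarrow> (real \<Rightarrow> 'm) \<Rightarrow> bool" where
  "geodesic_from A g p v \<gamma> \<longleftrightarrow> geodesic_on A g {0..1} \<gamma> \<and> \<gamma> 0 = p \<and>
     (\<forall>c\<in>charts_at A p. (chart_map c \<circ> \<gamma> has_vector_derivative v c) (at 0 within {0..1}))"

definition exp_dom ::
  "('m::topological_space, 'h::real_normed_vector) chart set \<Rightarrow> ('m, 'h) metric \<Rightarrow>
     'm \<Rightarrow> ('m, 'h) tvec set" where
  "exp_dom A g p = {v \<in> tangent_space A p. \<exists>\<gamma>. geodesic_from A g p v \<gamma>}"

definition exp_map ::
  "('m::topological_space, 'h::real_normed_vector) chart set \<Rightarrow> ('m, 'h) metric \<Rightarrow>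
     'm \<Rightarrow> ('m, 'h) tvec \<Rightarrow> 'm" where
  "exp_map A g p v = (THE q. \<exists>\<gamma>. geodesic_from A g p v \<gamma> \<and> \<gamma> 1 = q)"

definition exp_inv ::
  "('m::topological_space, 'h::real_normed_vector) chart set \<Rightarrow> ('m, 'h) metric \<Rightarrow>
     'm \<Rightarrow> ('m, 'h) tvec set \<Rightarrow> 'm \<Rightarrow> ('m, 'h) tvec" where
  "exp_inv A g p U = inv_into U (exp_map A g p)"

text \<open>\<open>U\<close> is an open neighbourhood of \<open>0\<close> in the tangent space at \<open>p\<close> on which the exponential map
  is a \<open>C\<^sup>\<infinity>\<close> diffeomorphism onto an open neighbourhood of \<open>p\<close>.  The tangent space carries the
  topology and smooth structure of the model, transported by the coordinates of a chart at \<open>p\<close>.\<close>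

definition exp_diffeo_nbhd ::
  "('m::topological_space, 'h::real_normed_vector) chart set \<Rightarrow> ('m, 'h) metric \<Rightarrow>
     'm \<Rightarrow> ('m, 'h) tvec set \<Rightarrow> bool" where
  "exp_diffeo_nbhd A g p U \<longleftrightarrow>
     U \<subseteq> exp_dom A g p \<and> (\<lambda>c. 0) \<in> U \<and> (\<forall>c\<in>charts_at A p. open ((\<lambda>v. v c) ` U)) \<and>
     inj_on (exp_map A g p) U \<and> open (exp_map A g p ` U) \<and>
     (\<forall>c\<in>charts_at A p. \<forall>c'\<in>A.
        smooth_on ((\<lambda>v. v c) ` {v\<in>U. exp_map A g p v \<in> chart_dom c'})
          (\<lambda>a. chart_map c' (exp_map A g p (tvec_of A p c a))) \<and>
        smooth_on (chart_map c' ` (chart_dom c' \<inter> exp_map A g p ` U))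
          (\<lambda>y. exp_inv A g p U (chart_inv c' y) c))"

end

theory Submission
  imports Defs
begin

text \<open>
  In normal coordinates the metric is constant up to first order at \<open>p\<close>: radial lines are geodesics,
  so the geodesic equation at time \<open>0\<close> gives the second derivative of the exponential map on the
  diagonal; its symmetry then yields the whole second derivative, and the first-order term of the
  pulled-back metric cancels.  Hence on the ball of radius \<open>r\<close> the Riemannian norm and the norm at \<open>p\<close>
  differ by a factor \<open>1 + o(r)\<close>.  Straight segments bound the Riemannian distance from above.  For the
  lower bound, a curve between points at distance at most \<open>2r\<close> from \<open>p\<close> either stays in the ball of radius
  \<open>10r\<close>, where the comparison of norms applies, or is longer than the segment.  Both bounds hold for
  each pair of points, so they pass to distances to sets.
\<close>

text \<open>A chart whose differential at \<open>p\<close> is the identity makes the two norms agree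
  in general only up to a factor 1 + O(r). The vanishing first derivative of the pulled-back metric
  at \<open>0\<close> is what improves this to 1 + o(r), and differentiability at that single point
  suffices for it.

  In infinite dimensions closed balls are not compact and minimising geodesics may fail to exist, so
  distances are estimated through lengths of arbitrary curves; geodesics enter only through the
  exponential map. Their uniqueness has to be proved because \<open>exp_map\<close> is a
  \<open>THE\<close>: only then is \<open>exp_map\<close> along a ray a single geodesic.

  Every estimate has the form: for each e > 0 the factor is 1 + e * r for all small r. One function
  \<rho> is extracted from these at the very end. As for the radii, two points with coordinates of
  norm below 2r are less than 4r apart, whereas leaving the ball of radius 10r from such a point
  costs a displacement of 8r.\<close>

section \<open>Iterated derivatives\<close>

text \<open>\<open>smooth_on\<close> hides the family of derivatives behind an existential
  quantifier. Naming the family lets values, first and second derivatives of one map be read off the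
  same \<open>D\<close>.\<close>

definition derivs_on ::
  "'a::real_normed_vector set \<Rightarrow> ('a \<Rightarrow> 'a list \<Rightarrow> 'b::real_normed_vector) \<Rightarrow> bool" where
  "derivs_on S D \<longleftrightarrow> open S \<and>
        (\<forall>x\<in>S. \<forall>us vs. linear (\<lambda>h. D x (us @ h # vs))) \<and>
        (\<forall>n. \<forall>x\<in>S. \<exists>K. \<forall>vs. length vs = n \<longrightarrow>
           norm (D x vs) \<le> K * prod_list (map norm vs)) \<and>
        (\<forall>n. \<forall>x\<in>S. \<forall>e>0. \<exists>d>0. \<forall>y\<in>S. norm (y - x) < d \<longrightarrow>
           (\<forall>vs. length vs = n \<longrightarrow>
              norm (D y vs - D x vs - D x ((y - x) # vs))
                \<le> e * norm (y - x) * prod_list (map norm vs)))"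

lemma smooth_on_derivs:
  assumes "smooth_on S f"
  obtains D where "derivs_on S D" "\<And>x. x \<in> S \<Longrightarrow> D x [] = f x"
proof -
  have "\<exists>D. derivs_on S D \<and> (\<forall>x\<in>S. D x [] = f x)"
    using assms unfolding smooth_on_def derivs_on_def
    by (elim conjE exE, intro exI conjI) assumption+
  then show ?thesis using that by blast
qed

lemma derivs_on_open: "derivs_on S D \<Longrightarrow> open S"
  unfolding derivs_on_def by blast

lemma prod_list_norm_nonneg: "0 \<le> prod_list (map norm (vs :: 'a::real_normed_vector list))"
  by (induction vs) auto

lemma derivs_on_linear:
  "derivs_on S D \<Longrightarrow> x \<in> S \<Longrightarrow> linear (\<lambda>h. D x (us @ h # vs))"
  unfolding derivs_on_def by blast

lemma derivs_on_bound:
  assumes "derivs_on S D" "x \<in> S"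
  obtains K where "0 \<le> K" "\<And>vs. length vs = n \<Longrightarrow> norm (D x vs) \<le> K * prod_list (map norm vs)"
proof -
  obtain K where K: "\<And>vs. length vs = n \<Longrightarrow> norm (D x vs) \<le> K * prod_list (map norm vs)"
    using assms unfolding derivs_on_def by meson
  have "norm (D x vs) \<le> max K 0 * prod_list (map norm vs)" if "length vs = n" for vs
    using K[OF that] prod_list_norm_nonneg[of vs]
    by (smt (verit) mult_right_mono max.cobounded1)
  then show ?thesis using that[of "max K 0"] by auto
qed

lemma derivs_on_remainder:
  assumes "derivs_on S D" "x \<in> S" "e > 0"
  obtains d where "d > 0" "\<And>y vs. y \<in> S \<Longrightarrow> norm (y - x) < d \<Longrightarrow> length vs = n \<Longrightarrow>
    norm (D y vs - D x vs - D x ((y - x) # vs)) \<le> e * norm (y - x) * prod_list (map norm vs)"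
  using assms unfolding derivs_on_def by meson

lemma derivs_on_has_derivative:
  assumes D: "derivs_on S D" "x \<in> S"
  shows "((\<lambda>y. D y vs) has_derivative (\<lambda>h. D x (h # vs))) (at x)"
  unfolding has_derivative_at_alt
proof (intro conjI allI impI)
  obtain K where K: "\<And>ws. length ws = Suc (length vs) \<Longrightarrow> norm (D x ws) \<le> K * prod_list (map norm ws)"
    using derivs_on_bound[OF D] by blast
  show "bounded_linear (\<lambda>h. D x (h # vs))"
    unfolding bounded_linear_def bounded_linear_axioms_def
  proof
    show "linear (\<lambda>h. D x (h # vs))" using derivs_on_linear[OF D, of "[]"] by simp
    have "norm (D x (h # vs)) \<le> norm h * (K * prod_list (map norm vs))" for h
      using K[of "h # vs"] by (simp add: ac_simps)
    then show "\<exists>K. \<forall>h. norm (D x (h # vs)) \<le> norm h * K" by blast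
  qed
  fix e :: real assume e: "e > 0"
  define P where "P = prod_list (map norm vs)"
  have P: "P \<ge> 0" unfolding P_def by (rule prod_list_norm_nonneg)
  obtain d where d: "d > 0" "\<And>y ws. y \<in> S \<Longrightarrow> norm (y - x) < d \<Longrightarrow> length ws = length vs \<Longrightarrow>
    norm (D y ws - D x ws - D x ((y - x) # ws)) \<le> e / (P + 1) * norm (y - x) * prod_list (map norm ws)"
    using derivs_on_remainder[OF D, of "e / (P + 1)" "length vs"] e P
    by (metis add_nonneg_pos divide_pos_pos zero_less_one)
  obtain d' where d': "d' > 0" "ball x d' \<subseteq> S"
    using derivs_on_open[OF D(1)] D(2) open_contains_ball by blast
  show "\<exists>d>0. \<forall>y. norm (y - x) < d \<longrightarrow> norm (D y vs - D x vs - D x ((y - x) # vs)) \<le> e * norm (y - x)"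
  proof (intro exI[of _ "min d d'"] conjI allI impI)
    fix y assume y: "norm (y - x) < min d d'"
    then have "y \<in> S" using d'(2) by (auto simp: dist_norm norm_minus_commute)
    then have "norm (D y vs - D x vs - D x ((y - x) # vs)) \<le> e / (P + 1) * norm (y - x) * P"
      using d(2)[of y vs] y unfolding P_def by auto
    also have "\<dots> = e * norm (y - x) * (P / (P + 1))" by simp
    also have "\<dots> \<le> e * norm (y - x) * 1"
      using P e by (intro mult_left_mono) auto
    finally show "norm (D y vs - D x vs - D x ((y - x) # vs)) \<le> e * norm (y - x)" by simp
  qed (use d d' in auto)
qed

text \<open>The defining bound holds at one point at a time. The remainder estimate with error 1
  compares \<open>D y\<close> with \<open>D x\<close> and the derivative of next order at
  \<open>x\<close>; at distance at most 1 from \<open>x\<close> the three contributions are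
  \<open>K\<close>, \<open>L\<close> and 1.\<close>

lemma derivs_on_locally_bounded:
  assumes D: "derivs_on S D" "x \<in> S"
  obtains d K where "d > 0" "0 \<le> K" "ball x d \<subseteq> S"
    "\<And>y vs. y \<in> ball x d \<Longrightarrow> length vs = n \<Longrightarrow> norm (D y vs) \<le> K * prod_list (map norm vs)"
proof -
  obtain K where K: "0 \<le> K" "\<And>ws. length ws = n \<Longrightarrow> norm (D x ws) \<le> K * prod_list (map norm ws)"
    using derivs_on_bound[OF D] by blast
  obtain L where L: "0 \<le> L" "\<And>ws. length ws = Suc n \<Longrightarrow> norm (D x ws) \<le> L * prod_list (map norm ws)"
    using derivs_on_bound[OF D] by blast
  obtain d where d: "d > 0" "\<And>y ws. y \<in> S \<Longrightarrow> norm (y - x) < d \<Longrightarrow> length ws = n \<Longrightarrow>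
    norm (D y ws - D x ws - D x ((y - x) # ws)) \<le> 1 * norm (y - x) * prod_list (map norm ws)"
    using derivs_on_remainder[OF D, of 1 n] by (metis zero_less_one)
  obtain d' where d': "d' > 0" "ball x d' \<subseteq> S"
    using derivs_on_open[OF D(1)] D(2) open_contains_ball by blast
  define r where "r = min 1 (min d d')"
  have "norm (D y vs) \<le> (K + L + 1) * prod_list (map norm vs)"
    if y: "y \<in> ball x r" and vs: "length vs = n" for y vs
  proof -
    define P where "P = prod_list (map norm vs)"
    have P: "P \<ge> 0" unfolding P_def by (rule prod_list_norm_nonneg)
    have ny: "norm (y - x) < r" using y by (simp add: dist_norm norm_minus_commute)
    have yS: "y \<in> S" using y d'(2) by (auto simp: r_def)
    have "norm (D y vs - D x vs - D x ((y - x) # vs)) \<le> norm (y - x) * P"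
      using d(2)[OF yS _ vs] ny unfolding P_def by (auto simp: r_def)
    moreover have "norm (y - x) * P \<le> 1 * P"
      using ny P by (intro mult_right_mono) (auto simp: r_def)
    moreover have "norm (D x vs) \<le> K * P" using K vs by (simp add: P_def)
    moreover have "norm (D x ((y - x) # vs)) \<le> L * (norm (y - x) * P)"
      using L(2)[of "(y - x) # vs"] vs by (simp add: P_def)
    moreover have "L * (norm (y - x) * P) \<le> L * (1 * P)"
      using \<open>norm (y - x) * P \<le> 1 * P\<close> L(1) by (intro mult_left_mono)
    moreover have "norm (D y vs) \<le> norm (D y vs - D x vs - D x ((y - x) # vs)) + norm (D x vs)
        + norm (D x ((y - x) # vs))"
      using norm_triangle_sub[of "D y vs" "D x vs + D x ((y - x) # vs)"]
        norm_triangle_ineq[of "D x vs" "D x ((y - x) # vs)"] by (simp add: algebra_simps)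
    ultimately show ?thesis unfolding P_def[symmetric] by (simp add: algebra_simps)
  qed
  moreover have "r > 0" "ball x r \<subseteq> S" using d d' by (auto simp: r_def)
  ultimately show ?thesis using that[of r "K + L + 1"] K L by auto
qed

text \<open>Mean value inequality on a ball where the derivative of order \<open>Suc n\<close> is
  bounded.\<close>

lemma derivs_on_locally_lipschitz:
  assumes D: "derivs_on S D" "x \<in> S"
  obtains d L where "d > 0" "0 \<le> L" "ball x d \<subseteq> S"
    "\<And>y z vs. y \<in> ball x d \<Longrightarrow> z \<in> ball x d \<Longrightarrow> length vs = n \<Longrightarrow>
        norm (D y vs - D z vs) \<le> L * norm (y - z) * prod_list (map norm vs)"
proof -
  obtain d K where d: "d > 0" "0 \<le> K" "ball x d \<subseteq> S"
    "\<And>y vs. y \<in> ball x d \<Longrightarrow> length vs = Suc n \<Longrightarrow> norm (D y vs) \<le> K * prod_list (map norm vs)"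
    using derivs_on_locally_bounded[OF D] by blast
  have "norm (D y vs - D z vs) \<le> K * norm (y - z) * prod_list (map norm vs)"
    if y: "y \<in> ball x d" "z \<in> ball x d" and vs: "length vs = n" for y z vs
  proof -
    have "norm (D y vs - D z vs) \<le> (K * prod_list (map norm vs)) * norm (y - z)"
    proof (rule differentiable_bound[where S="ball x d" and f'="\<lambda>u h. D u (h # vs)"])
      fix u assume u: "u \<in> ball x d"
      then show "((\<lambda>y. D y vs) has_derivative (\<lambda>h. D u (h # vs))) (at u within ball x d)"
        using derivs_on_has_derivative[OF D(1), of u] d(3) has_derivative_at_withinI by blast
      show "onorm (\<lambda>h. D u (h # vs)) \<le> K * prod_list (map norm vs)"
        using d(4)[OF u, of "_ # vs"] vs
        by (intro onorm_bound) (auto simp: ac_simps d prod_list_norm_nonneg)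
    qed (use y in auto)
    then show ?thesis by (simp add: ac_simps)
  qed
  then show ?thesis using that[OF d(1,2,3)] by blast
qed

lemma smooth_on_continuous_on: "smooth_on S f \<Longrightarrow> continuous_on S f"
proof -
  assume "smooth_on S f"
  then obtain D where D: "derivs_on S D" "\<And>x. x \<in> S \<Longrightarrow> D x [] = f x"
    by (rule smooth_on_derivs) blast
  have "continuous_on S (\<lambda>x. D x [])"
    using derivs_on_has_derivative[OF D(1)]
    by (meson continuous_at_imp_continuous_on has_derivative_continuous)
  then show ?thesis using D(2) by (simp cong: continuous_on_cong)
qed

lemma smooth_on_has_derivative:
  assumes D: "derivs_on S D" "\<And>x. x \<in> S \<Longrightarrow> D x [] = f x" and x: "x \<in> S"
  shows "(f has_derivative (\<lambda>h. D x [h])) (at x)"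
proof (rule has_derivative_transform_within_open[OF derivs_on_has_derivative[OF D(1) x, of "[]"]])
  show "open S" using D(1) by (rule derivs_on_open)
qed (use D x in auto)

lemma smooth_on_differentiable:
  "smooth_on S f \<Longrightarrow> x \<in> S \<Longrightarrow> f differentiable (at x)"
  by (metis smooth_on_derivs smooth_on_has_derivative differentiable_def)

section \<open>Symmetry of the second derivative\<close>

text \<open>The second difference of \<open>f\<close> along \<open>h\<close> and \<open>k\<close> is
  symmetric in the two, and divided by the square of the step it tends both to \<open>B k h\<close>
  and to \<open>B h k\<close>. Real values are essential to the argument, which uses the mean value
  theorem with an exact intermediate point.\<close>

lemma symmetric_second_derivative:
  fixes f :: "'a::real_normed_vector \<Rightarrow> real"
  assumes S: "open S" "x \<in> S"
    and f': "\<And>y. y \<in> S \<Longrightarrow> (f has_derivative f' y) (at y)"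
    and f'': "\<And>e. e > 0 \<Longrightarrow> \<exists>d>0. \<forall>y\<in>S. norm (y - x) < d \<longrightarrow>
       (\<forall>h. \<bar>f' y h - f' x h - B (y - x) h\<bar> \<le> e * norm (y - x) * norm h)"
    and B: "\<And>h. linear (\<lambda>u. B u h)"
  shows "B h k = B k h"
proof -
  obtain r where r: "r > 0" "ball x r \<subseteq> S" using S open_contains_ball by blast
  define \<Delta> where "\<Delta> t h k = f (x + t *\<^sub>R h + t *\<^sub>R k) - f (x + t *\<^sub>R h) - f (x + t *\<^sub>R k) + f x" for t h k
  have key: "\<exists>d>0. \<forall>t. 0 < t \<and> t < d \<longrightarrow>
      \<bar>\<Delta> t h k - t\<^sup>2 * B k h\<bar> \<le> 2 * e * t\<^sup>2 * (norm h + norm k)\<^sup>2" if e: "e > 0" for e h k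
  proof -
    obtain d where d: "d > 0" "\<And>y h. y \<in> S \<Longrightarrow> norm (y - x) < d \<Longrightarrow>
        \<bar>f' y h - f' x h - B (y - x) h\<bar> \<le> e * norm (y - x) * norm h"
      using f''[OF e] by blast
    define N where "N = norm h + norm k"
    define \<delta> where "\<delta> = min d r / (N + 1)"
    have N: "N \<ge> 0" "norm h \<le> N" by (auto simp: N_def)
    have \<delta>: "\<delta> > 0" using N d r by (auto simp: \<delta>_def)
    have "\<bar>\<Delta> t h k - t\<^sup>2 * B k h\<bar> \<le> 2 * e * t\<^sup>2 * N\<^sup>2" if t: "0 < t" "t < \<delta>" for t
    proof -
      have tN: "t * N < min d r"
      proof -
        have "t * N \<le> t * (N + 1)" using t by simp
        also have "\<dots> < \<delta> * (N + 1)" using t N by simp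
        finally show ?thesis using N by (simp add: \<delta>_def)
      qed
      have small: "norm (s *\<^sub>R h + c *\<^sub>R k) \<le> t * N" if "0 \<le> s" "s \<le> t" "0 \<le> c" "c \<le> t" for s c
      proof -
        have "norm (s *\<^sub>R h + c *\<^sub>R k) \<le> s * norm h + c * norm k"
          using norm_triangle_ineq[of "s *\<^sub>R h" "c *\<^sub>R k"] that by simp
        also have "\<dots> \<le> t * norm h + t * norm k"
          using that by (intro add_mono mult_right_mono) auto
        finally show ?thesis by (simp add: N_def algebra_simps)
      qed
      have shift: "x + s *\<^sub>R h + c *\<^sub>R k - x = s *\<^sub>R h + c *\<^sub>R k" for s c by simp
      have inS: "x + s *\<^sub>R h + c *\<^sub>R k \<in> S" if "0 \<le> s" "s \<le> t" "0 \<le> c" "c \<le> t" for s c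
      proof -
        have "dist x (x + s *\<^sub>R h + c *\<^sub>R k) = norm (s *\<^sub>R h + c *\<^sub>R k)"
          using shift[of s c] by (metis dist_commute dist_norm)
        then have "dist x (x + s *\<^sub>R h + c *\<^sub>R k) < r"
          using small[OF that] tN by simp
        then show ?thesis using r by auto
      qed
      have rem: "\<bar>f' (x + s *\<^sub>R h + c *\<^sub>R k) h - f' x h - B (s *\<^sub>R h + c *\<^sub>R k) h\<bar> \<le> e * (t * N * N)"
        if "0 \<le> s" "s \<le> t" "0 \<le> c" "c \<le> t" for s c
      proof -
        have "\<bar>f' (x + s *\<^sub>R h + c *\<^sub>R k) h - f' x h - B (s *\<^sub>R h + c *\<^sub>R k) h\<bar>
            \<le> e * norm (s *\<^sub>R h + c *\<^sub>R k) * norm h"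
          using d(2)[OF inS[OF that], of h, unfolded shift] small[OF that] tN by linarith
        also have "\<dots> \<le> e * (t * N) * N"
          using small[OF that] e N t by (intro mult_mono) auto
        finally show ?thesis by (simp add: mult.assoc)
      qed
      \<comment> \<open>With the increment in \<open>k\<close> frozen, \<open>\<Delta> t h k\<close>
        is \<open>g t - g 0\<close>. The remainder estimate at the two points in \<open>g'\<close>
        leaves \<open>t * B k h\<close>, since the contributions of \<open>f' x h\<close> and
        \<open>B (\<xi> *\<^sub>R h) h\<close> cancel.\<close>
      define g where "g s = f (x + s *\<^sub>R h + t *\<^sub>R k) - f (x + s *\<^sub>R h)" for s
      define g' where "g' s = f' (x + s *\<^sub>R h + t *\<^sub>R k) h - f' (x + s *\<^sub>R h) h" for s
      have g': "(g has_real_derivative g' s) (at s)" if s: "0 \<le> s" "s \<le> t" for s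
      proof -
        have aux: "((\<lambda>s. f (x + s *\<^sub>R h + c *\<^sub>R k)) has_real_derivative f' (x + s *\<^sub>R h + c *\<^sub>R k) h) (at s)"
          if "0 \<le> c" "c \<le> t" for c
        proof -
          have fd: "(f has_derivative f' (x + s *\<^sub>R h + c *\<^sub>R k)) (at (x + s *\<^sub>R h + c *\<^sub>R k))"
            by (rule f'[OF inS]) (use s that in auto)
          have "((\<lambda>s. f (x + s *\<^sub>R h + c *\<^sub>R k)) has_derivative (\<lambda>u. f' (x + s *\<^sub>R h + c *\<^sub>R k) (u *\<^sub>R h))) (at s)"
            by (rule has_derivative_compose[where f="\<lambda>s. x + s *\<^sub>R h + c *\<^sub>R k" and f'="\<lambda>u. u *\<^sub>R h" and g=f])
              (auto intro!: derivative_eq_intros fd)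
          moreover have "f' (x + s *\<^sub>R h + c *\<^sub>R k) (u *\<^sub>R h) = f' (x + s *\<^sub>R h + c *\<^sub>R k) h * u" for u
            using linear_scale[OF has_derivative_linear[OF fd]] by simp
          ultimately show ?thesis by (simp add: has_field_derivative_def)
        qed
        show ?thesis unfolding g_def g'_def
          using aux[of t] aux[of 0] t by (auto intro!: DERIV_diff)
      qed
      obtain \<xi> where \<xi>: "0 < \<xi>" "\<xi> < t" "g t - g 0 = (t - 0) * g' \<xi>"
        using MVT2[of 0 t g g'] t g' by auto
      have D: "\<Delta> t h k = t * g' \<xi>" using \<xi>(3) by (simp add: \<Delta>_def g_def)
      have "B (\<xi> *\<^sub>R h + t *\<^sub>R k) h = B (\<xi> *\<^sub>R h) h + t * B k h"
        using linear_add[OF B] linear_scale[OF B] by simp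
      then have "\<bar>g' \<xi> - t * B k h\<bar> \<le> 2 * (e * (t * N * N))"
        using rem[of \<xi> t] rem[of \<xi> 0] \<xi> t unfolding g'_def by auto
      then have "t * \<bar>g' \<xi> - t * B k h\<bar> \<le> t * (2 * (e * (t * N * N)))"
        using t by (intro mult_left_mono) auto
      moreover have "\<Delta> t h k - t\<^sup>2 * B k h = t * (g' \<xi> - t * B k h)"
        using D by (simp add: algebra_simps power2_eq_square)
      ultimately show ?thesis using t by (simp add: abs_mult power2_eq_square ac_simps)
    qed
    then show ?thesis using \<delta> unfolding N_def by blast
  qed
  define M where "M = (norm h + norm k)\<^sup>2"
  have "\<bar>B k h - B h k\<bar> \<le> 4 * e * M" if e: "e > 0" for e
  proof -
    obtain d1 where d1: "d1 > 0" "\<And>t. 0 < t \<Longrightarrow> t < d1 \<Longrightarrow> \<bar>\<Delta> t h k - t\<^sup>2 * B k h\<bar> \<le> 2 * e * t\<^sup>2 * M"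
      using key[OF e, of h k] unfolding M_def by blast
    obtain d2 where d2: "d2 > 0" "\<And>t. 0 < t \<Longrightarrow> t < d2 \<Longrightarrow> \<bar>\<Delta> t k h - t\<^sup>2 * B h k\<bar> \<le> 2 * e * t\<^sup>2 * M"
      using key[OF e, of k h] unfolding M_def by (metis add.commute)
    define t where "t = min d1 d2 / 2"
    have t: "0 < t" "t < d1" "t < d2" using d1(1) d2(1) by (auto simp: t_def)
    have "\<Delta> t h k = \<Delta> t k h" by (simp add: \<Delta>_def algebra_simps)
    then have "\<bar>t\<^sup>2 * B k h - t\<^sup>2 * B h k\<bar> \<le> t\<^sup>2 * (4 * e * M)"
      using d1(2)[of t] d2(2)[of t] t by (simp add: algebra_simps)
    then have "t\<^sup>2 * \<bar>B k h - B h k\<bar> \<le> t\<^sup>2 * (4 * e * M)"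
      by (simp add: right_diff_distrib[symmetric] abs_mult)
    then show ?thesis using t by simp
  qed
  then have "\<bar>B k h - B h k\<bar> \<le> 0 + e" if "e > 0" for e
  proof -
    have M: "M \<ge> 0" by (simp add: M_def)
    \<comment> \<open>Rescaling the tolerance by \<open>M + 1\<close> turns the bound
      \<open>4 * e * M\<close> into \<open>e\<close>, also when \<open>M = 0\<close>.\<close>
    have "\<bar>B k h - B h k\<bar> \<le> 4 * (e / (4 * (M + 1))) * M"
      using that M by (intro \<open>\<And>e. e > 0 \<Longrightarrow> \<bar>B k h - B h k\<bar> \<le> 4 * e * M\<close>) simp
    also have "\<dots> = e * (M / (M + 1))" using M by (simp add: field_simps)
    also have "\<dots> \<le> e * 1" using M that by (intro mult_left_mono) auto
    finally show ?thesis by simp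
  qed
  then have "\<bar>B k h - B h k\<bar> \<le> 0" by (rule field_le_epsilon)
  then show ?thesis by simp
qed

text \<open>Testing against every vector \<open>w\<close> reduces vector values to the scalar
  case.\<close>

lemma derivs_on_symmetric:
  fixes D :: "'a::real_normed_vector \<Rightarrow> 'a list \<Rightarrow> 'b::real_inner"
  assumes D: "derivs_on S D" "x \<in> S"
  shows "D x [h, k] = D x [k, h]"
proof -
  have "w \<bullet> D x [h, k] = w \<bullet> D x [k, h]" for w
  proof (rule symmetric_second_derivative[where S=S and f="\<lambda>y. w \<bullet> D y []" and f'="\<lambda>y h. w \<bullet> D y [h]" and x=x])
    show "((\<lambda>y. w \<bullet> D y []) has_derivative (\<lambda>h. w \<bullet> D y [h])) (at y)" if "y \<in> S" for y
      using derivs_on_has_derivative[OF D(1) that, of "[]"] by (intro derivative_intros)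
    show "linear (\<lambda>u. w \<bullet> D x [u, h])" for h
      using derivs_on_linear[OF D, of "[]" "[h]"]
      by (auto simp: linear_iff inner_add_right)
    fix e :: real assume e: "e > 0"
    obtain d where d: "d > 0" "\<And>y vs. y \<in> S \<Longrightarrow> norm (y - x) < d \<Longrightarrow> length vs = 1 \<Longrightarrow>
      norm (D y vs - D x vs - D x ((y - x) # vs)) \<le> e / (norm w + 1) * norm (y - x) * prod_list (map norm vs)"
      using derivs_on_remainder[OF D, of "e / (norm w + 1)" 1] e
      by (metis add_nonneg_pos divide_pos_pos norm_ge_zero zero_less_one)
    have "\<bar>w \<bullet> D y [h] - w \<bullet> D x [h] - w \<bullet> D x [y - x, h]\<bar> \<le> e * norm (y - x) * norm h"
      if y: "y \<in> S" "norm (y - x) < d" for y h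
    proof -
      have "\<bar>w \<bullet> D y [h] - w \<bullet> D x [h] - w \<bullet> D x [y - x, h]\<bar>
          = \<bar>w \<bullet> (D y [h] - D x [h] - D x [y - x, h])\<bar>" by (simp add: inner_diff_right)
      also have "\<dots> \<le> norm w * norm (D y [h] - D x [h] - D x [y - x, h])"
        by (rule Cauchy_Schwarz_ineq2)
      also have "\<dots> \<le> norm w * (e / (norm w + 1) * norm (y - x) * norm h)"
        using d(2)[OF y, of "[h]"] by (intro mult_left_mono) auto
      also have "\<dots> = norm w / (norm w + 1) * (e * norm (y - x) * norm h)" by simp
      also have "\<dots> \<le> 1 * (e * norm (y - x) * norm h)"
        using e norm_ge_zero[of w] by (intro mult_right_mono) (auto simp: divide_le_eq_1 add_nonneg_pos)
      finally show ?thesis by simp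
    qed
    then show "\<exists>d>0. \<forall>y\<in>S. norm (y - x) < d \<longrightarrow>
       (\<forall>h. \<bar>w \<bullet> D y [h] - w \<bullet> D x [h] - w \<bullet> D x [y - x, h]\<bar> \<le> e * norm (y - x) * norm h)"
      using d(1) by blast
  qed (use D derivs_on_open in auto)
  then show ?thesis by (metis inner_commute vector_eq_ldot)
qed

section \<open>Analytic tools\<close>

text \<open>After multiplication by the integrating factor \<open>exp (- C * s)\<close> the function
  has nonpositive derivative.\<close>

lemma gronwall_nonpos:
  fixes f f' :: "real \<Rightarrow> real"
  assumes f: "\<And>t. t \<in> {a..b} \<Longrightarrow> (f has_real_derivative f' t) (at t within {a..b})"
    and le: "\<And>t. t \<in> {a..b} \<Longrightarrow> f' t \<le> C * f t"
    and "f a \<le> 0" and t: "t \<in> {a..b}"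
  shows "f t \<le> 0"
proof (cases "a < t")
  case True
  define h where "h s = exp (- C * s) * f s" for s
  have h: "(h has_real_derivative exp (- C * s) * (f' s - C * f s)) (at s within {a..t})" if "s \<in> {a..t}" for s
  proof -
    have "(f has_real_derivative f' s) (at s within {a..t})"
      using f[of s] that t by (auto intro: DERIV_subset)
    then show ?thesis unfolding h_def
      by (auto intro!: derivative_eq_intros simp: algebra_simps)
  qed
  obtain x where x: "x \<in> {a<..<t}" "h t - h a = (t - a) * (exp (- C * x) * (f' x - C * f x))"
    using mvt_simple[OF True, of h "\<lambda>s d. d * (exp (- C * s) * (f' s - C * f s))"] h
    by (auto simp: has_field_derivative_def mult_commute_abs)
  have "(t - a) * (exp (- C * x) * (f' x - C * f x)) \<le> 0"
    using le[of x] x(1) t by (intro mult_nonneg_nonpos) auto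
  then have "h t \<le> h a" using x by simp
  also have "\<dots> \<le> 0" using assms(3) by (simp add: h_def mult_nonneg_nonpos)
  finally show ?thesis by (simp add: h_def mult_le_0_iff)
qed (use assms in auto)

text \<open>The equation is kept in the weak form in which \<open>geodesic_on\<close> states it, not
  solved for the second derivative. Coercivity of \<open>G\<close> replaces inversion: testing with
  the difference of the second derivatives bounds that difference by those of position and velocity,
  and Gronwall applies.\<close>

lemma second_order_ode_unique:
  fixes y1 y2 v1 v2 z1 z2 :: "real \<Rightarrow> 'h::real_inner"
    and G :: "'h \<Rightarrow> 'h \<Rightarrow> 'h \<Rightarrow> real" and Ch :: "'h \<Rightarrow> 'h \<Rightarrow> 'h \<Rightarrow> 'h \<Rightarrow> real"
  assumes y1: "\<And>t. t \<in> {a..b} \<Longrightarrow> (y1 has_vector_derivative v1 t) (at t within {a..b})"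
    and y2: "\<And>t. t \<in> {a..b} \<Longrightarrow> (y2 has_vector_derivative v2 t) (at t within {a..b})"
    and v1: "\<And>t. t \<in> {a..b} \<Longrightarrow> (v1 has_vector_derivative z1 t) (at t within {a..b})"
    and v2: "\<And>t. t \<in> {a..b} \<Longrightarrow> (v2 has_vector_derivative z2 t) (at t within {a..b})"
    and B1: "\<And>t. t \<in> {a..b} \<Longrightarrow> y1 t \<in> B" and B2: "\<And>t. t \<in> {a..b} \<Longrightarrow> y2 t \<in> B"
    and eq1: "\<And>t w. t \<in> {a..b} \<Longrightarrow> G (y1 t) (z1 t) w + Ch (y1 t) (v1 t) (v1 t) w = 0"
    and eq2: "\<And>t w. t \<in> {a..b} \<Longrightarrow> G (y2 t) (z2 t) w + Ch (y2 t) (v2 t) (v2 t) w = 0"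
    and G_diff: "\<And>x u u' w. x \<in> B \<Longrightarrow> G x (u - u') w = G x u w - G x u' w"
    and G_lip: "\<And>x y u w. x \<in> B \<Longrightarrow> y \<in> B \<Longrightarrow> \<bar>G x u w - G y u w\<bar> \<le> L * norm (x - y) * norm u * norm w"
    and G_pos: "\<And>x u. x \<in> B \<Longrightarrow> k * (norm u)\<^sup>2 \<le> G x u u" and k: "k > 0"
    and Ch_diff1: "\<And>x u u' v w. x \<in> B \<Longrightarrow> Ch x (u - u') v w = Ch x u v w - Ch x u' v w"
    and Ch_diff2: "\<And>x u v v' w. x \<in> B \<Longrightarrow> Ch x u (v - v') w = Ch x u v w - Ch x u v' w"
    and Ch_lip: "\<And>x y u v w. x \<in> B \<Longrightarrow> y \<in> B \<Longrightarrow>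
        \<bar>Ch x u v w - Ch y u v w\<bar> \<le> L * norm (x - y) * norm u * norm v * norm w"
    and Ch_bound: "\<And>x u v w. x \<in> B \<Longrightarrow> \<bar>Ch x u v w\<bar> \<le> M * norm u * norm v * norm w"
    and L: "L \<ge> 0" and M: "M \<ge> 0"
    and init: "y1 a = y2 a" "v1 a = v2 a" and t: "t \<in> {a..b}"
  shows "y1 t = y2 t \<and> v1 t = v2 t"
proof -
  have "continuous_on {a..b} v1" "continuous_on {a..b} v2"
    using v1 v2 has_vector_derivative_continuous
    unfolding continuous_on_eq_continuous_within by blast+
  then have "bounded (v1 ` {a..b} \<union> v2 ` {a..b})"
    by (simp add: compact_continuous_image compact_imp_bounded)
  then obtain V where V: "V > 0" "\<And>t. t \<in> {a..b} \<Longrightarrow> norm (v1 t) \<le> V" "\<And>t. t \<in> {a..b} \<Longrightarrow> norm (v2 t) \<le> V"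
    unfolding bounded_pos by auto
  \<comment> \<open>Testing the second equation with \<open>z2 t\<close> itself and using coercivity
    bounds the acceleration. Only \<open>z2\<close> is needed, because the change of
    \<open>G\<close> between the two curves is paired with \<open>z2\<close> below.\<close>
  define Z where "Z = M * V\<^sup>2 / k"
  have z2: "norm (z2 t) \<le> Z" if t: "t \<in> {a..b}" for t
  proof (cases "z2 t = 0")
    case False
    have "k * (norm (z2 t))\<^sup>2 \<le> G (y2 t) (z2 t) (z2 t)" using G_pos B2[OF t] by blast
    also have "\<dots> = - Ch (y2 t) (v2 t) (v2 t) (z2 t)" using eq2[OF t, of "z2 t"] by simp
    also have "\<dots> \<le> M * norm (v2 t) * norm (v2 t) * norm (z2 t)"
      using Ch_bound[OF B2[OF t], of "v2 t" "v2 t" "z2 t"] by linarith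
    also have "\<dots> \<le> M * V * V * norm (z2 t)"
      using V(1) V(3)[OF t] M by (intro mult_mono) auto
    finally have "(k * norm (z2 t)) * norm (z2 t) \<le> (M * V\<^sup>2) * norm (z2 t)"
      by (simp add: power2_eq_square ac_simps)
    then have "k * norm (z2 t) \<le> M * V\<^sup>2" using False by (simp only: mult_le_cancel_right) auto
    then show ?thesis using k by (simp add: Z_def field_simps)
  qed (use M k V in \<open>auto simp: Z_def\<close>)
  have Z: "Z \<ge> 0" using M k by (simp add: Z_def)
  \<comment> \<open>\<open>c1\<close> collects the Lipschitz terms of \<open>Ch\<close> and
    \<open>G\<close>; \<open>c2\<close> collects the two terms in which one velocity argument of
    \<open>Ch\<close> is varied.\<close>
  define c1 where "c1 = (L * V\<^sup>2 + L * Z) / k"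
  define c2 where "c2 = 2 * M * V / k"
  have c: "c1 \<ge> 0" "c2 \<ge> 0" using L M V Z k by (auto simp: c1_def c2_def)
  have dz: "norm (z1 t - z2 t) \<le> c1 * norm (y1 t - y2 t) + c2 * norm (v1 t - v2 t)"
    if t: "t \<in> {a..b}" for t
  proof (cases "z1 t = z2 t")
    case False
    let ?w = "z1 t - z2 t" and ?dy = "y1 t - y2 t" and ?dv = "v1 t - v2 t"
    note b = B1[OF t] B2[OF t]
    have "k * (norm ?w)\<^sup>2 \<le> G (y1 t) ?w ?w" using G_pos b by blast
    also have "\<dots> = G (y1 t) (z1 t) ?w - G (y2 t) (z2 t) ?w + (G (y2 t) (z2 t) ?w - G (y1 t) (z2 t) ?w)"
      using G_diff b by simp
    also have "\<dots> = (Ch (y2 t) (v2 t) (v2 t) ?w - Ch (y1 t) (v2 t) (v2 t) ?w)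
        - Ch (y1 t) ?dv (v1 t) ?w - Ch (y1 t) (v2 t) ?dv ?w + (G (y2 t) (z2 t) ?w - G (y1 t) (z2 t) ?w)"
      using eq1[OF t, of ?w] eq2[OF t, of ?w] Ch_diff1 Ch_diff2 b by simp
    also have "\<dots> \<le> L * norm ?dy * norm (v2 t) * norm (v2 t) * norm ?w
        + M * norm ?dv * norm (v1 t) * norm ?w + M * norm (v2 t) * norm ?dv * norm ?w
        + L * norm ?dy * norm (z2 t) * norm ?w"
      using Ch_lip[OF b(2,1), of "v2 t" "v2 t" ?w] Ch_bound[OF b(1), of ?dv "v1 t" ?w]
        Ch_bound[OF b(1), of "v2 t" ?dv ?w] G_lip[OF b(2,1), of "z2 t" ?w]
      by (simp add: norm_minus_commute[of "y2 t"])
    also have "\<dots> \<le> L * norm ?dy * V * V * norm ?w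
        + M * norm ?dv * V * norm ?w + M * V * norm ?dv * norm ?w
        + L * norm ?dy * Z * norm ?w"
      using V(2,3)[OF t] V(1) L M z2[OF t] Z by (intro add_mono mult_mono) auto
    also have "\<dots> = (k * (c1 * norm ?dy + c2 * norm ?dv)) * norm ?w"
      using k by (simp add: c1_def c2_def field_simps power2_eq_square)
    finally have "(k * norm ?w) * norm ?w \<le> (k * (c1 * norm ?dy + c2 * norm ?dv)) * norm ?w"
      by (simp add: power2_eq_square ac_simps)
    then have "k * norm ?w \<le> k * (c1 * norm ?dy + c2 * norm ?dv)"
      using False by (simp only: mult_le_cancel_right) auto
    then show ?thesis using k by simp
  qed (use c in auto)
  \<comment> \<open>The squared distance of the two solutions in phase space. By Cauchy-Schwarz,
    \<open>dz\<close> and 2ab \<le> a^2 + b^2 its derivative is at most a constant multiple of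
    it.\<close>
  define f where "f s = (y1 s - y2 s) \<bullet> (y1 s - y2 s) + (v1 s - v2 s) \<bullet> (v1 s - v2 s)" for s
  define f' where "f' s = 2 * ((y1 s - y2 s) \<bullet> (v1 s - v2 s)) + 2 * ((v1 s - v2 s) \<bullet> (z1 s - z2 s))" for s
  have "f t \<le> 0"
  proof (rule gronwall_nonpos[where f=f and f'=f' and C="1 + c1 + 2 * c2"])
    fix s assume s: "s \<in> {a..b}"
    have ip: "((\<lambda>s. u s \<bullet> u s) has_real_derivative 2 * (u s \<bullet> u')) (at s within {a..b})"
      if "(u has_vector_derivative u') (at s within {a..b})" for u :: "real \<Rightarrow> 'h" and u'
      using has_derivative_inner[OF that[unfolded has_vector_derivative_def] that[unfolded has_vector_derivative_def]]
      unfolding has_field_derivative_def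
      by (rule has_derivative_eq_rhs) (auto simp: fun_eq_iff inner_commute)
    show "(f has_real_derivative f' s) (at s within {a..b})"
      unfolding f_def f'_def
      by (intro DERIV_add ip has_vector_derivative_diff y1 y2 v1 v2 s)
    have "(y1 s - y2 s) \<bullet> (v1 s - v2 s) \<le> norm (y1 s - y2 s) * norm (v1 s - v2 s)"
      by (rule norm_cauchy_schwarz)
    moreover have "(v1 s - v2 s) \<bullet> (z1 s - z2 s) \<le> norm (v1 s - v2 s) * (c1 * norm (y1 s - y2 s) + c2 * norm (v1 s - v2 s))"
      using norm_cauchy_schwarz[of "v1 s - v2 s" "z1 s - z2 s"] dz[OF s]
      by (meson mult_left_mono norm_ge_zero order_trans)
    ultimately have "f' s \<le> (1 + c1) * (2 * norm (y1 s - y2 s) * norm (v1 s - v2 s)) + 2 * c2 * (norm (v1 s - v2 s))\<^sup>2"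
      unfolding f'_def by (simp add: algebra_simps power2_eq_square)
    also have "\<dots> \<le> (1 + c1) * ((norm (y1 s - y2 s))\<^sup>2 + (norm (v1 s - v2 s))\<^sup>2)
        + 2 * c2 * ((norm (y1 s - y2 s))\<^sup>2 + (norm (v1 s - v2 s))\<^sup>2)"
      using c by (intro add_mono mult_left_mono sum_squares_bound) auto
    also have "\<dots> = (1 + c1 + 2 * c2) * f s"
      by (simp add: f_def power2_norm_eq_inner algebra_simps)
    finally show "f' s \<le> (1 + c1 + 2 * c2) * f s" .
  qed (use init t in \<open>auto simp: f_def\<close>)
  moreover have "(y1 t - y2 t) \<bullet> (y1 t - y2 t) \<ge> 0" "(v1 t - v2 t) \<bullet> (v1 t - v2 t) \<ge> 0" by simp_all
  ultimately have "(y1 t - y2 t) \<bullet> (y1 t - y2 t) = 0" "(v1 t - v2 t) \<bullet> (v1 t - v2 t) = 0"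
    unfolding f_def by linarith+
  then show ?thesis by simp
qed

section \<open>First-order flatness of a pulled-back bilinear form\<close>

lemma blinfun2_bound:
  fixes G :: "'h::real_normed_vector \<Rightarrow>\<^sub>L 'h \<Rightarrow>\<^sub>L real"
  shows "\<bar>blinfun_apply (blinfun_apply G u) v\<bar> \<le> norm G * norm u * norm v"
proof -
  have "\<bar>blinfun_apply (blinfun_apply G u) v\<bar> \<le> norm (blinfun_apply G u) * norm v"
    using norm_blinfun[of "blinfun_apply G u" v] by simp
  also have "\<dots> \<le> norm G * norm u * norm v"
    by (intro mult_right_mono norm_blinfun) simp
  finally show ?thesis .
qed

text \<open>The hypothesis \<open>canc\<close> says that the derivative at \<open>0\<close> of the pulled-back form
  \<open>a \<mapsto> Gh a (T a b) (T a b)\<close> vanishes.\<close>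

lemma pullback_form_flat:
  fixes Gh :: "'h::real_normed_vector \<Rightarrow> 'h \<Rightarrow>\<^sub>L 'h \<Rightarrow>\<^sub>L real" and T B :: "'h \<Rightarrow> 'h \<Rightarrow> 'h"
  assumes Gh: "(Gh has_derivative DG) (at 0)"
    and T: "\<And>e. e > 0 \<Longrightarrow> \<exists>d>0. \<forall>a. norm a < d \<longrightarrow> (\<forall>b. norm (T a b - b - B a b) \<le> e * norm a * norm b)"
    and B: "\<And>a b. norm (B a b) \<le> K * norm a * norm b" and K: "K \<ge> 0"
    and sym: "\<And>u v. blinfun_apply (blinfun_apply (Gh 0) u) v = blinfun_apply (blinfun_apply (Gh 0) v) u"
    and canc: "\<And>a b. 2 * blinfun_apply (blinfun_apply (Gh 0) (B a b)) b + blinfun_apply (blinfun_apply (DG a) b) b = 0"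
    and e: "e > 0"
  obtains d where "d > 0" "\<And>a b. norm a < d \<Longrightarrow>
    \<bar>blinfun_apply (blinfun_apply (Gh a) (T a b)) (T a b) - blinfun_apply (blinfun_apply (Gh 0) b) b\<bar>
      \<le> e * norm a * (norm b)\<^sup>2"
proof -
  define M where "M = norm (Gh 0)"
  obtain M' where M': "M' > 0" "\<And>a. norm (DG a) \<le> norm a * M'"
    using bounded_linear.pos_bounded[OF has_derivative_bounded_linear[OF Gh]] by blast
  have M: "M \<ge> 0" by (simp add: M_def)
  \<comment> \<open>\<open>4 + 2 * M\<close> is the coefficient of \<open>e1\<close> in the final
    sum: 4 from the remainder of \<open>Gh\<close> on vectors of norm at most \<open>2 * N\<close>,
    and \<open>2 * M\<close> from the remainder of \<open>T\<close>, which occurs twice by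
    symmetry.\<close>
  define e1 where "e1 = min 1 (e / (2 * (4 + 2 * M)))"
  have e1: "e1 > 0" "e1 \<le> 1" "e1 * (4 + 2 * M) \<le> e / 2"
  proof -
    show "e1 > 0" "e1 \<le> 1" using e M by (auto simp: e1_def)
    have "e1 * (4 + 2 * M) \<le> e / (2 * (4 + 2 * M)) * (4 + 2 * M)"
      using M by (intro mult_right_mono) (auto simp: e1_def)
    also have "\<dots> = e / 2" using M by (simp add: field_simps)
    finally show "e1 * (4 + 2 * M) \<le> e / 2" .
  qed
  obtain d1 where d1: "d1 > 0" "\<And>a b. norm a < d1 \<Longrightarrow> norm (T a b - b - B a b) \<le> e1 * norm a * norm b"
    using T[OF e1(1)] by blast
  obtain d2 where d2: "d2 > 0" "\<And>a. norm a < d2 \<Longrightarrow> norm (Gh a - Gh 0 - DG a) \<le> e1 * norm a"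
    using Gh e1(1) unfolding has_derivative_at_alt by (metis diff_zero)
  \<comment> \<open>The total coefficient of the terms quadratic in \<open>a\<close>; they come from
    \<open>t2\<close>, \<open>t3\<close> and \<open>t5\<close>.\<close>
  define Q where "Q = 3 * M' * (K + 1) + M * (K + 1)\<^sup>2"
  have Q: "Q > 0" using M M' K by (auto simp: Q_def intro!: add_pos_nonneg)
  \<comment> \<open>\<open>1 / (K + 1)\<close> gives \<open>norm \<delta> \<le> N\<close>, and
    \<open>e / (2 * Q)\<close> limits the quadratic terms to the half of \<open>e\<close> that
    \<open>e1\<close> leaves free.\<close>
  define d where "d = min (min d1 d2) (min (1 / (K + 1)) (e / (2 * Q)))"
  have d: "d > 0" using d1 d2 K e Q by (simp add: d_def)
  have "\<bar>blinfun_apply (blinfun_apply (Gh a) (T a b)) (T a b) - blinfun_apply (blinfun_apply (Gh 0) b) b\<bar>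
      \<le> e * norm a * (norm b)\<^sup>2" if a: "norm a < d" for a b
  proof -
    define u where "u = T a b"
    define \<delta> where "\<delta> = u - b"
    define \<eta> where "\<eta> = u - b - B a b"
    define A where "A = norm a"
    define N where "N = norm b"
    have AN: "A \<ge> 0" "N \<ge> 0" by (auto simp: A_def N_def)
    have Asm: "A < d1" "A < d2" "A < 1 / (K + 1)" "A < e / (2 * Q)"
      using a by (auto simp: d_def A_def)
    have KA: "(K + 1) * A \<le> 1" using Asm(3) K by (simp add: field_simps)
    have \<eta>: "norm \<eta> \<le> e1 * A * N" using d1(2) Asm by (simp add: \<eta>_def u_def A_def N_def)
    have \<delta>: "norm \<delta> \<le> (K + 1) * A * N"
    proof -
      have "norm \<delta> \<le> norm \<eta> + norm (B a b)"
        using norm_triangle_ineq[of \<eta> "B a b"] by (simp add: \<delta>_def \<eta>_def)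
      also have "\<dots> \<le> 1 * A * N + K * A * N"
        using \<eta> B[of a b] mult_right_mono[OF e1(2), of "A * N"] AN by (simp add: A_def N_def mult.assoc)
      finally show ?thesis by (simp add: algebra_simps)
    qed
    have \<delta>N: "norm \<delta> \<le> N" using \<delta> mult_right_mono[OF KA AN(2)] by linarith
    have u: "norm u \<le> 2 * N"
      using norm_triangle_ineq[of b \<delta>] \<delta>N by (simp add: \<delta>_def N_def)
    let ?ap = "\<lambda>H x y. blinfun_apply (blinfun_apply H x) y"
    have t1: "\<bar>?ap (Gh a - Gh 0 - DG a) u u\<bar> \<le> e1 * A * (2 * N) * (2 * N)"
    proof -
      have "\<bar>?ap (Gh a - Gh 0 - DG a) u u\<bar> \<le> norm (Gh a - Gh 0 - DG a) * norm u * norm u"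
        by (rule blinfun2_bound)
      also have "\<dots> \<le> e1 * A * (2 * N) * (2 * N)"
        using d2(2)[of a] Asm u AN e1 by (intro mult_mono) (auto simp: A_def)
      finally show ?thesis .
    qed
    have t2: "\<bar>?ap (DG a) \<delta> u\<bar> \<le> (A * M') * ((K + 1) * A * N) * (2 * N)"
    proof -
      have "\<bar>?ap (DG a) \<delta> u\<bar> \<le> norm (DG a) * norm \<delta> * norm u" by (rule blinfun2_bound)
      also have "\<dots> \<le> (A * M') * ((K + 1) * A * N) * (2 * N)"
        using M'(2)[of a] \<delta> u AN M'(1) K by (intro mult_mono) (auto simp: A_def)
      finally show ?thesis .
    qed
    have t3: "\<bar>?ap (DG a) b \<delta>\<bar> \<le> (A * M') * N * ((K + 1) * A * N)"
    proof -
      have "\<bar>?ap (DG a) b \<delta>\<bar> \<le> norm (DG a) * norm b * norm \<delta>" by (rule blinfun2_bound)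
      also have "\<dots> \<le> (A * M') * N * ((K + 1) * A * N)"
        using M'(2)[of a] \<delta> AN M'(1) K by (intro mult_mono) (auto simp: A_def N_def)
      finally show ?thesis .
    qed
    have t4: "\<bar>?ap (Gh 0) \<eta> b\<bar> \<le> M * (e1 * A * N) * N"
    proof -
      have "\<bar>?ap (Gh 0) \<eta> b\<bar> \<le> norm (Gh 0) * norm \<eta> * norm b" by (rule blinfun2_bound)
      also have "\<dots> \<le> M * (e1 * A * N) * N"
        using \<eta> AN e1 by (intro mult_mono) (auto simp: M_def N_def)
      finally show ?thesis .
    qed
    have t5: "\<bar>?ap (Gh 0) \<delta> \<delta>\<bar> \<le> M * ((K + 1) * A * N) * ((K + 1) * A * N)"
    proof -
      have "\<bar>?ap (Gh 0) \<delta> \<delta>\<bar> \<le> norm (Gh 0) * norm \<delta> * norm \<delta>" by (rule blinfun2_bound)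
      also have "\<dots> \<le> M * ((K + 1) * A * N) * ((K + 1) * A * N)"
        using \<delta> AN K by (intro mult_mono) (auto simp: M_def)
      finally show ?thesis .
    qed
    have u_eq: "u = b + \<delta>" and \<delta>_eq: "\<delta> = B a b + \<eta>" by (auto simp: \<delta>_def \<eta>_def)
    have e0: "?ap (Gh a) u u = ?ap (Gh a - Gh 0 - DG a) u u + ?ap (Gh 0) u u + ?ap (DG a) u u"
      by (simp add: blinfun.bilinear_simps)
    have e1': "?ap (DG a) u u = ?ap (DG a) \<delta> u + ?ap (DG a) b \<delta> + ?ap (DG a) b b"
      by (simp add: u_eq blinfun.bilinear_simps)
    have e2: "?ap (Gh 0) u u = ?ap (Gh 0) b b + 2 * ?ap (Gh 0) \<delta> b + ?ap (Gh 0) \<delta> \<delta>"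
      using sym[of b \<delta>] by (simp add: u_eq blinfun.bilinear_simps)
    have e3: "?ap (Gh 0) \<delta> b = ?ap (Gh 0) (B a b) b + ?ap (Gh 0) \<eta> b"
      unfolding \<delta>_eq by (simp add: blinfun.bilinear_simps)
    \<comment> \<open>Here \<open>canc\<close> removes the two terms of first order in
      \<open>a\<close>, namely \<open>2 * ?ap (Gh 0) (B a b) b\<close> and
      \<open>?ap (DG a) b b\<close>; each remaining term is quadratic in \<open>a\<close> or carries
      a remainder.\<close>
    have "?ap (Gh a) u u - ?ap (Gh 0) b b = ?ap (Gh a - Gh 0 - DG a) u u
        + ?ap (DG a) \<delta> u + ?ap (DG a) b \<delta> + 2 * ?ap (Gh 0) \<eta> b + ?ap (Gh 0) \<delta> \<delta>"
      using e0 e1' e2 e3 canc[of a b] by linarith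
    then have "\<bar>?ap (Gh a) u u - ?ap (Gh 0) b b\<bar> \<le> e1 * A * (2 * N) * (2 * N)
       + (A * M') * ((K + 1) * A * N) * (2 * N) + (A * M') * N * ((K + 1) * A * N)
       + 2 * (M * (e1 * A * N) * N) + M * ((K + 1) * A * N) * ((K + 1) * A * N)"
      using t1 t2 t3 t4 t5 by linarith
    also have "\<dots> = (e1 * (4 + 2 * M) + Q * A) * (A * N\<^sup>2)"
      by (simp add: Q_def power2_eq_square algebra_simps)
    also have "\<dots> \<le> (e / 2 + e / 2) * (A * N\<^sup>2)"
      using e1(3) Asm(4) Q AN by (intro mult_right_mono add_mono) (auto simp: field_simps)
    finally show ?thesis by (simp add: u_def A_def N_def mult.assoc)
  qed
  then show ?thesis using that d by blast
qed

section \<open>Continuous induction, little-o functions, Cauchy-Schwarz\<close>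

text \<open>The infimum of the times where \<open>Q\<close> fails satisfies \<open>Q\<close> by
  \<open>lim\<close>, and then \<open>ext\<close> keeps failures away from it. There is no separate
  base case, since at \<open>a\<close> the premise of \<open>lim\<close> is vacuous. Used both for
  uniqueness of geodesics and for confining short curves.\<close>

lemma real_interval_induct:
  fixes a b :: real
  assumes lim: "\<And>t. t \<in> {a..b} \<Longrightarrow> (\<And>s. a \<le> s \<Longrightarrow> s < t \<Longrightarrow> Q s) \<Longrightarrow> Q t"
    and ext: "\<And>t. a \<le> t \<Longrightarrow> t < b \<Longrightarrow> (\<And>s. a \<le> s \<Longrightarrow> s \<le> t \<Longrightarrow> Q s) \<Longrightarrow>
      \<exists>d>0. \<forall>s. t < s \<and> s < t + d \<and> s \<le> b \<longrightarrow> Q s"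
    and t: "t \<in> {a..b}"
  shows "Q t"
proof (rule ccontr)
  assume "\<not> Q t"
  define X where "X = {t\<in>{a..b}. \<not> Q t}"
  define T where "T = Inf X"
  have X: "X \<noteq> {}" "bdd_below X" using \<open>\<not> Q t\<close> t by (auto simp: X_def intro: bdd_belowI[of _ a])
  have T: "a \<le> T" "T \<le> t"
    using X \<open>\<not> Q t\<close> t by (auto simp: T_def X_def intro!: cInf_greatest cInf_lower)
  have below: "Q s" if "a \<le> s" "s < T" for s
  proof (rule ccontr)
    assume "\<not> Q s"
    then have "s \<in> X" using that T t by (auto simp: X_def)
    then show False using cInf_lower[OF _ X(2)] that by (force simp: T_def)
  qed
  have QT: "Q T" by (rule lim) (use T t below in auto)
  then have "T < b" using T t \<open>\<not> Q t\<close> by (cases "T = t") auto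
  moreover have "Q s" if "a \<le> s" "s \<le> T" for s using that below QT by (cases "s = T") auto
  ultimately obtain d where d: "d > 0" "\<And>s. T < s \<Longrightarrow> s < T + d \<Longrightarrow> s \<le> b \<Longrightarrow> Q s"
    using ext[of T] T by blast
  have "Inf X < T + d" using d by (simp add: T_def)
  then obtain s where s: "s \<in> X" "s < T + d" using cInf_lessD[OF X(1)] by blast
  have "T \<le> s" using cInf_lower[OF s(1) X(2)] by (simp add: T_def)
  moreover have "s \<noteq> T" using s QT by (auto simp: X_def)
  ultimately show False using d(2)[of s] s by (auto simp: X_def)
qed

text \<open>Interchanges quantifiers: bounds that hold for each \<open>e\<close>, on a range of
  \<open>r\<close> depending on \<open>e\<close>, become one bound with a single function of order
  o(r). The function is essentially \<open>r\<close> times the best admissible \<open>e\<close> at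
  radius \<open>r\<close>.\<close>

lemma little_o_witness:
  fixes P :: "real \<Rightarrow> real \<Rightarrow> bool"
  assumes ev: "\<And>e. e > 0 \<Longrightarrow> \<forall>\<^sub>F r in at_right 0. P r (e * r)"
    and mono: "\<And>r d d'. P r d \<Longrightarrow> 0 < d \<Longrightarrow> d \<le> d' \<Longrightarrow> P r d'"
  obtains \<rho> where "((\<lambda>r. \<rho> r / r) \<longlongrightarrow> 0) (at_right 0)" "\<And>r. r > 0 \<Longrightarrow> 0 \<le> \<rho> r"
    "\<forall>\<^sub>F r in at_right 0. P r (\<rho> r)"
proof -
  define X where "X r = {e. e > 0 \<and> P r (e * r)}" for r
  \<comment> \<open>Adding \<open>r\<close> lifts the value strictly above the infimum, so an
    admissible \<open>e\<close> lies below it and \<open>mono\<close> applies; the summand itself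
    tends to 0.\<close>
  define \<epsilon> where "\<epsilon> r = Inf (X r) + r" for r
  have bdd: "bdd_below (X r)" for r by (auto simp: X_def intro: bdd_belowI[of _ 0])
  have pos: "\<forall>\<^sub>F r::real in at_right 0. r > 0" by (simp add: eventually_at_right_less)
  have lt: "\<forall>\<^sub>F r::real in at_right 0. r < e" if "e > 0" for e
    using that eventually_at_right_field by blast
  have small: "\<forall>\<^sub>F r in at_right 0. \<epsilon> r < e" if e: "e > 0" for e
    using ev[OF half_gt_zero[OF e]] lt[OF half_gt_zero[OF e]]
  proof eventually_elim
    case (elim r)
    then have "e / 2 \<in> X r" using e by (simp add: X_def)
    then have "Inf (X r) \<le> e / 2" using bdd by (rule cInf_lower)
    then show ?case using elim by (simp add: \<epsilon>_def)
  qed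
  have good: "\<forall>\<^sub>F r in at_right 0. P r (\<epsilon> r * r) \<and> \<epsilon> r \<ge> 0"
    using ev[OF zero_less_one] pos
  proof eventually_elim
    case (elim r)
    then have ne: "X r \<noteq> {}" by (auto simp: X_def intro!: exI[of _ 1])
    have ge: "Inf (X r) \<ge> 0" using ne by (intro cInf_greatest) (auto simp: X_def)
    have "Inf (X r) < \<epsilon> r" using elim by (simp add: \<epsilon>_def)
    then obtain e where e: "e \<in> X r" "e < \<epsilon> r" using cInf_lessD[OF ne] by blast
    then have "P r (\<epsilon> r * r)"
      using elim by (intro mono[of r "e * r" "\<epsilon> r * r"]) (auto simp: X_def)
    then show ?case using ge elim by (simp add: \<epsilon>_def)
  qed
  \<comment> \<open>Where \<open>X r\<close> is empty its infimum is an unspecified real; the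
    maximum with 0 keeps \<open>\<rho>\<close> nonnegative there as well.\<close>
  define \<rho> where "\<rho> r = max 0 (\<epsilon> r) * r" for r
  show ?thesis
  proof (rule that[of \<rho>])
    have "((\<lambda>r. max 0 (\<epsilon> r)) \<longlongrightarrow> 0) (at_right 0)"
    proof (rule order_tendstoI)
      fix e :: real assume "0 < e"
      show "\<forall>\<^sub>F r in at_right 0. max 0 (\<epsilon> r) < e"
        using small[OF \<open>0 < e\<close>] by eventually_elim (use \<open>0 < e\<close> in auto)
    qed (auto simp: less_max_iff_disj)
    moreover have "\<forall>\<^sub>F r in at_right 0. max 0 (\<epsilon> r) = \<rho> r / r"
      using pos by eventually_elim (auto simp: \<rho>_def)
    ultimately show "((\<lambda>r. \<rho> r / r) \<longlongrightarrow> 0) (at_right 0)"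
      using tendsto_cong by fast
    show "\<forall>\<^sub>F r in at_right 0. P r (\<rho> r)"
      using good by eventually_elim (auto simp: \<rho>_def max_def)
  qed (auto simp: \<rho>_def)
qed

lemma form_cauchy_schwarz:
  fixes f :: "'h::real_vector \<Rightarrow> 'h \<Rightarrow> real"
  assumes f: "\<And>v. linear (\<lambda>u. f u v)" and sym: "\<And>u v. f u v = f v u" and pos: "\<And>u. u \<noteq> 0 \<Longrightarrow> f u u > 0"
  shows "\<bar>f u v\<bar> \<le> sqrt (f u u) * sqrt (f v v)"
proof (cases "v = 0")
  case True
  then have "f u v = 0" using linear_0[OF f] sym by metis
  then show ?thesis using True linear_0[OF f] by simp
next
  case False
  have lin: "f (x + y) z = f x z + f y z" "f z (x + y) = f z x + f z y" "f (c *\<^sub>R x) z = c * f x z" "f z (c *\<^sub>R x) = c * f z x" for x y z c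
    using linear_add[OF f] linear_scale[OF f] sym by (metis real_scaleR_def)+
  have nonneg: "f x x \<ge> 0" for x using pos[of x] lin(3)[of 0 0 0] by (cases "x = 0") auto
  \<comment> \<open>The minimiser of the quadratic polynomial
    \<open>f (u + t *\<^sub>R v) (u + t *\<^sub>R v)\<close> in \<open>t\<close>.\<close>
  define t where "t = - f u v / f v v"
  have fv: "f v v > 0" using pos False by blast
  have "0 \<le> f (u + t *\<^sub>R v) (u + t *\<^sub>R v)" by (rule nonneg)
  also have "\<dots> = f u u + 2 * t * f u v + t\<^sup>2 * f v v"
    using sym[of v u] by (simp add: lin power2_eq_square algebra_simps)
  also have "\<dots> = f u u - (f u v)\<^sup>2 / f v v"
    using fv by (simp add: t_def field_simps power2_eq_square)
  finally have "(f u v)\<^sup>2 \<le> f u u * f v v" using fv by (simp add: field_simps)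
  then have "sqrt ((f u v)\<^sup>2) \<le> sqrt (f u u * f v v)" by (rule real_sqrt_le_mono)
  then show ?thesis by (simp add: real_sqrt_mult)
qed

section \<open>Charts, tangent vectors and the metric\<close>

lemma smooth_on_open: "smooth_on S f \<Longrightarrow> open S"
  by (simp add: smooth_on_def)

lemma charts_atD: "c \<in> charts_at A q \<Longrightarrow> c \<in> A" "c \<in> charts_at A q \<Longrightarrow> q \<in> chart_dom c"
  by (auto simp: charts_at_def)

context hilbert_manifold
begin

abbreviation dtransition :: "('m, 'h) chart \<Rightarrow> ('m, 'h) chart \<Rightarrow> 'm \<Rightarrow> 'h \<Rightarrow> 'h" where
  "dtransition c c' q \<equiv> frechet_derivative (transition c c') (at (chart_map c q))"

lemma ex_chart_at: "\<exists>c. c \<in> charts_at A q"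
proof -
  have "q \<in> (\<Union>c\<in>A. chart_dom c)" using charts_cover by simp
  then show ?thesis unfolding charts_at_def by blast
qed

lemma chart_inv_map: "c \<in> A \<Longrightarrow> q \<in> chart_dom c \<Longrightarrow> chart_inv c (chart_map c q) = q"
  using chart_homeomorphism[of c] by (simp add: homeomorphism_def)

lemma chart_map_inv: "c \<in> A \<Longrightarrow> x \<in> chart_range c \<Longrightarrow> chart_map c (chart_inv c x) = x"
  using chart_homeomorphism[of c] by (simp add: homeomorphism_def)

lemma chart_inv_dom: "c \<in> A \<Longrightarrow> x \<in> chart_range c \<Longrightarrow> chart_inv c x \<in> chart_dom c"
  using chart_homeomorphism[of c] by (auto simp: homeomorphism_def)

lemma chart_map_range: "c \<in> A \<Longrightarrow> q \<in> chart_dom c \<Longrightarrow> chart_map c q \<in> chart_range c"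
  by (simp add: chart_range_def)

lemma chart_map_continuous: "c \<in> A \<Longrightarrow> continuous_on (chart_dom c) (chart_map c)"
  using chart_homeomorphism[of c] by (simp add: homeomorphism_def)

lemma chart_inv_continuous: "c \<in> A \<Longrightarrow> continuous_on (chart_range c) (chart_inv c)"
  using chart_homeomorphism[of c] by (simp add: homeomorphism_def)

lemma transition_map:
  "c \<in> A \<Longrightarrow> q \<in> chart_dom c \<Longrightarrow> transition c c' (chart_map c q) = chart_map c' q"
  by (simp add: transition_def chart_inv_map)

lemma transition_has_derivative:
  assumes "c \<in> charts_at A q" "c' \<in> charts_at A q"
  shows "(transition c c' has_derivative dtransition c c' q) (at (chart_map c q))"
proof -
  have "transition c c' differentiable (at (chart_map c q))"
    using assms by (intro smooth_on_differentiable[OF transition_smooth]) (auto simp: charts_at_def)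
  then show ?thesis by (simp add: frechet_derivative_works)
qed

lemma dtransition_eqI:
  assumes "c \<in> charts_at A q" "c' \<in> charts_at A q" "(transition c c' has_derivative f) (at (chart_map c q))"
  shows "dtransition c c' q = f"
  using frechet_derivative_at[OF assms(3)] by simp

lemma dtransition_self:
  assumes "c \<in> charts_at A q"
  shows "dtransition c c q a = a"
proof -
  have "(transition c c has_derivative (\<lambda>x. x)) (at (chart_map c q))"
  proof (rule has_derivative_transform_within_open[OF has_derivative_ident])
    show "open (chart_range c)" by (rule chart_range_open[OF charts_atD(1)[OF assms]])
    show "chart_map c q \<in> chart_range c" by (rule chart_map_range[OF charts_atD[OF assms]])
    show "x = transition c c x" if "x \<in> chart_range c" for x
      using that assms chart_map_inv by (auto simp: charts_at_def transition_def)
  qed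
  then show ?thesis using dtransition_eqI[OF assms assms] by simp
qed

text \<open>The cocycle identity that puts \<open>tvec_of\<close> into \<open>tangent_space\<close>:
  the chain rule on the overlap of the three charts, where the transition maps compose
  exactly.\<close>

lemma dtransition_trans:
  assumes c: "c \<in> charts_at A q" "c' \<in> charts_at A q" "c'' \<in> charts_at A q"
  shows "dtransition c' c'' q (dtransition c c' q a) = dtransition c c'' q a"
proof -
  note cA = charts_atD[OF c(1)] charts_atD[OF c(2)] charts_atD[OF c(3)]
  let ?T = "\<lambda>d. chart_map c ` (chart_dom c \<inter> chart_dom d)"
  have "((\<lambda>x. transition c' c'' (transition c c' x)) has_derivative
      (\<lambda>h. dtransition c' c'' q (dtransition c c' q h))) (at (chart_map c q))"
    by (rule has_derivative_compose[OF transition_has_derivative[OF c(1,2)]])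
      (use transition_has_derivative[OF c(2,3)] cA in \<open>simp add: transition_map\<close>)
  then have "(transition c c'' has_derivative
      (\<lambda>h. dtransition c' c'' q (dtransition c c' q h))) (at (chart_map c q))"
  proof (rule has_derivative_transform_within_open)
    show "open (?T c' \<inter> ?T c'')"
      using smooth_on_open[OF transition_smooth[of c c']] smooth_on_open[OF transition_smooth[of c c'']] cA
      by (intro open_Int) auto
    show "chart_map c q \<in> ?T c' \<inter> ?T c''" using cA by blast
    fix x assume x: "x \<in> ?T c' \<inter> ?T c''"
    then obtain s where s: "x = chart_map c s" "s \<in> chart_dom c" "s \<in> chart_dom c'" by blast
    then show "transition c' c'' (transition c c' x) = transition c c'' x"
      using cA by (simp add: transition_map)
  qed
  then show ?thesis using dtransition_eqI[OF c(1,3)] by simp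
qed

lemma tvec_of_self: "c \<in> charts_at A q \<Longrightarrow> tvec_of A q c a c = a"
  by (simp add: tvec_of_def dtransition_self)

lemma tvec_of_in_tangent_space: "c \<in> charts_at A q \<Longrightarrow> tvec_of A q c a \<in> tangent_space A q"
  by (auto simp: tangent_space_def tvec_of_def dtransition_trans)

lemma tvec_of_coord: "c \<in> charts_at A q \<Longrightarrow> v \<in> tangent_space A q \<Longrightarrow> tvec_of A q c (v c) = v"
proof
  fix d assume c: "c \<in> charts_at A q" and v: "v \<in> tangent_space A q"
  show "tvec_of A q c (v c) d = v d"
  proof (cases "d \<in> charts_at A q")
    case True
    then have "v d = dtransition c d q (v c)" using c v unfolding tangent_space_def by blast
    then show ?thesis using True by (simp add: tvec_of_def)
  next
    case False
    then have "v d = 0" using v unfolding tangent_space_def by blast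
    then show ?thesis using False by (simp add: tvec_of_def)
  qed
qed

lemma tvec_of_linear:
  assumes "c \<in> charts_at A q"
  shows "tvec_of A q c (s *\<^sub>R a + t *\<^sub>R b) = (\<lambda>d. s *\<^sub>R tvec_of A q c a d + t *\<^sub>R tvec_of A q c b d)"
proof
  fix d
  show "tvec_of A q c (s *\<^sub>R a + t *\<^sub>R b) d = s *\<^sub>R tvec_of A q c a d + t *\<^sub>R tvec_of A q c b d"
  proof (cases "d \<in> charts_at A q")
    case True
    have "linear (dtransition c d q)"
      using transition_has_derivative[OF assms True] by (rule has_derivative_linear)
    then show ?thesis using True by (simp add: tvec_of_def linear_add linear_scale)
  qed (simp add: tvec_of_def)
qed

lemma tvec_of_diff:
  "c \<in> charts_at A q \<Longrightarrow> tvec_of A q c (a - b) = (\<lambda>d. tvec_of A q c a d - tvec_of A q c b d)"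
  using tvec_of_linear[of c q 1 a "-1" b] by simp

lemma tvec_of_scale:
  "c \<in> charts_at A q \<Longrightarrow> tvec_of A q c (s *\<^sub>R a) = (\<lambda>d. s *\<^sub>R tvec_of A q c a d)"
  using tvec_of_linear[of c q s a 0 0] by simp

lemma tvec_of_0: "c \<in> charts_at A q \<Longrightarrow> tvec_of A q c 0 = (\<lambda>d. 0)"
  using tvec_of_scale[of c q 0 0] by simp

text \<open>Derivatives are taken within an arbitrary \<open>S\<close> because geodesics and the
  pieces of a curve have one-sided derivatives at their end points.\<close>

lemma vector_derivative_chart_change:
  assumes c: "c \<in> charts_at A (\<gamma> t)" "c' \<in> charts_at A (\<gamma> t)"
    and \<gamma>: "(\<gamma> \<longlongrightarrow> \<gamma> t) (at t within S)" and t: "t \<in> S"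
    and y: "(chart_map c \<circ> \<gamma> has_vector_derivative y) (at t within S)"
  shows "(chart_map c' \<circ> \<gamma> has_vector_derivative dtransition c c' (\<gamma> t) y) (at t within S)"
proof -
  note cA = charts_atD[OF c(1)] charts_atD[OF c(2)]
  have tr: "(transition c c' has_derivative dtransition c c' (\<gamma> t)) (at (chart_map c (\<gamma> t)))"
    by (rule transition_has_derivative[OF c])
  have "((\<lambda>s. transition c c' ((chart_map c \<circ> \<gamma>) s)) has_derivative
      (\<lambda>u. dtransition c c' (\<gamma> t) (u *\<^sub>R y))) (at t within S)"
    by (rule has_derivative_compose[OF y[unfolded has_vector_derivative_def]]) (use tr in simp)
  then have "(chart_map c' \<circ> \<gamma> has_derivative (\<lambda>u. dtransition c c' (\<gamma> t) (u *\<^sub>R y))) (at t within S)"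
  proof (rule has_derivative_transform_eventually)
    have "\<forall>\<^sub>F s in at t within S. \<gamma> s \<in> chart_dom c"
      using topological_tendstoD[OF \<gamma> chart_dom_open] cA by auto
    then show "\<forall>\<^sub>F s in at t within S. transition c c' ((chart_map c \<circ> \<gamma>) s) = (chart_map c' \<circ> \<gamma>) s"
      by eventually_elim (use cA in \<open>simp add: transition_map\<close>)
  qed (use cA t in \<open>auto simp: transition_map\<close>)
  then show ?thesis
    using linear_scale[OF has_derivative_linear[OF tr]] by (simp add: has_vector_derivative_def)
qed

lemma velocity_eq_tvec_of:
  assumes c: "c \<in> charts_at A (\<gamma> t)" and \<gamma>: "isCont \<gamma> t"
    and y: "(chart_map c \<circ> \<gamma> has_vector_derivative y) (at t)"
  shows "velocity A \<gamma> t = tvec_of A (\<gamma> t) c y"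
proof
  fix d
  show "velocity A \<gamma> t d = tvec_of A (\<gamma> t) c y d"
  proof (cases "d \<in> charts_at A (\<gamma> t)")
    case True
    have "(chart_map d \<circ> \<gamma> has_vector_derivative dtransition c d (\<gamma> t) y) (at t)"
      by (rule vector_derivative_chart_change[OF c True _ _ y]) (use \<gamma> in \<open>auto simp: isCont_def\<close>)
    then show ?thesis using True by (simp add: velocity_def tvec_of_def vector_derivative_at)
  qed (simp add: velocity_def tvec_of_def)
qed

end

section \<open>The metric and the Christoffel symbols in a chart\<close>

context riemannian_manifold
begin

abbreviation gmat :: "('m, 'h) chart \<Rightarrow> 'h \<Rightarrow> 'h \<Rightarrow> 'h \<Rightarrow> real" where
  "gmat c x a b \<equiv> blinfun_apply (blinfun_apply (metric_rep A g c x) a) b"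

lemma metric_form_linear:
  assumes "c \<in> charts_at A q"
  shows "linear (\<lambda>a. g q (tvec_of A q c a) (tvec_of A q c b))"
proof (rule linearI)
  fix a a' and r :: real
  show "g q (tvec_of A q c (a + a')) (tvec_of A q c b) =
      g q (tvec_of A q c a) (tvec_of A q c b) + g q (tvec_of A q c a') (tvec_of A q c b)"
    using metric_linear[of "tvec_of A q c a" q "tvec_of A q c a'" "tvec_of A q c b" 1 1]
      tvec_of_linear[OF assms, of 1 a 1 a'] tvec_of_in_tangent_space[OF assms] by simp
  show "g q (tvec_of A q c (r *\<^sub>R a)) (tvec_of A q c b) = r *\<^sub>R g q (tvec_of A q c a) (tvec_of A q c b)"
    using metric_linear[of "tvec_of A q c a" q "tvec_of A q c a'" "tvec_of A q c b" r 0]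
      tvec_of_linear[OF assms, of r a 0 a'] tvec_of_in_tangent_space[OF assms] by simp
qed

lemma metric_form_sym:
  "c \<in> charts_at A q \<Longrightarrow> g q (tvec_of A q c a) (tvec_of A q c b) = g q (tvec_of A q c b) (tvec_of A q c a)"
  by (intro metric_sym tvec_of_in_tangent_space)

lemma metric_form_pos:
  assumes "c \<in> charts_at A q" "a \<noteq> 0"
  shows "g q (tvec_of A q c a) (tvec_of A q c a) > 0"
proof (rule metric_pos)
  show "tvec_of A q c a \<noteq> (\<lambda>c. 0)" using tvec_of_self[OF assms(1), of a] assms(2) by auto
qed (use assms tvec_of_in_tangent_space in auto)

lemma metric_form_equiv:
  assumes "c \<in> charts_at A q"
  obtains k K where "k > 0" "K > 0"
    "\<And>a. k * norm a \<le> rnorm g q (tvec_of A q c a)" "\<And>a. rnorm g q (tvec_of A q c a) \<le> K * norm a"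
proof -
  obtain k K where k: "k > 0" "\<And>v. v \<in> tangent_space A q \<Longrightarrow> k * norm (v c) \<le> rnorm g q v"
     "\<And>v. v \<in> tangent_space A q \<Longrightarrow> rnorm g q v \<le> K * norm (v c)"
    using metric_norm_equivalent[OF assms] by blast
  have "k * norm a \<le> rnorm g q (tvec_of A q c a)" for a
    using k(2)[OF tvec_of_in_tangent_space[OF assms], of a] by (simp add: tvec_of_self[OF assms])
  moreover have "rnorm g q (tvec_of A q c a) \<le> max K 1 * norm a" for a
  proof -
    have "rnorm g q (tvec_of A q c a) \<le> K * norm a"
      using k(3)[OF tvec_of_in_tangent_space[OF assms], of a] by (simp add: tvec_of_self[OF assms])
    also have "\<dots> \<le> max K 1 * norm a" by (intro mult_right_mono) auto
    finally show ?thesis .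
  qed
  ultimately show ?thesis using that[of k "max K 1"] k(1) by auto
qed

text \<open>\<open>Blinfun\<close> can be evaluated only on bounded linear maps, and the locale
  postulates no boundedness of \<open>g\<close> as a bilinear form. It follows from Cauchy-Schwarz
  together with the equivalence of norms.\<close>

lemma metric_rep_apply:
  assumes c: "c \<in> charts_at A q"
  shows "gmat c (chart_map c q) a b = g q (tvec_of A q c a) (tvec_of A q c b)"
proof -
  define f where "f a b = g q (tvec_of A q c a) (tvec_of A q c b)" for a b
  obtain K where K: "K > 0" "\<And>a. sqrt (f a a) \<le> K * norm a"
    by (rule metric_form_equiv[OF c, unfolded rnorm_def f_def[symmetric]]) (rule that)
  have lin1: "linear (\<lambda>a. f a b)" for b
    unfolding f_def by (rule metric_form_linear[OF c])
  have sym: "f a b = f b a" for a b unfolding f_def by (rule metric_form_sym[OF c])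
  have lin2: "linear (\<lambda>b. f a b)" for a
    using lin1[of a] by (subst sym)
  have nonneg: "0 \<le> f b b" for b
    using metric_form_pos[OF c, of b] linear_0[OF lin1, of b] by (cases "b = 0") (auto simp: f_def)
  have bound: "\<bar>f a b\<bar> \<le> K * norm a * (K * norm b)" for a b
  proof -
    have "\<bar>f a b\<bar> \<le> sqrt (f a a) * sqrt (f b b)"
      by (rule form_cauchy_schwarz[OF lin1 sym]) (use metric_form_pos[OF c] in \<open>simp add: f_def\<close>)
    also have "\<dots> \<le> K * norm a * (K * norm b)"
      using K nonneg by (intro mult_mono) auto
    finally show ?thesis .
  qed
  have bl2: "bounded_linear (\<lambda>b. f a b)" for a
    unfolding bounded_linear_def bounded_linear_axioms_def
  proof
    show "\<exists>B. \<forall>b. norm (f a b) \<le> norm b * B"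
      using bound[of a] by (intro exI[of _ "K * norm a * K"]) (simp add: ac_simps)
  qed (rule lin2)
  then have ap2: "blinfun_apply (Blinfun (\<lambda>b. f a b)) = (\<lambda>b. f a b)" for a
    by (simp add: bounded_linear_Blinfun_apply)
  have bl1: "bounded_linear (\<lambda>a. Blinfun (\<lambda>b. f a b))"
    unfolding bounded_linear_def bounded_linear_axioms_def
  proof
    show "linear (\<lambda>a. Blinfun (\<lambda>b. f a b))"
      by (rule linearI; rule blinfun_eqI)
        (simp_all only: ap2 blinfun.add_left blinfun.scaleR_left, simp_all only: linear_add[OF lin1] linear_scale[OF lin1])
    have "norm (Blinfun (\<lambda>b. f a b)) \<le> norm a * (K * K)" for a
      by (rule norm_blinfun_bound) (use K bound[of a] in \<open>auto simp: ap2 ac_simps\<close>)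
    then show "\<exists>B. \<forall>a. norm (Blinfun (\<lambda>b. f a b)) \<le> norm a * B" by blast
  qed
  have "chart_inv c (chart_map c q) = q" using c chart_inv_map by (auto simp: charts_at_def)
  then have "metric_rep A g c (chart_map c q) = Blinfun (\<lambda>a. Blinfun (\<lambda>b. f a b))"
    by (simp add: metric_rep_def f_def)
  then show ?thesis using bounded_linear_Blinfun_apply[OF bl1] ap2 by (simp add: f_def)
qed

lemma gmat_sym:
  assumes "c \<in> A" "x \<in> chart_range c"
  shows "gmat c x a b = gmat c x b a"
proof -
  have c: "c \<in> charts_at A (chart_inv c x)" and x: "chart_map c (chart_inv c x) = x"
    using assms chart_inv_dom chart_map_inv by (auto simp: charts_at_def)
  show ?thesis using metric_rep_apply[OF c] metric_form_sym[OF c] by (simp add: x)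
qed

lemma rnorm_tvec_of:
  "c \<in> charts_at A q \<Longrightarrow> rnorm g q (tvec_of A q c a) = sqrt (gmat c (chart_map c q) a a)"
  by (simp add: rnorm_def metric_rep_apply)

text \<open>Bounds that make the geodesic equation in a chart an ordinary differential equation with
  Lipschitz right-hand side.\<close>

lemma christoffel_locally_lipschitz:
  assumes c: "c \<in> charts_at A q"
  obtains d k L M where "d > 0" "k > 0" "L \<ge> 0" "M \<ge> 0" "ball (chart_map c q) d \<subseteq> chart_range c"
    "\<And>x y u w. x \<in> ball (chart_map c q) d \<Longrightarrow> y \<in> ball (chart_map c q) d \<Longrightarrow>
      \<bar>gmat c x u w - gmat c y u w\<bar> \<le> L * norm (x - y) * norm u * norm w"
    "\<And>x u. x \<in> ball (chart_map c q) d \<Longrightarrow> k * (norm u)\<^sup>2 \<le> gmat c x u u"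
    "\<And>x y u v w. x \<in> ball (chart_map c q) d \<Longrightarrow> y \<in> ball (chart_map c q) d \<Longrightarrow>
      \<bar>christoffel1 A g c x u v w - christoffel1 A g c y u v w\<bar> \<le> L * norm (x - y) * norm u * norm v * norm w"
    "\<And>x u v w. x \<in> ball (chart_map c q) d \<Longrightarrow>
      \<bar>christoffel1 A g c x u v w\<bar> \<le> M * norm u * norm v * norm w"
proof -
  let ?x = "chart_map c q"
  note cA = charts_atD[OF c]
  obtain D where D: "derivs_on (chart_range c) D" "\<And>x. x \<in> chart_range c \<Longrightarrow> D x [] = metric_rep A g c x"
    using smooth_on_derivs[OF metric_smooth[OF cA(1)]] by blast
  have fd: "frechet_derivative (metric_rep A g c) (at x) = (\<lambda>h. D x [h])" if "x \<in> chart_range c" for x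
    using frechet_derivative_at[OF smooth_on_has_derivative[OF D(1) D(2) that]] by simp
  have xr: "?x \<in> chart_range c" using cA chart_map_range by blast
  obtain d0 L0 where 0: "d0 > 0" "0 \<le> L0" "ball ?x d0 \<subseteq> chart_range c"
    "\<And>y z vs. y \<in> ball ?x d0 \<Longrightarrow> z \<in> ball ?x d0 \<Longrightarrow> length vs = 0 \<Longrightarrow>
        norm (D y vs - D z vs) \<le> L0 * norm (y - z) * prod_list (map norm vs)"
    by (rule derivs_on_locally_lipschitz[OF D(1) xr, of 0]) (rule that)
  obtain d1 L1 where 1: "d1 > 0" "0 \<le> L1" "ball ?x d1 \<subseteq> chart_range c"
    "\<And>y z vs. y \<in> ball ?x d1 \<Longrightarrow> z \<in> ball ?x d1 \<Longrightarrow> length vs = 1 \<Longrightarrow>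
        norm (D y vs - D z vs) \<le> L1 * norm (y - z) * prod_list (map norm vs)"
    by (rule derivs_on_locally_lipschitz[OF D(1) xr, of 1]) (rule that)
  obtain d2 M where 2: "d2 > 0" "0 \<le> M" "ball ?x d2 \<subseteq> chart_range c"
    "\<And>y vs. y \<in> ball ?x d2 \<Longrightarrow> length vs = 1 \<Longrightarrow> norm (D y vs) \<le> M * prod_list (map norm vs)"
    by (rule derivs_on_locally_bounded[OF D(1) xr, of 1]) (rule that)
  obtain k where k: "k > 0" "\<And>a. k * norm a \<le> sqrt (gmat c ?x a a)"
    by (rule metric_form_equiv[OF c, unfolded rnorm_tvec_of[OF c]]) (rule that)
  \<comment> \<open>The last bound on the radius keeps the change of the metric below
    \<open>k\<^sup>2 / 2\<close>, half of its coercivity constant at the centre.\<close>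
  define d where "d = min (min d0 d1) (min d2 (k\<^sup>2 / (2 * (L0 + 1))))"
  \<comment> \<open>\<open>L\<close> has to dominate \<open>L0\<close> for the metric and
    \<open>3 / 2 * L1\<close> for the Christoffel symbols, which are half a sum of three
    derivatives. The constant \<open>2 * M\<close> below covers \<open>3 / 2 * M\<close> in the same
    way.\<close>
  define L where "L = L0 + 2 * L1"
  have d: "d > 0" using 0 1 2 k by (auto simp: d_def)
  have sub: "x \<in> ball ?x d0" "x \<in> ball ?x d1" "x \<in> ball ?x d2" "x \<in> chart_range c"
    "norm (x - ?x) < k\<^sup>2 / (2 * (L0 + 1))"
    if "x \<in> ball ?x d" for x
    using that 0(3) by (auto simp: d_def dist_norm norm_minus_commute)
  have G0: "\<bar>gmat c x u w - gmat c y u w\<bar> \<le> L0 * norm (x - y) * norm u * norm w"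
    if "x \<in> ball ?x d" "y \<in> ball ?x d" for x y u w
  proof -
    have "gmat c x u w - gmat c y u w = blinfun_apply (blinfun_apply (D x [] - D y []) u) w"
      using D(2)[OF sub(4)] that by (simp add: blinfun.bilinear_simps)
    also have "\<bar>\<dots>\<bar> \<le> norm (D x [] - D y []) * norm u * norm w" by (rule blinfun2_bound)
    also have "\<dots> \<le> L0 * norm (x - y) * norm u * norm w"
      using 0(4)[OF sub(1) sub(1), of x y "[]"] that by (intro mult_right_mono) auto
    finally show ?thesis .
  qed
  have G1: "\<bar>blinfun_apply (blinfun_apply (D x [u]) v) w - blinfun_apply (blinfun_apply (D y [u]) v) w\<bar>
      \<le> L1 * norm (x - y) * norm u * norm v * norm w"
    if "x \<in> ball ?x d" "y \<in> ball ?x d" for x y u v w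
  proof -
    have "blinfun_apply (blinfun_apply (D x [u]) v) w - blinfun_apply (blinfun_apply (D y [u]) v) w
        = blinfun_apply (blinfun_apply (D x [u] - D y [u]) v) w"
      by (simp add: blinfun.bilinear_simps)
    also have "\<bar>\<dots>\<bar> \<le> norm (D x [u] - D y [u]) * norm v * norm w" by (rule blinfun2_bound)
    also have "\<dots> \<le> L1 * norm (x - y) * norm u * norm v * norm w"
      using 1(4)[OF sub(2) sub(2), of x y "[u]"] that by (intro mult_right_mono) auto
    finally show ?thesis .
  qed
  have G2: "\<bar>blinfun_apply (blinfun_apply (D x [u]) v) w\<bar> \<le> M * norm u * norm v * norm w"
    if "x \<in> ball ?x d" for x u v w
  proof -
    have "\<bar>blinfun_apply (blinfun_apply (D x [u]) v) w\<bar> \<le> norm (D x [u]) * norm v * norm w"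
      by (rule blinfun2_bound)
    also have "\<dots> \<le> M * norm u * norm v * norm w"
      using 2(4)[OF sub(3)[OF that], of "[u]"] by (intro mult_right_mono) auto
    finally show ?thesis .
  qed
  have ch: "christoffel1 A g c x u v w = (blinfun_apply (blinfun_apply (D x [u]) v) w
     + blinfun_apply (blinfun_apply (D x [v]) u) w - blinfun_apply (blinfun_apply (D x [w]) u) v) / 2"
    if "x \<in> ball ?x d" for x u v w
    using fd[OF sub(4)[OF that]] by (simp add: christoffel1_def Let_def)
  have half: "\<bar>(p + q - s) / 2 - (p' + q' - s') / 2\<bar> \<le> (e + e + e) / 2"
    if "\<bar>p - p'\<bar> \<le> e" "\<bar>q - q'\<bar> \<le> e" "\<bar>s - s'\<bar> \<le> e" for p q s p' q' s' e :: real
    using that by (simp add: abs_le_iff field_simps)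
  show ?thesis
  proof (rule that[of d "k\<^sup>2 / 2" L "2 * M"])
    show "ball ?x d \<subseteq> chart_range c" using sub by blast
    show "\<bar>gmat c x u w - gmat c y u w\<bar> \<le> L * norm (x - y) * norm u * norm w"
      if "x \<in> ball ?x d" "y \<in> ball ?x d" for x y u w
    proof -
      have "L0 * norm (x - y) * norm u * norm w \<le> L * norm (x - y) * norm u * norm w"
        using 1(2) by (intro mult_right_mono) (auto simp: L_def)
      then show ?thesis using G0[OF that, of u w] by linarith
    qed
    show "k\<^sup>2 / 2 * (norm u)\<^sup>2 \<le> gmat c x u u" if x: "x \<in> ball ?x d" for x u
    proof -
      have "?x \<in> ball ?x d" using d by simp
      then have "\<bar>gmat c x u u - gmat c ?x u u\<bar> \<le> L0 * norm (x - ?x) * norm u * norm u" using x G0 by blast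
      also have "\<dots> \<le> k\<^sup>2 / 2 * norm u * norm u"
      proof (intro mult_right_mono)
        have "L0 * norm (x - ?x) \<le> (L0 + 1) * (k\<^sup>2 / (2 * (L0 + 1)))"
          using sub(5)[OF x] 0(2) by (intro mult_mono) auto
        moreover have l: "l * (k\<^sup>2 / (2 * l)) = k\<^sup>2 / 2" if "l > 0" for l :: real
          using that by simp
        ultimately show "L0 * norm (x - ?x) \<le> k\<^sup>2 / 2" using l[of "L0 + 1"] 0(2) by linarith
      qed auto
      also have "k\<^sup>2 / 2 * norm u * norm u = k\<^sup>2 / 2 * (norm u)\<^sup>2" by (simp add: power2_eq_square)
      finally have "gmat c ?x u u - k\<^sup>2 / 2 * (norm u)\<^sup>2 \<le> gmat c x u u" by linarith
      moreover have "k\<^sup>2 * (norm u)\<^sup>2 \<le> gmat c ?x u u"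
      proof -
        have "0 \<le> k * norm u" using k by simp
        then have "(k * norm u)\<^sup>2 \<le> (sqrt (gmat c ?x u u))\<^sup>2" using k(2)[of u] by (intro power_mono)
        moreover have "0 \<le> sqrt (gmat c ?x u u)" using k(2)[of u] \<open>0 \<le> k * norm u\<close> by linarith
        ultimately show ?thesis by (simp add: power_mult_distrib)
      qed
      ultimately show ?thesis by (simp add: field_simps)
    qed
    show "\<bar>christoffel1 A g c x u v w - christoffel1 A g c y u v w\<bar> \<le> L * norm (x - y) * norm u * norm v * norm w"
      if xy: "x \<in> ball ?x d" "y \<in> ball ?x d" for x y u v w
    proof -
      define T where "T = norm (x - y) * norm u * norm v * norm w"
      have T: "T \<ge> 0" by (simp add: T_def)
      have T3: "L1 * norm (x - y) * norm u * norm v * norm w = L1 * T"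
        "L1 * norm (x - y) * norm v * norm u * norm w = L1 * T"
        "L1 * norm (x - y) * norm w * norm u * norm v = L1 * T" by (simp_all add: T_def)
      have "\<bar>christoffel1 A g c x u v w - christoffel1 A g c y u v w\<bar> \<le> (L1 * T + L1 * T + L1 * T) / 2"
        using G1[OF xy, of u v w] G1[OF xy, of v u w] G1[OF xy, of w u v]
        unfolding ch[OF xy(1)] ch[OF xy(2)] T3 by (rule half)
      also have "\<dots> \<le> L * T" using T 0(2) 1(2) by (simp add: L_def algebra_simps)
      finally show ?thesis by (simp add: T_def mult.assoc)
    qed
    show "\<bar>christoffel1 A g c x u v w\<bar> \<le> 2 * M * norm u * norm v * norm w"
      if x: "x \<in> ball ?x d" for x u v w
    proof -
      define T where "T = norm u * norm v * norm w"
      have T: "T \<ge> 0" by (simp add: T_def)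
      have T3: "M * norm u * norm v * norm w = M * T" "M * norm v * norm u * norm w = M * T"
        "M * norm w * norm u * norm v = M * T" by (simp_all add: T_def)
      have "\<bar>christoffel1 A g c x u v w\<bar> \<le> (M * T + M * T + M * T) / 2"
        using G2[OF x, of u v w] G2[OF x, of v u w] G2[OF x, of w u v]
        unfolding ch[OF x] T3 using half[of _ 0 _ _ 0 _ 0] by simp
      also have "\<dots> \<le> 2 * M * T" using T 2(2) by (simp add: algebra_simps)
      finally show ?thesis by (simp add: T_def mult.assoc)
    qed
  qed (use d k 0 1 2 in \<open>auto simp: L_def\<close>)
qed

lemma metric_rep_has_derivative:
  assumes "c \<in> A" "x \<in> chart_range c"
  shows "(metric_rep A g c has_derivative frechet_derivative (metric_rep A g c) (at x)) (at x)"
  using smooth_on_differentiable[OF metric_smooth[OF assms(1)] assms(2)]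
  by (simp add: frechet_derivative_works)

lemma christoffel1_linear:
  assumes "c \<in> A" "x \<in> chart_range c"
  shows "linear (\<lambda>u. christoffel1 A g c x u v w)" "linear (\<lambda>v. christoffel1 A g c x u v w)"
proof -
  note lin = has_derivative_linear[OF metric_rep_has_derivative[OF assms]]
  show "linear (\<lambda>u. christoffel1 A g c x u v w)" "linear (\<lambda>v. christoffel1 A g c x u v w)"
    by (auto intro!: linearI simp: christoffel1_def Let_def linear_add[OF lin] linear_scale[OF lin]
       blinfun.bilinear_simps algebra_simps add_divide_distrib diff_divide_distrib)
qed

text \<open>Symmetry holds on the whole open chart range, so transposing the arguments leaves the
  differentiated function unchanged near \<open>x\<close>.\<close>

lemma dmetric_rep_sym:
  assumes c: "c \<in> A" and x: "x \<in> chart_range c"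
  defines "DG \<equiv> frechet_derivative (metric_rep A g c) (at x)"
  shows "blinfun_apply (blinfun_apply (DG u) a) b = blinfun_apply (blinfun_apply (DG u) b) a"
proof -
  have ap: "((\<lambda>y. gmat c y a b) has_derivative (\<lambda>u. blinfun_apply (blinfun_apply (DG u) a) b)) (at x)" for a b
    unfolding DG_def using metric_rep_has_derivative[OF c x]
    by (intro bounded_linear.has_derivative[OF blinfun.bounded_linear_left])
  have "((\<lambda>y. gmat c y b a) has_derivative (\<lambda>u. blinfun_apply (blinfun_apply (DG u) a) b)) (at x)"
    by (rule has_derivative_transform_within_open[OF ap chart_range_open[OF c] x]) (rule gmat_sym[OF c])
  then have "(\<lambda>u. blinfun_apply (blinfun_apply (DG u) a) b) = (\<lambda>u. blinfun_apply (blinfun_apply (DG u) b) a)"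
    using ap[of b a] by (rule has_derivative_unique)
  then show ?thesis by meson
qed

end

section \<open>Geodesics\<close>

lemma at_within_Icc_nontrivial:
  fixes t :: real
  assumes "t \<in> {a..b}" "a < b"
  shows "at t within {a..b} \<noteq> bot"
  using assms trivial_limit_within islimpt_Icc by (metis atLeastAtMost_iff)

lemma has_vector_derivative_unique_Icc:
  fixes t :: real
  assumes "t \<in> {a..b}" "a < b" "(f has_vector_derivative y) (at t within {a..b})"
    "(f has_vector_derivative z) (at t within {a..b})"
  shows "y = z"
  using vector_derivative_unique_within[OF at_within_Icc_nontrivial[OF assms(1,2)] assms(3,4)] .

context riemannian_manifold
begin

text \<open>Equality of the initial data of the second-order geodesic equation. One chart is enough
  in the definition, as the chain rule carries the equality of velocities to any other
  chart.\<close>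

definition first_order_agree :: "real set \<Rightarrow> (real \<Rightarrow> 'm) \<Rightarrow> (real \<Rightarrow> 'm) \<Rightarrow> real \<Rightarrow> bool" where
  "first_order_agree I \<gamma> \<gamma>' t \<longleftrightarrow> \<gamma> t = \<gamma>' t \<and>
     (\<exists>c\<in>charts_at A (\<gamma> t). \<exists>w. (chart_map c \<circ> \<gamma> has_vector_derivative w) (at t within I) \<and>
         (chart_map c \<circ> \<gamma>' has_vector_derivative w) (at t within I))"

lemma first_order_agree_chart:
  assumes ag: "first_order_agree I \<gamma> \<gamma>' t" and c: "c \<in> charts_at A (\<gamma> t)" and t: "t \<in> I"
    and cont: "continuous_on I \<gamma>" "continuous_on I \<gamma>'"
  obtains w where "(chart_map c \<circ> \<gamma> has_vector_derivative w) (at t within I)"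
         "(chart_map c \<circ> \<gamma>' has_vector_derivative w) (at t within I)"
proof -
  obtain d w where eq: "\<gamma> t = \<gamma>' t" and d: "d \<in> charts_at A (\<gamma> t)"
    and w: "(chart_map d \<circ> \<gamma> has_vector_derivative w) (at t within I)"
         "(chart_map d \<circ> \<gamma>' has_vector_derivative w) (at t within I)"
    using ag unfolding first_order_agree_def by blast
  have lim: "(\<gamma> \<longlongrightarrow> \<gamma> t) (at t within I)" "(\<gamma>' \<longlongrightarrow> \<gamma>' t) (at t within I)"
    using cont t by (auto simp: continuous_on_def)
  show ?thesis
  proof (rule that)
    show "(chart_map c \<circ> \<gamma> has_vector_derivative dtransition d c (\<gamma> t) w) (at t within I)"
      by (rule vector_derivative_chart_change[OF d c lim(1) t w(1)])
    show "(chart_map c \<circ> \<gamma>' has_vector_derivative dtransition d c (\<gamma> t) w) (at t within I)"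
      using vector_derivative_chart_change[OF d[unfolded eq] c[unfolded eq] lim(2) t w(2)] by (simp add: eq)
  qed
qed

lemma geodesic_chart:
  assumes "geodesic_on A g I \<gamma>" "c \<in> A"
  obtains x' x'' where
    "\<And>t. t \<in> I \<Longrightarrow> \<gamma> t \<in> chart_dom c \<Longrightarrow> (chart_map c \<circ> \<gamma> has_vector_derivative x' t) (at t within I)"
    "\<And>t. t \<in> I \<Longrightarrow> \<gamma> t \<in> chart_dom c \<Longrightarrow> (x' has_vector_derivative x'' t) (at t within I)"
    "\<And>t w. t \<in> I \<Longrightarrow> \<gamma> t \<in> chart_dom c \<Longrightarrow>
       gmat c (chart_map c (\<gamma> t)) (x'' t) w + christoffel1 A g c (chart_map c (\<gamma> t)) (x' t) (x' t) w = 0"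
proof -
  have "\<exists>x' x''. \<forall>t\<in>{t\<in>I. \<gamma> t \<in> chart_dom c}.
        (chart_map c \<circ> \<gamma> has_vector_derivative x' t) (at t within I) \<and>
        (x' has_vector_derivative x'' t) (at t within I) \<and>
        (\<forall>w. gmat c (chart_map c (\<gamma> t)) (x'' t) w
              + christoffel1 A g c (chart_map c (\<gamma> t)) (x' t) (x' t) w = 0)"
    using assms unfolding geodesic_on_def by (elim conjE) (drule bspec)
  then obtain x' x'' where "\<forall>t\<in>{t\<in>I. \<gamma> t \<in> chart_dom c}.
        (chart_map c \<circ> \<gamma> has_vector_derivative x' t) (at t within I) \<and>
        (x' has_vector_derivative x'' t) (at t within I) \<and>
        (\<forall>w. gmat c (chart_map c (\<gamma> t)) (x'' t) w
              + christoffel1 A g c (chart_map c (\<gamma> t)) (x' t) (x' t) w = 0)"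
    by (elim exE)
  then show ?thesis by (intro that[of x' x'']) auto
qed

lemma geodesic_continuous: "geodesic_on A g I \<gamma> \<Longrightarrow> continuous_on I \<gamma>"
  by (simp add: geodesic_on_def)

text \<open>The Lipschitz and coercivity bounds hold only on a small ball in a chart, so uniqueness
  for the differential equation applies as long as both curves remain in that ball; continuity
  guarantees this for a short time.\<close>

lemma geodesics_agree_forward:
  assumes geo: "geodesic_on A g {0..1} \<gamma>1" "geodesic_on A g {0..1} \<gamma>2"
    and t: "0 \<le> t" "t < 1" and ag: "first_order_agree {0..1} \<gamma>1 \<gamma>2 t"
  shows "\<exists>d>0. \<forall>s. t < s \<and> s < t + d \<and> s \<le> 1 \<longrightarrow> first_order_agree {0..1} \<gamma>1 \<gamma>2 s"
proof -
  let ?I = "{0..1::real}"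
  have tI: "t \<in> ?I" using t by simp
  have eq: "\<gamma>1 t = \<gamma>2 t" using ag by (simp add: first_order_agree_def)
  obtain c where c: "c \<in> charts_at A (\<gamma>1 t)" using ex_chart_at by blast
  note cA = charts_atD[OF c]
  note cont = geodesic_continuous[OF geo(1)] geodesic_continuous[OF geo(2)]
  obtain w where w: "(chart_map c \<circ> \<gamma>1 has_vector_derivative w) (at t within ?I)"
         "(chart_map c \<circ> \<gamma>2 has_vector_derivative w) (at t within ?I)"
    by (rule first_order_agree_chart[OF ag c tI cont]) (rule that)
  obtain v1 z1 where g1:
    "\<And>t. t \<in> ?I \<Longrightarrow> \<gamma>1 t \<in> chart_dom c \<Longrightarrow> (chart_map c \<circ> \<gamma>1 has_vector_derivative v1 t) (at t within ?I)"
    "\<And>t. t \<in> ?I \<Longrightarrow> \<gamma>1 t \<in> chart_dom c \<Longrightarrow> (v1 has_vector_derivative z1 t) (at t within ?I)"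
    "\<And>t w. t \<in> ?I \<Longrightarrow> \<gamma>1 t \<in> chart_dom c \<Longrightarrow>
       gmat c (chart_map c (\<gamma>1 t)) (z1 t) w + christoffel1 A g c (chart_map c (\<gamma>1 t)) (v1 t) (v1 t) w = 0"
    by (rule geodesic_chart[OF geo(1) cA(1)]) (rule that)
  obtain v2 z2 where g2:
    "\<And>t. t \<in> ?I \<Longrightarrow> \<gamma>2 t \<in> chart_dom c \<Longrightarrow> (chart_map c \<circ> \<gamma>2 has_vector_derivative v2 t) (at t within ?I)"
    "\<And>t. t \<in> ?I \<Longrightarrow> \<gamma>2 t \<in> chart_dom c \<Longrightarrow> (v2 has_vector_derivative z2 t) (at t within ?I)"
    "\<And>t w. t \<in> ?I \<Longrightarrow> \<gamma>2 t \<in> chart_dom c \<Longrightarrow>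
       gmat c (chart_map c (\<gamma>2 t)) (z2 t) w + christoffel1 A g c (chart_map c (\<gamma>2 t)) (v2 t) (v2 t) w = 0"
    by (rule geodesic_chart[OF geo(2) cA(1)]) (rule that)
  have v12: "v1 t = v2 t"
    using has_vector_derivative_unique_Icc[OF tI zero_less_one w(1) g1(1)[OF tI]]
      has_vector_derivative_unique_Icc[OF tI zero_less_one w(2) g2(1)[OF tI]] cA eq by simp
  let ?x = "chart_map c (\<gamma>1 t)"
  obtain d k L M where d: "d > 0" and k: "k > 0" and LM: "L \<ge> 0" "M \<ge> 0" and sub: "ball ?x d \<subseteq> chart_range c"
    and b: "\<And>x y u w. x \<in> ball ?x d \<Longrightarrow> y \<in> ball ?x d \<Longrightarrow>
      \<bar>gmat c x u w - gmat c y u w\<bar> \<le> L * norm (x - y) * norm u * norm w"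
    "\<And>x u. x \<in> ball ?x d \<Longrightarrow> k * (norm u)\<^sup>2 \<le> gmat c x u u"
    "\<And>x y u v w. x \<in> ball ?x d \<Longrightarrow> y \<in> ball ?x d \<Longrightarrow>
      \<bar>christoffel1 A g c x u v w - christoffel1 A g c y u v w\<bar> \<le> L * norm (x - y) * norm u * norm v * norm w"
    "\<And>x u v w. x \<in> ball ?x d \<Longrightarrow> \<bar>christoffel1 A g c x u v w\<bar> \<le> M * norm u * norm v * norm w"
    by (rule christoffel_locally_lipschitz[OF c]) (rule that)
  define V where "V = chart_dom c \<inter> chart_map c -` ball ?x d"
  have V: "open V"
    unfolding V_def using chart_map_continuous chart_dom_open cA by (intro continuous_open_preimage) auto
  have near: "\<exists>e>0. \<forall>s\<in>?I. dist s t < e \<longrightarrow> \<gamma> s \<in> V" if "continuous_on ?I \<gamma>" "\<gamma> t = \<gamma>1 t" for \<gamma>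
  proof -
    have "\<gamma> t \<in> V" using that(2) cA d by (simp add: V_def)
    moreover have "(\<gamma> \<longlongrightarrow> \<gamma> t) (at t within ?I)" using that(1) tI by (auto simp: continuous_on_def)
    ultimately have "\<forall>\<^sub>F s in at t within ?I. \<gamma> s \<in> V" using V by (intro topological_tendstoD)
    then obtain e where e: "e > 0" "\<forall>s\<in>?I. s \<noteq> t \<and> dist s t < e \<longrightarrow> \<gamma> s \<in> V"
      unfolding eventually_at by blast
    then have "\<forall>s\<in>?I. dist s t < e \<longrightarrow> \<gamma> s \<in> V" using \<open>\<gamma> t \<in> V\<close> by metis
    then show ?thesis using e(1) by blast
  qed
  obtain e1 where e1: "e1 > 0" "\<And>s. s \<in> ?I \<Longrightarrow> dist s t < e1 \<Longrightarrow> \<gamma>1 s \<in> V"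
    using near[OF cont(1)] by blast
  obtain e2 where e2: "e2 > 0" "\<And>s. s \<in> ?I \<Longrightarrow> dist s t < e2 \<Longrightarrow> \<gamma>2 s \<in> V"
    using near[OF cont(2)] eq by force
  \<comment> \<open>Halving keeps the closed interval \<open>{t..bb}\<close> inside both
    neighbourhoods of \<open>t\<close>.\<close>
  define bb where "bb = min (t + min e1 e2 / 2) 1"
  have bb: "t < bb" "bb \<le> 1" using e1 e2 t by (auto simp: bb_def)
  have J: "s \<in> ?I" "\<gamma>1 s \<in> V" "\<gamma>2 s \<in> V" if "s \<in> {t..bb}" for s
  proof -
    show "s \<in> ?I" using that bb t by auto
    have "dist s t < e1" "dist s t < e2" using that e1(1) e2(1) by (auto simp: dist_real_def bb_def)
    then show "\<gamma>1 s \<in> V" "\<gamma>2 s \<in> V" using e1(2) e2(2) \<open>s \<in> ?I\<close> by blast+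
  qed
  have JI: "{t..bb} \<subseteq> ?I" using J by blast
  have Jd: "\<gamma>1 s \<in> chart_dom c" "\<gamma>2 s \<in> chart_dom c" if "s \<in> {t..bb}" for s
    using J[OF that] by (auto simp: V_def)
  note cl = christoffel1_linear[OF cA(1)]
  have uniq: "(chart_map c \<circ> \<gamma>1) s = (chart_map c \<circ> \<gamma>2) s \<and> v1 s = v2 s" if s: "s \<in> {t..bb}" for s
  proof (rule second_order_ode_unique[where G="gmat c" and Ch="christoffel1 A g c" and B="ball ?x d"
        and a=t and b=bb and L=L and k=k and M=M and ?z1.0=z1 and ?z2.0=z2])
    fix r assume r: "r \<in> {t..bb}"
    show "(chart_map c \<circ> \<gamma>1 has_vector_derivative v1 r) (at r within {t..bb})"
      "(v1 has_vector_derivative z1 r) (at r within {t..bb})"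
      "(chart_map c \<circ> \<gamma>2 has_vector_derivative v2 r) (at r within {t..bb})"
      "(v2 has_vector_derivative z2 r) (at r within {t..bb})"
      using g1(1,2)[OF J(1)[OF r] Jd(1)[OF r]] g2(1,2)[OF J(1)[OF r] Jd(2)[OF r]] JI
      by (auto intro: has_vector_derivative_within_subset)
    show "(chart_map c \<circ> \<gamma>1) r \<in> ball ?x d" "(chart_map c \<circ> \<gamma>2) r \<in> ball ?x d"
      using J[OF r] by (auto simp: V_def)
    show "gmat c ((chart_map c \<circ> \<gamma>1) r) (z1 r) w + christoffel1 A g c ((chart_map c \<circ> \<gamma>1) r) (v1 r) (v1 r) w = 0"
      "gmat c ((chart_map c \<circ> \<gamma>2) r) (z2 r) w + christoffel1 A g c ((chart_map c \<circ> \<gamma>2) r) (v2 r) (v2 r) w = 0" for w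
      using g1(3)[OF J(1)[OF r] Jd(1)[OF r]] g2(3)[OF J(1)[OF r] Jd(2)[OF r]] by auto
  next
    fix x u u' v w assume x: "x \<in> ball ?x d"
    then have xr: "x \<in> chart_range c" using sub by blast
    show "christoffel1 A g c x (u - u') v w = christoffel1 A g c x u v w - christoffel1 A g c x u' v w"
      by (rule linear_diff[OF cl(1)[OF xr]])
    show "christoffel1 A g c x v (u - u') w = christoffel1 A g c x v u w - christoffel1 A g c x v u' w"
      by (rule linear_diff[OF cl(2)[OF xr]])
  qed (use b LM k s v12 eq in \<open>auto simp: blinfun.bilinear_simps\<close>)
  have "first_order_agree ?I \<gamma>1 \<gamma>2 s" if s: "t < s" "s < bb" for s
  proof -
    have sJ: "s \<in> {t..bb}" using s by simp
    note sd = Jd[OF sJ]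
    have e: "\<gamma>1 s = \<gamma>2 s"
    proof -
      have "chart_map c (\<gamma>1 s) = chart_map c (\<gamma>2 s)" using uniq[OF sJ] by simp
      then have "chart_inv c (chart_map c (\<gamma>1 s)) = chart_inv c (chart_map c (\<gamma>2 s))" by (rule arg_cong)
      then show ?thesis by (simp only: chart_inv_map[OF cA(1) sd(1)] chart_inv_map[OF cA(1) sd(2)])
    qed
    show ?thesis unfolding first_order_agree_def
    proof (intro conjI bexI exI)
      show "c \<in> charts_at A (\<gamma>1 s)" using sd cA by (simp add: charts_at_def)
      show "(chart_map c \<circ> \<gamma>1 has_vector_derivative v1 s) (at s within ?I)"
        by (rule g1(1)[OF J(1)[OF sJ] sd(1)])
      show "(chart_map c \<circ> \<gamma>2 has_vector_derivative v1 s) (at s within ?I)"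
        using g2(1)[OF J(1)[OF sJ] sd(2)] uniq[OF sJ] by simp
    qed (rule e)
  qed
  then show ?thesis using bb by (intro exI[of _ "bb - t"]) auto
qed

text \<open>Positions agree at \<open>t\<close> because limits are unique in a Hausdorff space. For
  the velocities, agreement at earlier times identifies \<open>v1\<close> with \<open>v2\<close>
  there, and both are continuous at \<open>t\<close>, being differentiable.\<close>

lemma geodesics_agree_limit:
  assumes geo: "geodesic_on A g {0..1} \<gamma>1" "geodesic_on A g {0..1} \<gamma>2"
    and t: "0 < t" "t \<le> 1" and ag: "\<And>s. 0 \<le> s \<Longrightarrow> s < t \<Longrightarrow> first_order_agree {0..1} \<gamma>1 \<gamma>2 s"
  shows "first_order_agree {0..1} \<gamma>1 \<gamma>2 t"
proof -
  let ?I = "{0..1::real}" and ?F = "at t within {0..<t}"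
  have tI: "t \<in> ?I" using t by simp
  have nb: "?F \<noteq> bot"
    using t closure_atLeastLessThan[of 0 t] by (simp add: at_within_eq_bot_iff)
  have sub: "{0..<t} \<subseteq> ?I" using t by auto
  have inF: "\<forall>\<^sub>F s in ?F. s \<in> {0..<t}" by (simp add: eventually_at_filter)
  note cont = geodesic_continuous[OF geo(1)] geodesic_continuous[OF geo(2)]
  have limI: "(\<gamma>1 \<longlongrightarrow> \<gamma>1 t) (at t within ?I)" "(\<gamma>2 \<longlongrightarrow> \<gamma>2 t) (at t within ?I)"
    using cont tI by (auto simp: continuous_on_def)
  have lim: "(\<gamma>1 \<longlongrightarrow> \<gamma>1 t) ?F" "(\<gamma>2 \<longlongrightarrow> \<gamma>2 t) ?F"
    using tendsto_within_subset[OF limI(1) sub] tendsto_within_subset[OF limI(2) sub] by auto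
  have "\<forall>\<^sub>F s in ?F. \<gamma>2 s = \<gamma>1 s"
    using inF by eventually_elim (use ag in \<open>auto simp: first_order_agree_def\<close>)
  then have "(\<gamma>1 \<longlongrightarrow> \<gamma>2 t) ?F" using lim(2) tendsto_cong by fast
  then have eq: "\<gamma>1 t = \<gamma>2 t" using lim(1) nb tendsto_unique by blast
  obtain c where c: "c \<in> charts_at A (\<gamma>1 t)" using ex_chart_at by blast
  note cA = charts_atD[OF c]
  obtain v1 z1 where g1:
    "\<And>t. t \<in> ?I \<Longrightarrow> \<gamma>1 t \<in> chart_dom c \<Longrightarrow> (chart_map c \<circ> \<gamma>1 has_vector_derivative v1 t) (at t within ?I)"
    "\<And>t. t \<in> ?I \<Longrightarrow> \<gamma>1 t \<in> chart_dom c \<Longrightarrow> (v1 has_vector_derivative z1 t) (at t within ?I)"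
    by (rule geodesic_chart[OF geo(1) cA(1)]) (rule that)
  obtain v2 z2 where g2:
    "\<And>t. t \<in> ?I \<Longrightarrow> \<gamma>2 t \<in> chart_dom c \<Longrightarrow> (chart_map c \<circ> \<gamma>2 has_vector_derivative v2 t) (at t within ?I)"
    "\<And>t. t \<in> ?I \<Longrightarrow> \<gamma>2 t \<in> chart_dom c \<Longrightarrow> (v2 has_vector_derivative z2 t) (at t within ?I)"
    by (rule geodesic_chart[OF geo(2) cA(1)]) (rule that)
  have td: "\<gamma>1 t \<in> chart_dom c" "\<gamma>2 t \<in> chart_dom c" using cA eq by auto
  have "(v1 \<longlongrightarrow> v1 t) (at t within ?I)" "(v2 \<longlongrightarrow> v2 t) (at t within ?I)"
    using has_vector_derivative_continuous[OF g1(2)[OF tI td(1)]]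
      has_vector_derivative_continuous[OF g2(2)[OF tI td(2)]] by (auto simp: continuous_within)
  then have vlim: "(v1 \<longlongrightarrow> v1 t) ?F" "(v2 \<longlongrightarrow> v2 t) ?F"
    using tendsto_within_subset sub by blast+
  have "\<forall>\<^sub>F s in ?F. \<gamma>1 s \<in> chart_dom c"
    using topological_tendstoD[OF lim(1) chart_dom_open[OF cA(1)] td(1)] .
  with inF have "\<forall>\<^sub>F s in ?F. v2 s = v1 s"
  proof eventually_elim
    case (elim s)
    then have sI: "s \<in> ?I" and a: "first_order_agree ?I \<gamma>1 \<gamma>2 s" using sub ag by auto
    have e: "\<gamma>2 s = \<gamma>1 s" using a by (simp add: first_order_agree_def)
    have cs: "c \<in> charts_at A (\<gamma>1 s)" using elim cA by (simp add: charts_at_def)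
    obtain w where w: "(chart_map c \<circ> \<gamma>1 has_vector_derivative w) (at s within ?I)"
         "(chart_map c \<circ> \<gamma>2 has_vector_derivative w) (at s within ?I)"
      by (rule first_order_agree_chart[OF a cs sI cont]) (rule that)
    show ?case
      using has_vector_derivative_unique_Icc[OF sI zero_less_one w(1) g1(1)[OF sI]]
        has_vector_derivative_unique_Icc[OF sI zero_less_one w(2) g2(1)[OF sI]] elim e by simp
  qed
  then have "(v1 \<longlongrightarrow> v2 t) ?F" using vlim(2) tendsto_cong by fast
  then have "v1 t = v2 t" using vlim(1) nb tendsto_unique by blast
  then show ?thesis
    unfolding first_order_agree_def using eq c g1(1)[OF tI td(1)] g2(1)[OF tI td(2)] by metis
qed

text \<open>Makes the description in \<open>exp_map\<close> well defined. The times of first-order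
  agreement satisfy both steps of continuous induction.\<close>

lemma geodesic_from_unique:
  assumes "geodesic_from A g p v \<gamma>1" "geodesic_from A g p v \<gamma>2" "t \<in> {0..1}"
  shows "\<gamma>1 t = \<gamma>2 t"
proof -
  have geo: "geodesic_on A g {0..1} \<gamma>1" "geodesic_on A g {0..1} \<gamma>2"
    and 0: "\<gamma>1 0 = p" "\<gamma>2 0 = p"
    and v: "\<And>c. c \<in> charts_at A p \<Longrightarrow> (chart_map c \<circ> \<gamma>1 has_vector_derivative v c) (at 0 within {0..1})"
      "\<And>c. c \<in> charts_at A p \<Longrightarrow> (chart_map c \<circ> \<gamma>2 has_vector_derivative v c) (at 0 within {0..1})"
    using assms by (auto simp: geodesic_from_def)
  have ag0: "first_order_agree {0..1} \<gamma>1 \<gamma>2 0"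
    using 0 v ex_chart_at[of p] unfolding first_order_agree_def by metis
  have "first_order_agree {0..1} \<gamma>1 \<gamma>2 t"
  proof (rule real_interval_induct[OF _ _ assms(3)])
    fix s :: real assume "s \<in> {0..1}" "\<And>r. 0 \<le> r \<Longrightarrow> r < s \<Longrightarrow> first_order_agree {0..1} \<gamma>1 \<gamma>2 r"
    \<comment> \<open>At \<open>s = 0\<close> there are no earlier times to take a limit along, so
      the initial data are used instead.\<close>
    then show "first_order_agree {0..1} \<gamma>1 \<gamma>2 s"
      using ag0 geodesics_agree_limit[OF geo, of s] by (cases "s = 0") auto
  qed (use geodesics_agree_forward[OF geo] in auto)
  then show ?thesis by (simp add: first_order_agree_def)
qed

lemma exp_map_eq:
  assumes "geodesic_from A g p v \<gamma>"
  shows "exp_map A g p v = \<gamma> 1"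
  unfolding exp_map_def
proof (rule the_equality)
  show "\<exists>\<gamma>'. geodesic_from A g p v \<gamma>' \<and> \<gamma>' 1 = \<gamma> 1" using assms by blast
  show "q = \<gamma> 1" if "\<exists>\<gamma>'. geodesic_from A g p v \<gamma>' \<and> \<gamma>' 1 = q" for q
    using that geodesic_from_unique[OF assms, of _ 1] by auto
qed

section \<open>Rescaling of geodesics\<close>

lemma has_vector_derivative_rescale:
  fixes r :: real
  assumes "(f has_vector_derivative y) (at (r * s) within {0..1})" "r \<in> {0..1}" "s \<in> {0..1}"
  shows "((\<lambda>s. f (r * s)) has_vector_derivative r *\<^sub>R y) (at s within {0..1})"
proof -
  have sub: "(\<lambda>s. r * s) ` {0..1} \<subseteq> {0..1}" using assms(2) by (auto simp: mult_le_one)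
  have "((\<lambda>s. r * s) has_vector_derivative r) (at s within {0..1})"
    by (auto intro!: derivative_eq_intros simp: has_vector_derivative_def)
  then have "(f \<circ> (\<lambda>s. r * s) has_vector_derivative r *\<^sub>R y) (at s within {0..1})"
    by (rule vector_diff_chain_within) (rule has_vector_derivative_within_subset[OF assms(1) sub])
  then show ?thesis by (simp add: o_def)
qed

text \<open>The acceleration and the Christoffel term, quadratic in the velocity, both pick up the
  factor \<open>r * r\<close>, so the geodesic equation survives a linear change of time.\<close>

lemma geodesic_from_rescale:
  assumes \<gamma>: "geodesic_from A g p v \<gamma>" and r: "r \<in> {0..1}"
  shows "geodesic_from A g p (\<lambda>c. r *\<^sub>R v c) (\<lambda>s. \<gamma> (r * s))"
  unfolding geodesic_from_def geodesic_on_def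
proof (intro conjI ballI)
  let ?I = "{0..1::real}"
  have geo: "geodesic_on A g ?I \<gamma>" and 0: "\<gamma> 0 = p"
    and v: "\<And>c. c \<in> charts_at A p \<Longrightarrow> (chart_map c \<circ> \<gamma> has_vector_derivative v c) (at 0 within ?I)"
    using \<gamma> by (auto simp: geodesic_from_def)
  have rs: "r * s \<in> ?I" if "s \<in> ?I" for s using that r by (auto simp: mult_le_one)
  show "continuous_on ?I (\<lambda>s. \<gamma> (r * s))"
    by (rule continuous_on_compose2[OF geodesic_continuous[OF geo]]) (use rs in \<open>auto intro!: continuous_intros\<close>)
  show "\<gamma> (r * 0) = p" using 0 by simp
  show "(chart_map c \<circ> (\<lambda>s. \<gamma> (r * s)) has_vector_derivative r *\<^sub>R v c) (at 0 within ?I)"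
    if c: "c \<in> charts_at A p" for c
    using has_vector_derivative_rescale[of "chart_map c \<circ> \<gamma>" "v c" r 0] v[OF c] r by (simp add: o_def)
  fix c assume c: "c \<in> A"
  obtain x' x'' where x:
    "\<And>t. t \<in> ?I \<Longrightarrow> \<gamma> t \<in> chart_dom c \<Longrightarrow> (chart_map c \<circ> \<gamma> has_vector_derivative x' t) (at t within ?I)"
    "\<And>t. t \<in> ?I \<Longrightarrow> \<gamma> t \<in> chart_dom c \<Longrightarrow> (x' has_vector_derivative x'' t) (at t within ?I)"
    "\<And>t w. t \<in> ?I \<Longrightarrow> \<gamma> t \<in> chart_dom c \<Longrightarrow>
       gmat c (chart_map c (\<gamma> t)) (x'' t) w + christoffel1 A g c (chart_map c (\<gamma> t)) (x' t) (x' t) w = 0"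
    by (rule geodesic_chart[OF geo c]) (rule that)
  show "\<exists>x' x''. \<forall>t\<in>{t\<in>?I. \<gamma> (r * t) \<in> chart_dom c}.
        (chart_map c \<circ> (\<lambda>s. \<gamma> (r * s)) has_vector_derivative x' t) (at t within ?I) \<and>
        (x' has_vector_derivative x'' t) (at t within ?I) \<and>
        (\<forall>w. gmat c (chart_map c (\<gamma> (r * t))) (x'' t) w
              + christoffel1 A g c (chart_map c (\<gamma> (r * t))) (x' t) (x' t) w = 0)"
  proof (rule exI[of _ "\<lambda>t. r *\<^sub>R x' (r * t)"], rule exI[of _ "\<lambda>t. r *\<^sub>R r *\<^sub>R x'' (r * t)"],
      intro ballI conjI allI)
    fix t assume "t \<in> {t\<in>?I. \<gamma> (r * t) \<in> chart_dom c}"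
    then have t: "t \<in> ?I" "\<gamma> (r * t) \<in> chart_dom c" by auto
    show "(chart_map c \<circ> (\<lambda>s. \<gamma> (r * s)) has_vector_derivative r *\<^sub>R x' (r * t)) (at t within ?I)"
      using has_vector_derivative_rescale[OF x(1)[OF rs[OF t(1)] t(2)] r t(1)] by (simp add: o_def)
    show "((\<lambda>t. r *\<^sub>R x' (r * t)) has_vector_derivative r *\<^sub>R r *\<^sub>R x'' (r * t)) (at t within ?I)"
      by (rule bounded_linear.has_vector_derivative[OF bounded_linear_scaleR_right
            has_vector_derivative_rescale[OF x(2)[OF rs[OF t(1)] t(2)] r t(1)]])
    fix w
    note cl = christoffel1_linear[OF c chart_map_range[OF c t(2)]]
    have "gmat c (chart_map c (\<gamma> (r * t))) (r *\<^sub>R r *\<^sub>R x'' (r * t)) w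
          + christoffel1 A g c (chart_map c (\<gamma> (r * t))) (r *\<^sub>R x' (r * t)) (r *\<^sub>R x' (r * t)) w
       = r * r * (gmat c (chart_map c (\<gamma> (r * t))) (x'' (r * t)) w
           + christoffel1 A g c (chart_map c (\<gamma> (r * t))) (x' (r * t)) (x' (r * t)) w)"
      using linear_scale[OF cl(1)] linear_scale[OF cl(2)] by (simp add: blinfun.bilinear_simps algebra_simps)
    then show "gmat c (chart_map c (\<gamma> (r * t))) (r *\<^sub>R r *\<^sub>R x'' (r * t)) w
          + christoffel1 A g c (chart_map c (\<gamma> (r * t))) (r *\<^sub>R x' (r * t)) (r *\<^sub>R x' (r * t)) w = 0"
      using x(3)[OF rs[OF t(1)] t(2), of w] by simp
  qed
qed

lemma exp_map_radial:
  assumes "geodesic_from A g p v \<gamma>" "r \<in> {0..1}"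
  shows "exp_map A g p (\<lambda>c. r *\<^sub>R v c) = \<gamma> r"
  using exp_map_eq[OF geodesic_from_rescale[OF assms]] by simp

end

section \<open>Normal coordinates\<close>

text \<open>The chart \<open>c\<close> identifies the tangent space at \<open>p\<close> with the model space, and the exponential map
  becomes \<open>ex\<close>; the inverse of \<open>ex\<close> is the normal chart \<open>nc\<close>.\<close>

locale normal_coordinates = riemannian_manifold A g
  for A :: "('m::t2_space, 'h::{real_inner, banach}) chart set" and g :: "('m, 'h) metric" +
  fixes p :: 'm and U :: "('m, 'h) tvec set" and c :: "('m, 'h) chart"
  assumes c: "c \<in> charts_at A p" and U: "exp_diffeo_nbhd A g p U"
begin

definition ex :: "'h \<Rightarrow> 'm" where
  "ex a = exp_map A g p (tvec_of A p c a)"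

text \<open>The second condition makes the image visible in \<open>c\<close>, so that the same chart
  serves as coordinates on both sides of the exponential map.\<close>

definition W :: "'h set" where
  "W = {a. tvec_of A p c a \<in> U \<and> ex a \<in> chart_dom c}"

definition E :: "'h \<Rightarrow> 'h" where
  "E a = chart_map c (ex a)"

definition dE :: "'h \<Rightarrow> 'h \<Rightarrow> 'h" where
  "dE a = frechet_derivative E (at a)"

definition N :: "'h \<Rightarrow> real" where
  "N a = rnorm g p (tvec_of A p c a)"

lemmas cA = charts_atD[OF c]

lemma U_subset: "U \<subseteq> exp_dom A g p"
  using U by (simp add: exp_diffeo_nbhd_def)

lemma U_tangent: "v \<in> U \<Longrightarrow> v \<in> tangent_space A p"
  using U_subset by (auto simp: exp_dom_def)

lemma coords_eq:
  "(\<lambda>v. v c) ` {v\<in>U. exp_map A g p v \<in> chart_dom c'} = {a. tvec_of A p c a \<in> U \<and> ex a \<in> chart_dom c'}"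
proof (intro equalityI subsetI)
  fix a assume "a \<in> (\<lambda>v. v c) ` {v\<in>U. exp_map A g p v \<in> chart_dom c'}"
  then obtain v where v: "v \<in> U" "exp_map A g p v \<in> chart_dom c'" "a = v c" by blast
  then have "tvec_of A p c a = v" using tvec_of_coord[OF c U_tangent] by simp
  then show "a \<in> {a. tvec_of A p c a \<in> U \<and> ex a \<in> chart_dom c'}" using v by (simp add: ex_def)
next
  fix a assume "a \<in> {a. tvec_of A p c a \<in> U \<and> ex a \<in> chart_dom c'}"
  then show "a \<in> (\<lambda>v. v c) ` {v\<in>U. exp_map A g p v \<in> chart_dom c'}"
    using tvec_of_self[OF c, of a] unfolding ex_def by (intro image_eqI[of _ _ "tvec_of A p c a"]) auto
qed

lemma smooth_exp_chart:
  assumes "c' \<in> A"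
  shows "smooth_on {a. tvec_of A p c a \<in> U \<and> ex a \<in> chart_dom c'} (\<lambda>a. chart_map c' (ex a))"
proof -
  have "smooth_on ((\<lambda>v. v c) ` {v\<in>U. exp_map A g p v \<in> chart_dom c'})
          (\<lambda>a. chart_map c' (exp_map A g p (tvec_of A p c a)))"
    using U c assms unfolding exp_diffeo_nbhd_def by (elim conjE) (drule bspec, assumption, drule bspec, assumption, erule conjunct1)
  then show ?thesis unfolding coords_eq ex_def .
qed

lemma smooth_E: "smooth_on W E"
  using smooth_exp_chart[OF cA(1)] unfolding W_def E_def[abs_def] .

lemma open_W: "open W"
  using smooth_on_open[OF smooth_E] .

lemma tvec_of_zero_U: "tvec_of A p c 0 \<in> U"
  using U tvec_of_0[OF c] by (simp add: exp_diffeo_nbhd_def)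

lemma geodesic_of_coord:
  assumes "tvec_of A p c a \<in> U"
  obtains \<gamma> where "geodesic_from A g p (tvec_of A p c a) \<gamma>" "\<And>r. r \<in> {0..1} \<Longrightarrow> ex (r *\<^sub>R a) = \<gamma> r"
proof -
  obtain \<gamma> where \<gamma>: "geodesic_from A g p (tvec_of A p c a) \<gamma>"
    using assms U_subset by (auto simp: exp_dom_def)
  then show ?thesis using that exp_map_radial[OF \<gamma>] by (simp add: ex_def tvec_of_scale[OF c])
qed

text \<open>The ray through \<open>0\<close> is constant, so \<open>ex 0\<close> can be read off at
  time 0, where the geodesic is at \<open>p\<close> by definition.\<close>

lemma ex_0: "ex 0 = p"
proof -
  obtain \<gamma> where \<gamma>: "geodesic_from A g p (tvec_of A p c 0) \<gamma>" "\<And>r. r \<in> {0..1} \<Longrightarrow> ex (r *\<^sub>R 0) = \<gamma> r"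
    by (rule geodesic_of_coord[OF tvec_of_zero_U]) (rule that)
  then show ?thesis using \<gamma>(2)[of 0] by (simp add: geodesic_from_def)
qed

lemma zero_W: "0 \<in> W"
  using tvec_of_zero_U ex_0 cA by (simp add: W_def)

lemma E_0: "E 0 = chart_map c p"
  by (simp add: E_def ex_0)

lemma E_derivs:
  obtains D where "derivs_on W D" "\<And>a. a \<in> W \<Longrightarrow> D a [] = E a" "\<And>a b. a \<in> W \<Longrightarrow> dE a b = D a [b]"
proof -
  obtain D where D: "derivs_on W D" "\<And>a. a \<in> W \<Longrightarrow> D a [] = E a"
    by (rule smooth_on_derivs[OF smooth_E]) (rule that)
  have "dE a b = D a [b]" if "a \<in> W" for a b
    using fun_cong[OF frechet_derivative_at[OF smooth_on_has_derivative[OF D that]], of b] by (simp add: dE_def)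
  then show ?thesis using that[OF D] by blast
qed

lemma E_has_derivative: "a \<in> W \<Longrightarrow> (E has_derivative dE a) (at a)"
  using smooth_on_differentiable[OF smooth_E] by (simp add: dE_def frechet_derivative_works)

text \<open>Radial lines are geodesics, so the geodesic equation at time \<open>0\<close> determines the diagonal of
  the second derivative of \<open>E\<close>.\<close>

lemma radial_derivatives_small:
  assumes D: "derivs_on W D" "\<And>a. a \<in> W \<Longrightarrow> D a [] = E a"
    and seg: "\<And>r. r \<in> {0..1} \<Longrightarrow> r *\<^sub>R a \<in> W"
  shows "D 0 [a] = a" "gmat c (chart_map c p) (D 0 [a, a]) w + christoffel1 A g c (chart_map c p) a a w = 0"
proof -
  let ?I = "{0..1::real}"
  have "tvec_of A p c a \<in> U" using seg[of 1] by (simp add: W_def)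
  then obtain \<gamma> where \<gamma>: "geodesic_from A g p (tvec_of A p c a) \<gamma>" "\<And>r. r \<in> ?I \<Longrightarrow> ex (r *\<^sub>R a) = \<gamma> r"
    by (rule geodesic_of_coord) (rule that)
  have geo: "geodesic_on A g ?I \<gamma>" and \<gamma>0: "\<gamma> 0 = p"
    and v: "(chart_map c \<circ> \<gamma> has_vector_derivative a) (at 0 within ?I)"
    using \<gamma>(1) c tvec_of_self[OF c] by (auto simp: geodesic_from_def)
  have dom: "\<gamma> r \<in> chart_dom c" if "r \<in> ?I" for r
    using seg[OF that] \<gamma>(2)[OF that] by (simp add: W_def)
  obtain x' x'' where x:
    "\<And>t. t \<in> ?I \<Longrightarrow> \<gamma> t \<in> chart_dom c \<Longrightarrow> (chart_map c \<circ> \<gamma> has_vector_derivative x' t) (at t within ?I)"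
    "\<And>t. t \<in> ?I \<Longrightarrow> \<gamma> t \<in> chart_dom c \<Longrightarrow> (x' has_vector_derivative x'' t) (at t within ?I)"
    "\<And>t w. t \<in> ?I \<Longrightarrow> \<gamma> t \<in> chart_dom c \<Longrightarrow>
       gmat c (chart_map c (\<gamma> t)) (x'' t) w + christoffel1 A g c (chart_map c (\<gamma> t)) (x' t) (x' t) w = 0"
    by (rule geodesic_chart[OF geo cA(1)]) (rule that)
  \<comment> \<open>Differentiating along the ray prepends \<open>a\<close> to the argument list.
    Uniqueness of derivatives then identifies \<open>x' r\<close> with
    \<open>D (r *\<^sub>R a) [a]\<close> and \<open>x'' 0\<close> with
    \<open>D 0 [a, a]\<close>.\<close>
  have ray: "((\<lambda>r. D (r *\<^sub>R a) vs) has_vector_derivative D (r *\<^sub>R a) (a # vs)) (at r within ?I)"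
    if "r \<in> ?I" for r vs
  proof -
    have d: "((\<lambda>y. D y vs) has_derivative (\<lambda>h. D (r *\<^sub>R a) (h # vs))) (at (r *\<^sub>R a))"
      by (rule derivs_on_has_derivative[OF D(1) seg[OF that]])
    have "((\<lambda>r. D (r *\<^sub>R a) vs) has_derivative (\<lambda>u. D (r *\<^sub>R a) ((u *\<^sub>R a) # vs))) (at r within ?I)"
      by (rule has_derivative_compose[where f="\<lambda>r. r *\<^sub>R a" and f'="\<lambda>u. u *\<^sub>R a" and g="\<lambda>y. D y vs"])
        (auto intro!: derivative_eq_intros d)
    then show ?thesis
      using linear_scale[OF has_derivative_linear[OF d]] by (simp add: has_vector_derivative_def)
  qed
  have eq0: "(chart_map c \<circ> \<gamma>) r = D (r *\<^sub>R a) []" if "r \<in> ?I" for r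
    using D(2)[OF seg[OF that]] \<gamma>(2)[OF that] by (simp add: E_def)
  have eq1: "x' r = D (r *\<^sub>R a) [a]" if r: "r \<in> ?I" for r
  proof (rule has_vector_derivative_unique_Icc[OF r zero_less_one])
    show "(chart_map c \<circ> \<gamma> has_vector_derivative x' r) (at r within ?I)" by (rule x(1)[OF r dom[OF r]])
    show "(chart_map c \<circ> \<gamma> has_vector_derivative D (r *\<^sub>R a) [a]) (at r within ?I)"
      by (rule has_vector_derivative_transform[OF r eq0 ray[OF r]])
  qed
  have 0: "(0::real) \<in> ?I" by simp
  have eq2: "x'' 0 = D 0 [a, a]"
  proof (rule has_vector_derivative_unique_Icc[OF 0 zero_less_one])
    show "(x' has_vector_derivative x'' 0) (at 0 within ?I)" by (rule x(2)[OF 0 dom[OF 0]])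
    show "(x' has_vector_derivative D 0 [a, a]) (at 0 within ?I)"
      using has_vector_derivative_transform[OF 0 eq1 ray[OF 0, of "[a]"]] by simp
  qed
  have "x' 0 = a" by (rule has_vector_derivative_unique_Icc[OF 0 zero_less_one x(1)[OF 0 dom[OF 0]] v])
  then show "D 0 [a] = a" using eq1[OF 0] by simp
  show "gmat c (chart_map c p) (D 0 [a, a]) w + christoffel1 A g c (chart_map c p) a a w = 0"
    using x(3)[OF 0 dom[OF 0], of w] eq2 \<open>x' 0 = a\<close> \<gamma>0 by simp
qed

text \<open>The restriction that the segment to \<open>a\<close> lies in \<open>W\<close> disappears
  by scaling: the first identity is linear in \<open>a\<close>, and both terms of the second are
  quadratic.\<close>

lemma radial_derivatives:
  assumes D: "derivs_on W D" "\<And>a. a \<in> W \<Longrightarrow> D a [] = E a"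
  shows "D 0 [a] = a" "gmat c (chart_map c p) (D 0 [a, a]) w + christoffel1 A g c (chart_map c p) a a w = 0"
proof -
  obtain d where d: "d > 0" "ball 0 d \<subseteq> W" using open_W zero_W open_contains_ball by blast
  define s where "s = d / (norm a + 1)"
  have s: "s > 0" using d by (simp add: s_def add_nonneg_pos)
  have "s * norm a < d"
  proof -
    have "s * norm a < s * (norm a + 1)" using s by simp
    also have "\<dots> = d" using norm_ge_zero[of a] by (simp add: s_def add_nonneg_pos less_imp_neq[symmetric])
    finally show ?thesis .
  qed
  then have "r *\<^sub>R s *\<^sub>R a \<in> W" if "r \<in> {0..1}" for r
  proof -
    have "norm (r *\<^sub>R s *\<^sub>R a) = r * (s * norm a)" using that s by simp
    also have "\<dots> \<le> 1 * (s * norm a)" using that s by (intro mult_right_mono) auto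
    also have "\<dots> < d" using \<open>s * norm a < d\<close> by simp
    finally show ?thesis using d(2) by (auto simp: dist_norm)
  qed
  note small = radial_derivatives_small[OF D this]
  have lin1: "linear (\<lambda>h. D 0 [h])" using derivs_on_linear[OF D(1) zero_W, of "[]" "[]"] by simp
  have lin2: "linear (\<lambda>h. D 0 [h, b])" "linear (\<lambda>h. D 0 [b, h])" for b
    using derivs_on_linear[OF D(1) zero_W, of "[]" "[b]"] derivs_on_linear[OF D(1) zero_W, of "[b]" "[]"] by simp_all
  show "D 0 [a] = a" using small(1) s linear_scale[OF lin1] by simp
  note cl = christoffel1_linear[OF cA(1) chart_map_range[OF cA]]
  have "D 0 [s *\<^sub>R a, s *\<^sub>R a] = s *\<^sub>R s *\<^sub>R D 0 [a, a]"
    using linear_scale[OF lin2(1), of s a "s *\<^sub>R a"] linear_scale[OF lin2(2), of a s a] by simp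
  moreover have "christoffel1 A g c (chart_map c p) (s *\<^sub>R a) (s *\<^sub>R a) w = s * s * christoffel1 A g c (chart_map c p) a a w"
    using linear_scale[OF cl(1)] linear_scale[OF cl(2)] by simp
  ultimately have "s * s * (gmat c (chart_map c p) (D 0 [a, a]) w + christoffel1 A g c (chart_map c p) a a w) = 0"
    using small(2)[of w] by (simp add: blinfun.bilinear_simps algebra_simps)
  then show "gmat c (chart_map c p) (D 0 [a, a]) w + christoffel1 A g c (chart_map c p) a a w = 0"
    using s by simp
qed

lemma dE_0: "dE 0 b = b"
proof -
  obtain D where D: "derivs_on W D" "\<And>a. a \<in> W \<Longrightarrow> D a [] = E a" "\<And>a b. a \<in> W \<Longrightarrow> dE a b = D a [b]"
    by (rule E_derivs) (rule that)
  show ?thesis using D(3)[OF zero_W] radial_derivatives(1)[OF D(1,2)] by simp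
qed

lemma normal_metric_flat:
  assumes e: "e > 0"
  obtains d where "d > 0" "ball 0 d \<subseteq> W" "\<And>a b. norm a < d \<Longrightarrow>
    \<bar>gmat c (E a) (dE a b) (dE a b) - gmat c (chart_map c p) b b\<bar> \<le> e * norm a * (norm b)\<^sup>2"
proof -
  let ?x = "chart_map c p"
  obtain D where D: "derivs_on W D" "\<And>a. a \<in> W \<Longrightarrow> D a [] = E a" "\<And>a b. a \<in> W \<Longrightarrow> dE a b = D a [b]"
    by (rule E_derivs) (rule that)
  note rad = radial_derivatives[OF D(1,2)]
  obtain r where r: "r > 0" "ball 0 r \<subseteq> W" using open_W zero_W open_contains_ball by blast
  define DG where "DG = frechet_derivative (metric_rep A g c) (at ?x)"
  have xr: "?x \<in> chart_range c" by (rule chart_map_range[OF cA])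
  have DG: "(metric_rep A g c has_derivative DG) (at ?x)"
    unfolding DG_def by (rule metric_rep_has_derivative[OF cA(1) xr])
  have "((\<lambda>a. metric_rep A g c (E a)) has_derivative (\<lambda>h. DG (dE 0 h))) (at 0)"
    by (rule has_derivative_compose[OF E_has_derivative[OF zero_W]]) (simp add: E_0 DG)
  then have Gh: "((\<lambda>a. metric_rep A g c (E a)) has_derivative DG) (at 0)" by (simp add: dE_0)
  obtain K where K: "0 \<le> K" "\<And>vs. length vs = 2 \<Longrightarrow> norm (D 0 vs) \<le> K * prod_list (map norm vs)"
    by (rule derivs_on_bound[OF D(1) zero_W, of 2]) (rule that)
  note sym = dmetric_rep_sym[OF cA(1) xr, folded DG_def]
  have lin2: "linear (\<lambda>h. D 0 [h, b])" "linear (\<lambda>h. D 0 [b, h])" for b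
    using derivs_on_linear[OF D(1) zero_W, of "[]" "[b]"] derivs_on_linear[OF D(1) zero_W, of "[b]" "[]"] by simp_all
  note cl = christoffel1_linear[OF cA(1) xr]
  \<comment> \<open>Polarisation: the radial identity at \<open>a + b\<close>, minus those at
    \<open>a\<close> and at \<open>b\<close>, isolates the mixed derivative
    \<open>D 0 [a, b]\<close>, provided that the latter is symmetric.\<close>
  have canc: "2 * gmat c (E 0) (D 0 [a, b]) b + blinfun_apply (blinfun_apply (DG a) b) b = 0" for a b
  proof -
    have "D 0 [a + b, a + b] = D 0 [a, a] + 2 *\<^sub>R D 0 [a, b] + D 0 [b, b]"
      using linear_add[OF lin2(1), of a b "a + b"] linear_add[OF lin2(2), of _ a b]
        derivs_on_symmetric[OF D(1) zero_W, of b a] by (simp add: scaleR_2)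
    then have "gmat c ?x (D 0 [a + b, a + b]) b =
        gmat c ?x (D 0 [a, a]) b + 2 * gmat c ?x (D 0 [a, b]) b + gmat c ?x (D 0 [b, b]) b"
      by (simp add: blinfun.bilinear_simps)
    moreover have "christoffel1 A g c ?x (a + b) (a + b) b = christoffel1 A g c ?x a a b
        + (christoffel1 A g c ?x a b b + christoffel1 A g c ?x b a b) + christoffel1 A g c ?x b b b"
      using linear_add[OF cl(1)] linear_add[OF cl(2)] by simp
    \<comment> \<open>When the third argument equals \<open>b\<close>, the derivatives in direction
      \<open>b\<close> cancel in each symbol and half of the derivative in direction
      \<open>a\<close> remains.\<close>
    moreover have "christoffel1 A g c ?x a b b + christoffel1 A g c ?x b a b = blinfun_apply (blinfun_apply (DG a) b) b"
      using sym[of b a b] by (simp add: christoffel1_def Let_def DG_def[symmetric])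
    ultimately show ?thesis using rad(2)[of "a + b" b] rad(2)[of a b] rad(2)[of b b] by (simp add: E_0)
  qed
  obtain d where d: "d > 0" "\<And>a b. norm a < d \<Longrightarrow>
    \<bar>blinfun_apply (blinfun_apply (metric_rep A g c (E a)) (D a [b])) (D a [b]) - gmat c (E 0) b b\<bar>
      \<le> e * norm a * (norm b)\<^sup>2"
  proof (rule pullback_form_flat[where Gh="\<lambda>a. metric_rep A g c (E a)" and DG=DG and T="\<lambda>a b. D a [b]"
        and B="\<lambda>a b. D 0 [a, b]" and K=K and e=e])
    fix e' :: real assume "e' > 0"
    then obtain d' where d': "d' > 0" "\<And>y vs. y \<in> W \<Longrightarrow> norm (y - 0) < d' \<Longrightarrow> length vs = 1 \<Longrightarrow>
      norm (D y vs - D 0 vs - D 0 ((y - 0) # vs)) \<le> e' * norm (y - 0) * prod_list (map norm vs)"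
      by (rule derivs_on_remainder[OF D(1) zero_W, of _ 1]) (rule that)
    have "norm (D a [b] - b - D 0 [a, b]) \<le> e' * norm a * norm b" if "norm a < min d' r" for a b
    proof -
      have "a \<in> W" using that r(2) by (auto simp: dist_norm)
      then show ?thesis using d'(2)[of a "[b]"] that rad(1) by simp
    qed
    then show "\<exists>d>0. \<forall>a. norm a < d \<longrightarrow> (\<forall>b. norm (D a [b] - b - D 0 [a, b]) \<le> e' * norm a * norm b)"
      using d'(1) r(1) by (intro exI[of _ "min d' r"]) auto
  next
    show "norm (D 0 [a, b]) \<le> K * norm a * norm b" for a b using K(2)[of "[a, b]"] by (simp add: mult.assoc)
    show "gmat c (E 0) u v = gmat c (E 0) v u" for u v using gmat_sym[OF cA(1) xr] by (simp add: E_0)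
  qed (use Gh K canc e in auto)
  show ?thesis
  proof (rule that[of "min d r"])
    show "\<bar>gmat c (E a) (dE a b) (dE a b) - gmat c ?x b b\<bar> \<le> e * norm a * (norm b)\<^sup>2" if "norm a < min d r" for a b
    proof -
      have "a \<in> W" using that r(2) by (auto simp: dist_norm)
      then show ?thesis using d(2)[of a b] that D(3) by (simp add: E_0)
    qed
  qed (use d r in auto)
qed

section \<open>The norm at \<open>p\<close> in coordinates, and its comparison with the metric
  nearby\<close>

lemma N_eq: "N a = sqrt (gmat c (chart_map c p) a a)"
  by (simp add: N_def rnorm_tvec_of[OF c])

lemma gmat_cauchy_schwarz: "\<bar>gmat c (chart_map c p) a b\<bar> \<le> N a * N b"
proof -
  have "linear (\<lambda>u. gmat c (chart_map c p) u v)" for v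
    by (rule linearI) (simp_all add: blinfun.bilinear_simps)
  then show ?thesis unfolding N_eq
    by (rule form_cauchy_schwarz) (use gmat_sym[OF cA(1) chart_map_range[OF cA]] metric_form_pos[OF c] in \<open>auto simp: metric_rep_apply[OF c]\<close>)
qed

lemma gmat_p_nonneg: "0 \<le> gmat c (chart_map c p) a a"
  using metric_form_pos[OF c, of a] by (cases "a = 0") (auto simp: metric_rep_apply[OF c, symmetric] blinfun.bilinear_simps)

lemma N_nonneg: "0 \<le> N a"
  by (simp add: N_eq gmat_p_nonneg)

lemma N_square: "(N a)\<^sup>2 = gmat c (chart_map c p) a a"
  by (simp add: N_eq gmat_p_nonneg)

lemma N_scale: "N (s *\<^sub>R a) = \<bar>s\<bar> * N a"
proof -
  have "N (s *\<^sub>R a) = sqrt (s\<^sup>2 * gmat c (chart_map c p) a a)"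
    by (simp add: N_eq blinfun.bilinear_simps power2_eq_square mult.assoc)
  then show ?thesis by (simp add: N_eq real_sqrt_mult)
qed

lemma N_triangle: "N (a + b) \<le> N a + N b"
proof (rule power2_le_imp_le)
  have "(N (a + b))\<^sup>2 = gmat c (chart_map c p) a a + 2 * gmat c (chart_map c p) a b + gmat c (chart_map c p) b b"
    using gmat_sym[OF cA(1) chart_map_range[OF cA], of a b] by (simp add: N_square blinfun.bilinear_simps)
  also have "\<dots> \<le> (N a)\<^sup>2 + 2 * (N a * N b) + (N b)\<^sup>2"
    using gmat_cauchy_schwarz[of a b] by (simp add: N_square)
  finally show "(N (a + b))\<^sup>2 \<le> (N a + N b)\<^sup>2" by (simp add: power2_sum)
qed (use N_nonneg in simp)

lemma N_minus_commute: "N (a - b) = N (b - a)"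
  using N_scale[of "-1" "a - b"] by simp

lemma N_equiv:
  obtains k K where "k > 0" "K > 0" "\<And>a. k * norm a \<le> N a" "\<And>a. N a \<le> K * norm a"
  by (rule metric_form_equiv[OF c]) (auto simp: N_def intro: that)

text \<open>The radius \<open>r\<close> is kept apart from \<open>N a\<close> so that one factor
  serves every base point in the ball.\<close>

lemma normal_metric_estimate:
  assumes e: "e > 0"
  obtains d where "d > 0" "\<And>a. N a < d \<Longrightarrow> a \<in> W"
    "\<And>r a b. r < d \<Longrightarrow> N a \<le> r \<Longrightarrow> N b \<le> (1 + e * r) * sqrt (gmat c (E a) (dE a b) (dE a b))"
    "\<And>r a b. r < d \<Longrightarrow> N a \<le> r \<Longrightarrow> sqrt (gmat c (E a) (dE a b) (dE a b)) \<le> (1 + e * r) * N b"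
proof -
  obtain k K where k: "k > 0" "\<And>a. k * norm a \<le> N a" by (rule N_equiv) (rule that)
  \<comment> \<open>One factor \<open>k\<close> converts \<open>norm a\<close> to \<open>N a\<close>
    and two convert the square of \<open>norm b\<close>; the 1/2 leaves room for passing from
    squares to norms.\<close>
  define e' where "e' = k ^ 3 * e / 2"
  have "e' > 0" using e k by (simp add: e'_def)
  then obtain d where d: "d > 0" "ball 0 d \<subseteq> W" "\<And>a b. norm a < d \<Longrightarrow>
    \<bar>gmat c (E a) (dE a b) (dE a b) - gmat c (chart_map c p) b b\<bar> \<le> e' * norm a * (norm b)\<^sup>2"
    by (rule normal_metric_flat) (rule that)
  \<comment> \<open>\<open>k * d\<close> turns a bound on \<open>N a\<close> into one on
    \<open>norm a\<close>, and \<open>1 / e\<close> ensures \<open>e * r < 1\<close>.\<close>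
  define d' where "d' = min (k * d) (1 / e)"
  have small: "norm a < d" if "N a < d'" for a
  proof -
    have "k * norm a < k * d" using k(2)[of a] that by (simp add: d'_def)
    then show ?thesis using k(1) by simp
  qed
  have key: "\<bar>gmat c (E a) (dE a b) (dE a b) - (N b)\<^sup>2\<bar> \<le> e * r / 2 * (N b)\<^sup>2"
    and r0: "0 \<le> e * r" "e * r < 1"
    if r: "r < d'" "N a \<le> r" for r a b
  proof -
    have r1: "r \<ge> 0" using r N_nonneg[of a] by linarith
    have "norm a \<le> r / k" using k(1) k(2)[of a] r by (simp add: field_simps)
    have "\<bar>gmat c (E a) (dE a b) (dE a b) - (N b)\<^sup>2\<bar> \<le> e' * norm a * (norm b)\<^sup>2"
      using d(3)[OF small] r by (simp add: N_square)
    also have "\<dots> \<le> e' * (r / k) * (N b / k)\<^sup>2"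
    proof (intro mult_mono power_mono)
      show "norm b \<le> N b / k" using k(1) k(2)[of b] by (simp add: field_simps)
    qed (use \<open>norm a \<le> r / k\<close> \<open>e' > 0\<close> r1 k in auto)
    also have "\<dots> = e * r / 2 * (N b)\<^sup>2" using k(1) by (simp add: e'_def field_simps power2_eq_square power3_eq_cube)
    finally show "\<bar>gmat c (E a) (dE a b) (dE a b) - (N b)\<^sup>2\<bar> \<le> e * r / 2 * (N b)\<^sup>2" .
    show "0 \<le> e * r" using e r1 by simp
    have "e * r < e * (1 / e)" using r e by (intro mult_strict_left_mono) (auto simp: d'_def)
    then show "e * r < 1" using e by simp
  qed
  show ?thesis
  proof (rule that[of d'])
    show "d' > 0" using d k e by (simp add: d'_def)
    show "a \<in> W" if "N a < d'" for a using small[OF that] d(2) by (auto simp: dist_norm)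
    fix r a b assume r: "r < d'" "N a \<le> r"
    define H where "H = gmat c (E a) (dE a b) (dE a b)"
    note h = key[OF r, of b, folded H_def] r0[OF r]
    have er: "1 - e * r / 2 > 0" using h by simp
    have Hlow: "(1 - e * r / 2) * (N b)\<^sup>2 \<le> H" and Hup: "H \<le> (1 + e * r / 2) * (N b)\<^sup>2"
      using h(1) unfolding abs_le_iff left_diff_distrib distrib_right mult_1 by linarith+
    have H0: "0 \<le> H" using Hlow er by (meson mult_nonneg_nonneg less_imp_le order_trans zero_le_power2)
    have "(N b)\<^sup>2 \<le> (1 + e * r)\<^sup>2 * H"
    proof -
      \<comment> \<open>This replaces division by \<open>1 - e * r / 2\<close> by multiplication
        with \<open>(1 + e * r)\<^sup>2\<close>, so that the lower and the upper estimate share one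
        factor.\<close>
      have "1 \<le> (1 + e * r)\<^sup>2 * (1 - e * r / 2)"
      proof -
        define x where "x = e * r"
        have "0 \<le> x" "x\<^sup>2 \<le> 1" using h(2,3) by (auto simp: x_def power_le_one)
        then have "0 \<le> x * (3 - x\<^sup>2) / 2" by simp
        moreover have "(1 + x)\<^sup>2 * (1 - x / 2) = 1 + x * (3 - x\<^sup>2) / 2"
          by (simp add: power2_eq_square field_simps)
        ultimately show ?thesis unfolding x_def by linarith
      qed
      then have "1 * (N b)\<^sup>2 \<le> (1 + e * r)\<^sup>2 * (1 - e * r / 2) * (N b)\<^sup>2" by (rule mult_right_mono) simp
      also have "\<dots> \<le> (1 + e * r)\<^sup>2 * H" using Hlow unfolding mult.assoc by (intro mult_left_mono) auto
      finally show ?thesis by simp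
    qed
    then have "sqrt ((N b)\<^sup>2) \<le> sqrt ((1 + e * r)\<^sup>2 * H)" by (rule real_sqrt_le_mono)
    then show "N b \<le> (1 + e * r) * sqrt H" using h(2) N_nonneg by (simp add: real_sqrt_mult)
    have "H \<le> (1 + e * r)\<^sup>2 * (N b)\<^sup>2"
    proof -
      have "1 + x / 2 \<le> (1 + x)\<^sup>2" if "0 \<le> x" for x :: real
        using that zero_le_power2[of x] unfolding power2_sum by simp
      from this[OF h(2)] have "1 + e * r / 2 \<le> (1 + e * r)\<^sup>2" .
      then have "(1 + e * r / 2) * (N b)\<^sup>2 \<le> (1 + e * r)\<^sup>2 * (N b)\<^sup>2" by (rule mult_right_mono) simp
      then show ?thesis using Hup by linarith
    qed
    then have "sqrt H \<le> sqrt ((1 + e * r)\<^sup>2 * (N b)\<^sup>2)" by (rule real_sqrt_le_mono)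
    then show "sqrt H \<le> (1 + e * r) * N b" using h(2) N_nonneg by (simp add: real_sqrt_mult)
  qed
qed

end

section \<open>Speed of curves\<close>

text \<open>\<open>velocity\<close> uses the two-sided derivative, which need not exist at end
  points and corners. Pointwise bounds on the speed are therefore available only off a finite
  set.\<close>

lemma integral_le_finite_except:
  fixes f h :: "real \<Rightarrow> real"
  assumes "f integrable_on {a..b}" "h integrable_on {a..b}" "finite F"
    and le: "\<And>x. x \<in> {a..b} - F \<Longrightarrow> f x \<le> h x"
  shows "integral {a..b} f \<le> integral {a..b} h"
proof -
  define h' where "h' x = (if x \<in> F then f x else h x)" for x
  have neg: "negligible F" using assms(3) by (rule negligible_finite)
  have "h' integrable_on {a..b}"
    by (rule integrable_spike_finite[OF assms(3) _ assms(2)]) (simp add: h'_def)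
  then have "integral {a..b} f \<le> integral {a..b} h'"
    using assms(1) le by (intro integral_le) (auto simp: h'_def)
  also have "\<dots> = integral {a..b} h"
    by (rule integral_spike[OF neg]) (simp add: h'_def)
  finally show ?thesis .
qed

context riemannian_manifold
begin

definition speed :: "(real \<Rightarrow> 'm) \<Rightarrow> real \<Rightarrow> real" where
  "speed \<gamma> t = rnorm g (\<gamma> t) (velocity A \<gamma> t)"

text \<open>The times at which the two-sided derivative exists, so that the speed is the metric norm
  of a genuine derivative in every chart. A piecewise C1 curve has only finitely many other
  times.\<close>

definition regular_at :: "(real \<Rightarrow> 'm) \<Rightarrow> real \<Rightarrow> bool" where
  "regular_at \<gamma> t \<longleftrightarrow> isCont \<gamma> t \<and> (\<forall>c\<in>charts_at A (\<gamma> t). \<exists>y.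
     (chart_map c \<circ> \<gamma> has_vector_derivative y) (at t) \<and>
     speed \<gamma> t = sqrt (gmat c (chart_map c (\<gamma> t)) y y))"

lemma C1_curve_regular_at:
  assumes \<gamma>: "C1_curve_on A {a..b} \<gamma>" and t: "t \<in> {a<..<b}"
  shows "regular_at \<gamma> t"
  unfolding regular_at_def
proof (intro conjI ballI)
  have "at t within {a..b} = at t" using t by (intro at_within_Icc_at) auto
  moreover have "continuous_on {a..b} \<gamma>" using \<gamma> by (simp add: C1_curve_on_def)
  ultimately show cont: "isCont \<gamma> t"
    using t by (metis atLeastAtMost_iff continuous_on_eq_continuous_within greaterThanLessThan_iff less_imp_le)
  fix c assume c: "c \<in> charts_at A (\<gamma> t)"
  have "\<exists>x'. \<forall>s\<in>{s\<in>{a..b}. \<gamma> s \<in> chart_dom c}.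
      (chart_map c \<circ> \<gamma> has_vector_derivative x' s) (at s within {a..b})"
    using \<gamma> charts_atD(1)[OF c] unfolding C1_curve_on_def by blast
  then obtain x' where x': "\<forall>s\<in>{s\<in>{a..b}. \<gamma> s \<in> chart_dom c}.
      (chart_map c \<circ> \<gamma> has_vector_derivative x' s) (at s within {a..b})" by (elim exE)
  define y where "y = x' t"
  have "(chart_map c \<circ> \<gamma> has_vector_derivative y) (at t within {a..b})"
    unfolding y_def using t charts_atD(2)[OF c] by (intro x'[rule_format]) auto
  then have y: "(chart_map c \<circ> \<gamma> has_vector_derivative y) (at t)"
    using \<open>at t within {a..b} = at t\<close> by simp
  show "\<exists>y. (chart_map c \<circ> \<gamma> has_vector_derivative y) (at t) \<and>
     speed \<gamma> t = sqrt (gmat c (chart_map c (\<gamma> t)) y y)"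
    using y velocity_eq_tvec_of[OF c cont y] rnorm_tvec_of[OF c, of y] by (auto simp: speed_def)
qed

text \<open>No single chart need cover the curve. The norm of the derivative is expressed in each
  chart by a continuous function, these expressions agree on overlaps, and together they form a
  continuous function on the closed interval that equals the speed off the end points.\<close>

lemma C1_curve_speed_integrable:
  assumes \<gamma>: "C1_curve_on A {a..b} \<gamma>" and ab: "a < b"
  shows "speed \<gamma> integrable_on {a..b}"
proof -
  let ?I = "{a..b}"
  have cont: "continuous_on ?I \<gamma>" using \<gamma> by (simp add: C1_curve_on_def)
  have "\<forall>c\<in>A. \<exists>x'. continuous_on {t\<in>?I. \<gamma> t \<in> chart_dom c} x' \<and>
        (\<forall>t\<in>{t\<in>?I. \<gamma> t \<in> chart_dom c}. (chart_map c \<circ> \<gamma> has_vector_derivative x' t) (at t within ?I))"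
    using \<gamma> by (simp add: C1_curve_on_def)
  from bchoice[OF this] obtain X where X: "\<And>c. c \<in> A \<Longrightarrow> continuous_on {t\<in>?I. \<gamma> t \<in> chart_dom c} (X c)"
    "\<And>c t. c \<in> A \<Longrightarrow> t \<in> ?I \<Longrightarrow> \<gamma> t \<in> chart_dom c \<Longrightarrow> (chart_map c \<circ> \<gamma> has_vector_derivative X c t) (at t within ?I)"
    by blast
  define h where "h c t = sqrt (gmat c (chart_map c (\<gamma> t)) (X c t) (X c t))" for c t
  \<comment> \<open>The chosen chart may jump with \<open>t\<close>; \<open>indep\<close> makes the
    value of \<open>h\<close> insensitive to the choice.\<close>
  define ch where "ch t = (SOME c. c \<in> charts_at A (\<gamma> t))" for t
  have ch: "ch t \<in> charts_at A (\<gamma> t)" for t unfolding ch_def using someI_ex[OF ex_chart_at] .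
  have indep: "h c t = h d t" if t: "t \<in> ?I" and c: "c \<in> charts_at A (\<gamma> t)" and d: "d \<in> charts_at A (\<gamma> t)" for c d t
  proof -
    have lim: "(\<gamma> \<longlongrightarrow> \<gamma> t) (at t within ?I)" using cont t by (auto simp: continuous_on_def)
    note cA = charts_atD[OF c] and dA = charts_atD[OF d]
    have "X d t = dtransition c d (\<gamma> t) (X c t)"
      by (rule has_vector_derivative_unique_Icc[OF t ab X(2)[OF dA(1) t dA(2)]
            vector_derivative_chart_change[OF c d lim t X(2)[OF cA(1) t cA(2)]]])
    then have "tvec_of A (\<gamma> t) c (X c t) d = X d t" using d by (simp add: tvec_of_def)
    then have "tvec_of A (\<gamma> t) d (X d t) = tvec_of A (\<gamma> t) c (X c t)"
      using tvec_of_coord[OF d tvec_of_in_tangent_space[OF c, of "X c t"]] by simp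
    then show ?thesis using rnorm_tvec_of[OF c, of "X c t"] rnorm_tvec_of[OF d, of "X d t"] by (simp add: h_def)
  qed
  have "continuous_on ?I (\<lambda>t. h (ch t) t)"
    unfolding continuous_on_def
  proof
    fix t assume t: "t \<in> ?I"
    define c where "c = ch t"
    have c: "c \<in> charts_at A (\<gamma> t)" using ch by (simp add: c_def)
    note cA = charts_atD[OF c]
    define S where "S = {s\<in>?I. \<gamma> s \<in> chart_dom c}"
    have tS: "t \<in> S" using t cA by (simp add: S_def)
    have c1: "continuous_on S (\<lambda>s. chart_map c (\<gamma> s))"
      by (rule continuous_on_compose2[OF chart_map_continuous[OF cA(1)] continuous_on_subset[OF cont]])
        (auto simp: S_def)
    have c2: "continuous_on S (\<lambda>s. metric_rep A g c (chart_map c (\<gamma> s)))"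
      by (rule continuous_on_compose2[OF smooth_on_continuous_on[OF metric_smooth[OF cA(1)]] c1])
        (auto simp: S_def intro: chart_map_range cA)
    have "continuous_on S (h c)"
      unfolding h_def[abs_def] using X(1)[OF cA(1)] c2
      by (intro continuous_on_real_sqrt bounded_bilinear.continuous_on[OF bounded_bilinear_blinfun_apply])
        (auto simp: S_def)
    then have hS: "(h c \<longlongrightarrow> h c t) (at t within S)" using tS by (simp add: continuous_on_def)
    have ev: "\<forall>\<^sub>F s in at t within ?I. s \<in> S"
    proof -
      have "(\<gamma> \<longlongrightarrow> \<gamma> t) (at t within ?I)" using cont t by (auto simp: continuous_on_def)
      then have "\<forall>\<^sub>F s in at t within ?I. \<gamma> s \<in> chart_dom c"
        using chart_dom_open[OF cA(1)] cA(2) by (rule topological_tendstoD)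
      moreover have "\<forall>\<^sub>F s in at t within ?I. s \<in> ?I" by (simp add: eventually_at_filter)
      ultimately show ?thesis by eventually_elim (simp add: S_def)
    qed
    have "(h c \<longlongrightarrow> h c t) (at t within ?I)"
    proof (rule topological_tendstoI)
      fix B assume "open B" "h c t \<in> B"
      then have "\<forall>\<^sub>F s in at t within S. h c s \<in> B" using hS by (intro topological_tendstoD)
      then have "\<forall>\<^sub>F s in at t within ?I. s \<in> S \<longrightarrow> h c s \<in> B"
        unfolding eventually_at_filter by (rule eventually_mono) auto
      with ev show "\<forall>\<^sub>F s in at t within ?I. h c s \<in> B" by eventually_elim auto
    qed
    moreover have "\<forall>\<^sub>F s in at t within ?I. h (ch s) s = h c s"
      using ev by eventually_elim (use indep ch cA in \<open>auto simp: S_def charts_at_def\<close>)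
    ultimately show "((\<lambda>s. h (ch s) s) \<longlongrightarrow> h (ch t) t) (at t within ?I)"
      unfolding c_def[symmetric] using tendsto_cong by fast
  qed
  then have "(\<lambda>t. h (ch t) t) integrable_on ?I" by (rule integrable_continuous_real)
  then show ?thesis
  proof (rule integrable_spike_finite[of "{a, b}", rotated 2])
    fix t assume t: "t \<in> ?I - {a, b}"
    then have tI: "t \<in> ?I" "t \<in> {a<..<b}" by auto
    note cA = charts_atD[OF ch[of t]]
    obtain y where y: "(chart_map (ch t) \<circ> \<gamma> has_vector_derivative y) (at t)"
      "speed \<gamma> t = sqrt (gmat (ch t) (chart_map (ch t) (\<gamma> t)) y y)"
      using C1_curve_regular_at[OF \<gamma> tI(2)] ch[of t] unfolding regular_at_def by blast
    have "y = X (ch t) t"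
      by (rule has_vector_derivative_unique_Icc[OF tI(1) ab has_vector_derivative_at_within[OF y(1)] X(2)[OF cA(1) tI(1) cA(2)]])
    then show "speed \<gamma> t = h (ch t) t" using y(2) by (simp add: h_def)
  qed simp
qed

lemma piecewise_C1_curve_props:
  assumes "piecewise_C1_curve A \<gamma> a b"
  shows "a < b \<and> continuous_on {a..b} \<gamma> \<and> speed \<gamma> integrable_on {a..b} \<and>
     (\<exists>F. finite F \<and> (\<forall>t\<in>{a..b} - F. regular_at \<gamma> t))"
  using assms
proof (induction rule: piecewise_C1_curve.induct)
  case (piece a b)
  have "\<exists>F. finite F \<and> (\<forall>t\<in>{a..b} - F. regular_at \<gamma> t)"
    by (intro exI[of _ "{a, b}"]) (auto intro!: C1_curve_regular_at[OF piece(2)])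
  then show ?case using piece C1_curve_speed_integrable[OF piece(2,1)] by (auto simp: C1_curve_on_def)
next
  case (join a b c)
  then have ab: "a < b" "b < c" by auto
  have un: "{a..c} = {a..b} \<union> {b..c}" using ab by (simp add: ivl_disj_un_two_touch(4))
  obtain F1 F2 where F: "finite F1" "\<forall>t\<in>{a..b} - F1. regular_at \<gamma> t" "finite F2" "\<forall>t\<in>{b..c} - F2. regular_at \<gamma> t"
    using join by blast
  have "\<exists>F. finite F \<and> (\<forall>t\<in>{a..c} - F. regular_at \<gamma> t)"
    using F unfolding un by (intro exI[of _ "F1 \<union> F2"]) auto
  moreover have "continuous_on {a..c} \<gamma>"
    unfolding un using join by (intro continuous_on_closed_Un) auto
  moreover have "speed \<gamma> integrable_on {a..c}"
    using join ab by (intro Henstock_Kurzweil_Integration.integrable_combine[of a b c]) auto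
  ultimately show ?case using ab by auto
qed

lemma regular_at_speed_nonneg: "regular_at \<gamma> t \<Longrightarrow> 0 \<le> speed \<gamma> t"
proof -
  assume r: "regular_at \<gamma> t"
  obtain c where c: "c \<in> charts_at A (\<gamma> t)" using ex_chart_at by blast
  then obtain y where y: "speed \<gamma> t = sqrt (gmat c (chart_map c (\<gamma> t)) y y)"
    using r unfolding regular_at_def by blast
  have "0 \<le> gmat c (chart_map c (\<gamma> t)) y y"
    using metric_form_pos[OF c, of y] by (cases "y = 0") (auto simp: metric_rep_apply[OF c, symmetric] blinfun.bilinear_simps)
  then show ?thesis using y by simp
qed

end

section \<open>Curves in normal coordinates\<close>

context normal_coordinates
begin

definition nc :: "'m \<Rightarrow> 'h" where
  "nc q = exp_inv A g p U q c"

lemma exp_inv_ex: "tvec_of A p c a \<in> U \<Longrightarrow> exp_inv A g p U (ex a) = tvec_of A p c a"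
  using U by (simp add: exp_inv_def ex_def exp_diffeo_nbhd_def)

lemma nc_ex: "a \<in> W \<Longrightarrow> nc (ex a) = a"
  by (simp add: nc_def exp_inv_ex W_def tvec_of_self[OF c])

definition Q :: "'m set" where
  "Q = chart_dom c \<inter> exp_map A g p ` U"

lemma ex_W: "ex ` W = Q"
proof (intro equalityI subsetI)
  fix q assume "q \<in> Q"
  then obtain v where v: "v \<in> U" "q = exp_map A g p v" "q \<in> chart_dom c" by (auto simp: Q_def)
  then have t: "tvec_of A p c (v c) = v" using tvec_of_coord[OF c U_tangent] by simp
  then have "ex (v c) = q" using v by (simp add: ex_def)
  moreover have "v c \<in> W" using t v \<open>ex (v c) = q\<close> by (simp add: W_def)
  ultimately show "q \<in> ex ` W" by blast
qed (auto simp: Q_def W_def ex_def)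

lemma nc_W: "q \<in> Q \<Longrightarrow> nc q \<in> W" and ex_nc: "q \<in> Q \<Longrightarrow> ex (nc q) = q"
  using nc_ex by (auto simp: ex_W[symmetric])

lemma open_Q: "open Q"
  unfolding Q_def using U chart_dom_open[OF cA(1)] by (auto simp: exp_diffeo_nbhd_def)

lemma smooth_nc_chart: "smooth_on (chart_map c ` Q) (\<lambda>y. nc (chart_inv c y))"
proof -
  have "smooth_on (chart_map c ` (chart_dom c \<inter> exp_map A g p ` U)) (\<lambda>y. exp_inv A g p U (chart_inv c y) c)"
    using U c cA(1) unfolding exp_diffeo_nbhd_def
    by (elim conjE) (drule bspec, assumption, drule bspec, assumption, erule conjunct2)
  then show ?thesis unfolding Q_def nc_def .
qed

lemma continuous_nc: "continuous_on Q nc"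
proof -
  have "continuous_on Q (\<lambda>q. nc (chart_inv c (chart_map c q)))"
    by (rule continuous_on_compose2[OF smooth_on_continuous_on[OF smooth_nc_chart]])
      (use chart_map_continuous[OF cA(1)] in \<open>auto simp: Q_def intro: continuous_on_subset\<close>)
  then show ?thesis
    by (rule continuous_on_eq) (simp add: Q_def chart_inv_map[OF cA(1)])
qed

lemma continuous_ex: "continuous_on W ex"
proof -
  have "continuous_on W (\<lambda>a. chart_inv c (E a))"
    by (rule continuous_on_compose2[OF chart_inv_continuous[OF cA(1)] smooth_on_continuous_on[OF smooth_E]])
      (auto simp: W_def E_def chart_map_range[OF cA(1)])
  then show ?thesis
    by (rule continuous_on_eq) (simp add: W_def E_def chart_inv_map[OF cA(1)])
qed

lemma open_ex_image:
  assumes "open B" "B \<subseteq> W"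
  shows "open (ex ` B)"
proof -
  have "ex ` B = Q \<inter> nc -` B"
  proof (intro equalityI subsetI)
    fix q assume "q \<in> ex ` B"
    then obtain a where a: "a \<in> B" "q = ex a" by blast
    then have "a \<in> W" using assms(2) by blast
    then show "q \<in> Q \<inter> nc -` B" using a nc_ex[of a] by (simp add: ex_W[symmetric])
  next
    fix q assume "q \<in> Q \<inter> nc -` B"
    then show "q \<in> ex ` B" using ex_nc[of q] by (intro image_eqI[of _ _ "nc q"]) auto
  qed
  then show ?thesis using continuous_open_preimage[OF continuous_nc open_Q assms(1)] by simp
qed

lemma continuous_N: "continuous_on S N"
proof -
  have "continuous_on S (\<lambda>a. gmat c (chart_map c p) a a)"
    by (intro bounded_bilinear.continuous_on[OF bounded_bilinear_blinfun_apply] continuous_intros)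
  then show ?thesis unfolding N_eq[abs_def] by (rule continuous_on_real_sqrt)
qed

lemma open_N_ball: "open {a. N a < R}"
proof -
  have "{a. N a < R} = N -` {..<R}" by auto
  then show ?thesis using continuous_N[of UNIV] by (simp add: continuous_on_open_vimage[OF open_UNIV])
qed

text \<open>The derivative \<open>x'\<close> comes from smoothness of the inverse exponential. Since
  \<open>E\<close> after \<open>nc\<close> is the chart map, the chain rule shows that
  \<open>dE\<close> sends \<open>x'\<close> to the derivative of the curve in \<open>c\<close>; this
  makes the speed a value of the pulled-back metric.\<close>

lemma nc_curve_derivative:
  assumes reg: "regular_at \<gamma> t" and q: "\<gamma> t \<in> Q"
  obtains x' where "((\<lambda>s. nc (\<gamma> s)) has_vector_derivative x') (at t)"
    "speed \<gamma> t = sqrt (gmat c (E (nc (\<gamma> t))) (dE (nc (\<gamma> t)) x') (dE (nc (\<gamma> t)) x'))"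
proof -
  have ct: "c \<in> charts_at A (\<gamma> t)" using q cA by (simp add: Q_def charts_at_def)
  have cont: "isCont \<gamma> t" using reg by (simp add: regular_at_def)
  obtain y where y: "(chart_map c \<circ> \<gamma> has_vector_derivative y) (at t)"
    "speed \<gamma> t = sqrt (gmat c (chart_map c (\<gamma> t)) y y)"
    using reg ct unfolding regular_at_def by blast
  define \<Phi> where "\<Phi> = (\<lambda>y. nc (chart_inv c y))"
  define d\<Phi> where "d\<Phi> = frechet_derivative \<Phi> (at (chart_map c (\<gamma> t)))"
  have \<Phi>: "(\<Phi> has_derivative d\<Phi>) (at (chart_map c (\<gamma> t)))"
    using smooth_on_differentiable[OF smooth_nc_chart, of "chart_map c (\<gamma> t)"] q
    by (simp add: \<Phi>_def d\<Phi>_def frechet_derivative_works)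
  have ev: "\<forall>\<^sub>F s in at t. \<gamma> s \<in> Q"
    using topological_tendstoD[OF _ open_Q q] cont by (simp add: isCont_def)
  have "((\<lambda>s. \<Phi> ((chart_map c \<circ> \<gamma>) s)) has_derivative (\<lambda>u. d\<Phi> (u *\<^sub>R y))) (at t)"
    by (rule has_derivative_compose[OF y(1)[unfolded has_vector_derivative_def]]) (use \<Phi> in simp)
  then have "((\<lambda>s. nc (\<gamma> s)) has_derivative (\<lambda>u. d\<Phi> (u *\<^sub>R y))) (at t)"
  proof (rule has_derivative_transform_eventually)
    show "\<forall>\<^sub>F s in at t. \<Phi> ((chart_map c \<circ> \<gamma>) s) = nc (\<gamma> s)"
      using ev by eventually_elim (simp add: \<Phi>_def Q_def chart_inv_map[OF cA(1)])
  qed (use q in \<open>auto simp: \<Phi>_def Q_def chart_inv_map[OF cA(1)]\<close>)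
  then have x': "((\<lambda>s. nc (\<gamma> s)) has_vector_derivative d\<Phi> y) (at t)"
    using linear_scale[OF has_derivative_linear[OF \<Phi>]] by (simp add: has_vector_derivative_def)
  have dEt: "(E has_derivative dE (nc (\<gamma> t))) (at (nc (\<gamma> t)))"
    by (rule E_has_derivative[OF nc_W[OF q]])
  have "((\<lambda>s. E (nc (\<gamma> s))) has_derivative (\<lambda>u. dE (nc (\<gamma> t)) (u *\<^sub>R d\<Phi> y))) (at t)"
    by (rule has_derivative_compose[OF x'[unfolded has_vector_derivative_def]]) (use dEt in simp)
  then have "((chart_map c \<circ> \<gamma>) has_derivative (\<lambda>u. dE (nc (\<gamma> t)) (u *\<^sub>R d\<Phi> y))) (at t)"
  proof (rule has_derivative_transform_eventually)
    show "\<forall>\<^sub>F s in at t. E (nc (\<gamma> s)) = (chart_map c \<circ> \<gamma>) s"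
      using ev by eventually_elim (simp add: E_def ex_nc)
  qed (use q in \<open>auto simp: E_def ex_nc\<close>)
  then have "((chart_map c \<circ> \<gamma>) has_vector_derivative dE (nc (\<gamma> t)) (d\<Phi> y)) (at t)"
    using linear_scale[OF has_derivative_linear[OF dEt]] by (simp add: has_vector_derivative_def)
  then have "dE (nc (\<gamma> t)) (d\<Phi> y) = y" using y(1) by (rule vector_derivative_unique_at)
  moreover have "E (nc (\<gamma> t)) = chart_map c (\<gamma> t)" using q by (simp add: E_def ex_nc)
  ultimately show ?thesis using that[OF x'] y(2) by simp
qed

section \<open>Length against displacement in normal coordinates\<close>

text \<open>Pairing the coordinates with the total displacement \<open>w\<close> gives a real
  function whose increment is the square of \<open>N w\<close>. Cauchy-Schwarz bounds its derivative
  by \<open>K * N w\<close> times the speed, and one factor \<open>N w\<close> is then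
  cancelled.\<close>

lemma curve_displacement:
  assumes \<gamma>: "piecewise_C1_curve A \<gamma> 0 1" and K: "K \<ge> 0" and R: "\<And>a. N a < R \<Longrightarrow> a \<in> W"
    and low: "\<And>a b. N a < R \<Longrightarrow> N b \<le> K * sqrt (gmat c (E a) (dE a b) (dE a b))"
    and rs: "0 \<le> r" "r \<le> s" "s \<le> 1"
    and inB: "\<And>t. t \<in> {r..s} \<Longrightarrow> \<gamma> t \<in> ex ` {a. N a < R}"
  shows "N (nc (\<gamma> s) - nc (\<gamma> r)) \<le> K * integral {r..s} (speed \<gamma>)"
proof -
  obtain F where F: "finite F" "\<And>t. t \<in> {0..1} - F \<Longrightarrow> regular_at \<gamma> t"
    and cont: "continuous_on {0..1} \<gamma>" and int: "speed \<gamma> integrable_on {0..1}"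
    using piecewise_C1_curve_props[OF \<gamma>] by blast
  have sub: "{r..s} \<subseteq> {0..1}" using rs by auto
  have int': "speed \<gamma> integrable_on {r..s}" by (rule integrable_on_subinterval[OF int sub])
  have inQ: "\<gamma> t \<in> Q" "N (nc (\<gamma> t)) < R" if "t \<in> {r..s}" for t
    using inB[OF that] R nc_ex ex_W by auto
  define w where "w = nc (\<gamma> s) - nc (\<gamma> r)"
  define f where "f t = gmat c (chart_map c p) (nc (\<gamma> t)) w" for t
  \<comment> \<open>At the finitely many exceptional times this value is arbitrary, which the
    fundamental theorem with exceptional set \<open>F\<close> allows.\<close>
  define f' where "f' t = vector_derivative f (at t)" for t
  have f': "(f has_vector_derivative f' t) (at t) \<and> f' t \<le> K * N w * speed \<gamma> t" if t: "t \<in> {r..s} - F" for t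
  proof -
    have tI: "t \<in> {r..s}" "regular_at \<gamma> t" using t sub F(2) by auto
    obtain x' where x': "((\<lambda>s. nc (\<gamma> s)) has_vector_derivative x') (at t)"
      "speed \<gamma> t = sqrt (gmat c (E (nc (\<gamma> t))) (dE (nc (\<gamma> t)) x') (dE (nc (\<gamma> t)) x'))"
      by (rule nc_curve_derivative[OF tI(2) inQ(1)[OF tI(1)]]) (rule that)
    have bl: "bounded_linear (\<lambda>a. gmat c (chart_map c p) a w)"
      by (intro bounded_linear_compose[OF blinfun.bounded_linear_left] blinfun.bounded_linear_right)
    have d: "(f has_vector_derivative gmat c (chart_map c p) x' w) (at t)"
      unfolding f_def by (rule bounded_linear.has_vector_derivative[OF bl x'(1)])
    then have "f' t = gmat c (chart_map c p) x' w" unfolding f'_def by (rule vector_derivative_at)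
    moreover have "gmat c (chart_map c p) x' w \<le> N x' * N w"
      using gmat_cauchy_schwarz[of x' w] by linarith
    moreover have "N x' * N w \<le> (K * speed \<gamma> t) * N w"
      using low[OF inQ(2)[OF tI(1)], of x'] x'(2) by (intro mult_right_mono N_nonneg) simp
    ultimately show ?thesis using d by (simp add: ac_simps)
  qed
  have contf: "continuous_on {r..s} f"
  proof -
    have "continuous_on {r..s} (\<lambda>t. nc (\<gamma> t))"
      by (rule continuous_on_compose2[OF continuous_nc continuous_on_subset[OF cont sub]]) (use inQ in auto)
    then show ?thesis unfolding f_def[abs_def]
      by (intro bounded_bilinear.continuous_on[OF bounded_bilinear_blinfun_apply] continuous_intros)
  qed
  have hi: "(f' has_integral (f s - f r)) {r..s}"
    by (rule fundamental_theorem_of_calculus_interior_strong[OF F(1) rs(2) _ contf]) (use f' in auto)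
  have "(N w)\<^sup>2 = f s - f r" by (simp add: N_square f_def w_def blinfun.bilinear_simps)
  also have "\<dots> = integral {r..s} f'" using hi by (simp add: integral_unique)
  also have "\<dots> \<le> integral {r..s} (\<lambda>t. K * N w * speed \<gamma> t)"
    by (rule integral_le_finite_except[OF _ _ F(1)]) (use hi int' f' in \<open>auto intro: integrable_on_mult_right\<close>)
  also have "\<dots> = (K * integral {r..s} (speed \<gamma>)) * N w" by simp
  finally have le: "N w * N w \<le> (K * integral {r..s} (speed \<gamma>)) * N w" by (simp add: power2_eq_square)
  have "0 \<le> integral {r..s} (speed \<gamma>)"
  proof -
    have "integral {r..s} (\<lambda>_. 0 :: real) \<le> integral {r..s} (speed \<gamma>)"
      by (rule integral_le_finite_except[OF _ int' F(1)])
        (use sub F(2) regular_at_speed_nonneg in auto)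
    then show ?thesis by simp
  qed
  then show ?thesis
    using le K N_nonneg[of w] unfolding w_def[symmetric]
    by (cases "N w = 0") (auto simp: mult_le_cancel_right)
qed

text \<open>A curve that is too short to leave a small ball stays in it.  As the closed ball need not be
  closed in the manifold, the exit point is reached as a limit in the complete model space.\<close>

lemma short_curve_stays:
  assumes \<gamma>: "piecewise_C1_curve A \<gamma> 0 1" and K: "K \<ge> 0" and R: "\<And>a. N a < R \<Longrightarrow> a \<in> W"
    and low: "\<And>a b. N a < R \<Longrightarrow> N b \<le> K * sqrt (gmat c (E a) (dE a b) (dE a b))"
    and x0: "\<gamma> 0 = ex x0" and short: "N x0 + K * curve_length A g \<gamma> < R"
  obtains x1 where "N x1 < R" "\<gamma> 1 = ex x1" "N (x1 - x0) \<le> K * curve_length A g \<gamma>"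
proof -
  obtain F where F: "finite F" "\<And>t. t \<in> {0..1} - F \<Longrightarrow> regular_at \<gamma> t"
    and cont: "continuous_on {0..1} \<gamma>" and int: "speed \<gamma> integrable_on {0..1}"
    using piecewise_C1_curve_props[OF \<gamma>] by blast
  have int': "speed \<gamma> integrable_on {r..s}" if "0 \<le> r" "s \<le> 1" for r s
    by (rule integrable_on_subinterval[OF int]) (use that in auto)
  have nonneg: "0 \<le> integral {r..s} (speed \<gamma>)" if "0 \<le> r" "s \<le> 1" for r s
  proof -
    have "integral {r..s} (\<lambda>_. 0 :: real) \<le> integral {r..s} (speed \<gamma>)"
      by (rule integral_le_finite_except[OF _ int'[OF that] F(1)])
        (use that F(2) regular_at_speed_nonneg in auto)
    then show ?thesis by simp
  qed
  have L: "curve_length A g \<gamma> = integral {0..1} (speed \<gamma>)"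
    by (simp add: curve_length_def speed_def[abs_def])
  define B where "B = {a. N a < R}"
  have BW: "B \<subseteq> W" using R by (auto simp: B_def)
  have BQ: "ex ` B \<subseteq> Q" using BW ex_W by blast
  have oB: "open (ex ` B)" by (rule open_ex_image[OF _ BW]) (simp add: B_def open_N_ball)
  \<comment> \<open>Arc length up to time \<open>t\<close>. Its continuity is what makes the
    coordinates converge at the possible exit time.\<close>
  define P where "P t = integral {0..t} (speed \<gamma>)" for t
  have P_diff: "P s - P r = integral {r..s} (speed \<gamma>)" if "0 \<le> r" "r \<le> s" "s \<le> 1" for r s
    using Henstock_Kurzweil_Integration.integral_combine[OF that(1,2) int'[of 0 s]] that by (simp add: P_def)
  have P_le: "P s \<le> curve_length A g \<gamma>" if "0 \<le> s" "s \<le> 1" for s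
    using P_diff[of s 1] nonneg[of s 1] that by (simp add: L P_def)
  have disp: "N (nc (\<gamma> s) - nc (\<gamma> r)) \<le> K * (P s - P r)"
    if "0 \<le> r" "r \<le> s" "s \<le> 1" "\<And>t. t \<in> {r..s} \<Longrightarrow> \<gamma> t \<in> ex ` B" for r s
    using curve_displacement[OF \<gamma> K R low that(1-3)] that(4) P_diff[OF that(1-3)] by (simp add: B_def)
  have x0B: "x0 \<in> B"
  proof -
    have "0 \<le> K * curve_length A g \<gamma>" using K nonneg[of 0 1] by (simp add: L)
    then show ?thesis using short by (simp add: B_def)
  qed
  have nc0: "nc (\<gamma> 0) = x0" using x0 nc_ex x0B BW by auto
  have lim: "\<gamma> t \<in> ex ` B" if t: "t \<in> {0..1}" and before: "\<And>s. 0 \<le> s \<Longrightarrow> s < t \<Longrightarrow> \<gamma> s \<in> ex ` B" for t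
  proof (cases "t = 0")
    case True
    then show ?thesis using x0 x0B by auto
  next
    case False
    then have t0: "t > 0" "t \<le> 1" using t by auto
    \<comment> \<open>Whether \<open>\<gamma> t\<close> has normal coordinates is not yet known, so
      the coordinates are followed along times that increase to \<open>t\<close>.\<close>
    define s where "s n = t * (1 - 1 / real (Suc n))" for n
    have s: "0 \<le> s n" "s n < t" "s n \<le> 1" for n
    proof -
      have "1 - 1 / real (Suc n) \<ge> 0" "1 - 1 / real (Suc n) < 1" by (auto simp: field_simps)
      then show "0 \<le> s n" "s n < t" using t0 by (simp_all only: s_def) (auto simp: mult_less_cancel_left2)
      then show "s n \<le> 1" using t0 by simp
    qed
    have slim: "s \<longlonglongrightarrow> t"
    proof -
      have "(\<lambda>n. t * (1 - 1 / real (Suc n))) \<longlonglongrightarrow> t * (1 - 0)"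
        by (intro tendsto_intros LIMSEQ_Suc[OF lim_inverse_n'])
      then show ?thesis by (simp add: s_def[abs_def])
    qed
    define x where "x n = nc (\<gamma> (s n))" for n
    have ex_x: "ex (x n) = \<gamma> (s n)" for n
      unfolding x_def by (rule ex_nc[OF subsetD[OF BQ before[OF s(1,2)]]])
    obtain k where k: "k > 0" "\<And>a. k * norm a \<le> N a" by (rule N_equiv) (rule that)
    have dist: "norm (x m - x n) \<le> (K / k) * \<bar>P (s m) - P (s n)\<bar>" for m n
    proof -
      have main: "N (x m - x n) \<le> K * (P (s m) - P (s n))" if "s n \<le> s m" for m n
        unfolding x_def using s[of n] s[of m] that by (intro disp before) auto
      have "N (x m - x n) \<le> K * \<bar>P (s m) - P (s n)\<bar>"
      proof (cases "s n \<le> s m")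
        case True
        then show ?thesis using main[of n m] mult_left_mono[OF abs_ge_self K] by (meson order_trans)
      next
        case False
        then have "N (x m - x n) \<le> K * (P (s n) - P (s m))" using main[of m n] by (simp add: N_minus_commute)
        also have "\<dots> \<le> K * \<bar>P (s m) - P (s n)\<bar>" using K by (intro mult_left_mono) auto
        finally show ?thesis .
      qed
      then have "k * norm (x m - x n) \<le> K * \<bar>P (s m) - P (s n)\<bar>" using k(2) order_trans by blast
      then show ?thesis using k(1) by (simp add: field_simps)
    qed
    have "continuous_on {0..1} P"
      unfolding P_def[abs_def] by (rule indefinite_integral_continuous_1[OF int])
    then have "(\<lambda>n. P (s n)) \<longlonglongrightarrow> P t"
      by (rule continuous_on_tendsto_compose[OF _ slim t]) (use s in auto)
    then have CP: "Cauchy (\<lambda>n. P (s n))" by (rule LIMSEQ_imp_Cauchy)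
    have "Cauchy x"
    proof (rule CauchyI)
      fix e :: real assume e: "e > 0"
      define q where "q = K / k + 1"
      have q: "q > 0" "K / k \<le> q" using K k by (auto simp: q_def intro: add_nonneg_pos)
      obtain M where M: "\<And>m n. m \<ge> M \<Longrightarrow> n \<ge> M \<Longrightarrow> norm (P (s m) - P (s n)) < e / q"
        using CauchyD[OF CP, of "e / q"] e q by auto
      have "norm (x m - x n) < e" if "m \<ge> M" "n \<ge> M" for m n
      proof -
        have "norm (x m - x n) \<le> (K / k) * \<bar>P (s m) - P (s n)\<bar>" by (rule dist)
        also have "\<dots> \<le> q * \<bar>P (s m) - P (s n)\<bar>" using q by (intro mult_right_mono) auto
        also have "\<dots> < q * (e / q)" using M[OF that] q by (intro mult_strict_left_mono) auto
        finally show ?thesis using q by simp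
      qed
      then show "\<exists>M. \<forall>m\<ge>M. \<forall>n\<ge>M. norm (x m - x n) < e" by blast
    qed
    then obtain xs where xs: "x \<longlonglongrightarrow> xs" using Cauchy_convergent convergent_def by blast
    \<comment> \<open>The right-hand side does not depend on \<open>n\<close> and is less than
      \<open>R\<close> by \<open>short\<close>, so the limit of the coordinates still lies in the
      open ball \<open>B\<close>.\<close>
    have "N (x n) \<le> N x0 + K * curve_length A g \<gamma>" for n
    proof -
      have "N (x n - x0) \<le> K * (P (s n) - P 0)"
        using disp[of 0 "s n"] s[of n] before nc0 by (auto simp: x_def)
      also have "\<dots> \<le> K * curve_length A g \<gamma>"
        using P_le[of "s n"] s[of n] K by (intro mult_left_mono) (auto simp: P_def)
      finally show ?thesis using N_triangle[of x0 "x n - x0"] by simp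
    qed
    moreover have "(\<lambda>n. N (x n)) \<longlonglongrightarrow> N xs"
      by (rule continuous_on_tendsto_compose[OF continuous_N[of UNIV] xs]) auto
    ultimately have "N xs \<le> N x0 + K * curve_length A g \<gamma>"
      using LIMSEQ_le_const2 by blast
    then have xsB: "xs \<in> B" using short by (simp add: B_def)
    have xW: "x n \<in> W" for n unfolding x_def by (rule nc_W[OF subsetD[OF BQ before[OF s(1,2)]]])
    have "(\<lambda>n. ex (x n)) \<longlonglongrightarrow> ex xs"
      by (rule continuous_on_tendsto_compose[OF continuous_ex xs]) (use xsB BW xW in auto)
    moreover have "(\<lambda>n. \<gamma> (s n)) \<longlonglongrightarrow> \<gamma> t"
      by (rule continuous_on_tendsto_compose[OF cont slim t]) (use s in auto)
    ultimately have "\<gamma> t = ex xs" unfolding ex_x using LIMSEQ_unique by blast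
    then show ?thesis using xsB by blast
  qed
  have ext: "\<exists>d>0. \<forall>s. t < s \<and> s < t + d \<and> s \<le> 1 \<longrightarrow> \<gamma> s \<in> ex ` B"
    if t: "0 \<le> t" "t < 1" and before: "\<And>s. 0 \<le> s \<Longrightarrow> s \<le> t \<Longrightarrow> \<gamma> s \<in> ex ` B" for t
  proof -
    have "(\<gamma> \<longlongrightarrow> \<gamma> t) (at t within {0..1})" using cont t by (auto simp: continuous_on_def)
    then have "\<forall>\<^sub>F s in at t within {0..1}. \<gamma> s \<in> ex ` B"
      using oB before[OF t(1)] by (intro topological_tendstoD) auto
    then obtain d where d: "d > 0" "\<And>s. s \<in> {0..1} \<Longrightarrow> s \<noteq> t \<Longrightarrow> dist s t < d \<Longrightarrow> \<gamma> s \<in> ex ` B"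
      unfolding eventually_at by blast
    then show ?thesis using t by (intro exI[of _ d]) (auto simp: dist_real_def)
  qed
  have all: "\<gamma> t \<in> ex ` B" if "t \<in> {0..1}" for t
    by (rule real_interval_induct[of 0 1 "\<lambda>t. \<gamma> t \<in> ex ` B", OF lim ext that])
  show ?thesis
  proof (rule that[of "nc (\<gamma> 1)"])
    have "\<gamma> 1 \<in> ex ` B" using all by simp
    then show "N (nc (\<gamma> 1)) < R" "\<gamma> 1 = ex (nc (\<gamma> 1))"
      using nc_ex BW by (auto simp: B_def)
    have "N (nc (\<gamma> 1) - nc (\<gamma> 0)) \<le> K * (P 1 - P 0)" by (rule disp) (use all in auto)
    then show "N (nc (\<gamma> 1) - x0) \<le> K * curve_length A g \<gamma>" by (simp add: nc0 P_def L)
  qed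
qed

text \<open>The image under \<open>ex\<close> of the straight segment is a competitor in the
  infimum. Its parameter interval has length 1, so a bound on the speed is a bound on the
  length.\<close>

lemma segment_curve:
  assumes seg: "\<And>t. t \<in> {0..1} \<Longrightarrow> x + t *\<^sub>R w \<in> W" and K: "\<And>t. t \<in> {0..1} \<Longrightarrow>
      sqrt (gmat c (E (x + t *\<^sub>R w)) (dE (x + t *\<^sub>R w) w) (dE (x + t *\<^sub>R w) w)) \<le> K"
  shows "rdist A g (ex x) (ex (x + w)) \<le> ereal K"
proof -
  let ?I = "{0..1::real}"
  define l where "l t = x + t *\<^sub>R w" for t
  define \<gamma> where "\<gamma> t = ex (l t)" for t
  have lW: "l t \<in> W" if "t \<in> ?I" for t using seg[OF that] by (simp add: l_def)
  have lc: "continuous_on S l" for S unfolding l_def[abs_def] by (intro continuous_intros)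
  have ld: "(l has_derivative (\<lambda>u. u *\<^sub>R w)) (at t within S)" for t S
    unfolding l_def[abs_def] by (auto intro!: derivative_eq_intros)
  have "C1_curve_on A ?I \<gamma>"
    unfolding C1_curve_on_def
  proof (intro conjI ballI)
    show "continuous_on ?I \<gamma>"
      unfolding \<gamma>_def[abs_def] by (rule continuous_on_compose2[OF continuous_ex lc]) (use lW in auto)
    fix c' assume c': "c' \<in> A"
    \<comment> \<open>\<open>C1_curve_on\<close> must be checked in every chart of the atlas, so
      here the exponential map is read in the chart \<open>c'\<close> on the target side.\<close>
    define W' where "W' = {a. tvec_of A p c a \<in> U \<and> ex a \<in> chart_dom c'}"
    obtain D where D: "derivs_on W' D" "\<And>a. a \<in> W' \<Longrightarrow> D a [] = chart_map c' (ex a)"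
      by (rule smooth_on_derivs[OF smooth_exp_chart[OF c'], folded W'_def]) (rule that)
    let ?S = "{t\<in>?I. \<gamma> t \<in> chart_dom c'}"
    have lW': "l t \<in> W'" if "t \<in> ?S" for t using lW[of t] that by (auto simp: W'_def \<gamma>_def W_def)
    show "\<exists>x'. continuous_on ?S x' \<and> (\<forall>t\<in>?S. (chart_map c' \<circ> \<gamma> has_vector_derivative x' t) (at t within ?I))"
    proof (intro exI[of _ "\<lambda>t. D (l t) [w]"] conjI ballI)
      have "continuous_on W' (\<lambda>a. D a [w])"
        using derivs_on_has_derivative[OF D(1)] has_derivative_continuous
        by (intro continuous_at_imp_continuous_on ballI) blast
      then show "continuous_on ?S (\<lambda>t. D (l t) [w])"
        by (rule continuous_on_compose2[OF _ lc]) (use lW' in auto)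
      fix t assume t: "t \<in> ?S"
      have d: "((\<lambda>a. chart_map c' (ex a)) has_derivative (\<lambda>h. D (l t) [h])) (at (l t))"
        by (rule smooth_on_has_derivative[OF D lW'[OF t]])
      have "((\<lambda>t. chart_map c' (ex (l t))) has_derivative (\<lambda>u. D (l t) [u *\<^sub>R w])) (at t within ?I)"
        by (rule has_derivative_compose[where f=l and f'="\<lambda>u. u *\<^sub>R w" and g="\<lambda>a. chart_map c' (ex a)"])
          (rule ld, rule d)
      then show "(chart_map c' \<circ> \<gamma> has_vector_derivative D (l t) [w]) (at t within ?I)"
        using linear_scale[OF has_derivative_linear[OF d]]
        by (simp add: has_vector_derivative_def \<gamma>_def o_def)
    qed
  qed
  then have C1: "C1_curve_on A ?I \<gamma>" .
  have pw: "piecewise_C1_curve A \<gamma> 0 1" by (rule piecewise_C1_curve.piece[OF zero_less_one C1])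
  have "speed \<gamma> t \<le> K" if t: "t \<in> ?I - {0, 1}" for t
  proof -
    have tI: "t \<in> {0<..<1}" "t \<in> ?I" using t by auto
    have ct: "c \<in> charts_at A (\<gamma> t)" using lW[OF tI(2)] cA by (simp add: W_def \<gamma>_def charts_at_def)
    obtain y where y: "(chart_map c \<circ> \<gamma> has_vector_derivative y) (at t)"
      "speed \<gamma> t = sqrt (gmat c (chart_map c (\<gamma> t)) y y)"
      using C1_curve_regular_at[OF C1 tI(1)] ct unfolding regular_at_def by blast
    have d: "(E has_derivative dE (l t)) (at (l t))" by (rule E_has_derivative[OF lW[OF tI(2)]])
    have "((\<lambda>t. E (l t)) has_derivative (\<lambda>u. dE (l t) (u *\<^sub>R w))) (at t)"
      by (rule has_derivative_compose[where f=l and f'="\<lambda>u. u *\<^sub>R w" and g=E])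
        (rule ld, rule d)
    then have "(chart_map c \<circ> \<gamma> has_vector_derivative dE (l t) w) (at t)"
      using linear_scale[OF has_derivative_linear[OF d]]
      by (simp add: has_vector_derivative_def \<gamma>_def o_def E_def)
    then have "y = dE (l t) w" using y(1) vector_derivative_unique_at by blast
    then show ?thesis using y(2) K[OF tI(2)] by (simp add: \<gamma>_def E_def l_def)
  qed
  then have "integral ?I (speed \<gamma>) \<le> integral ?I (\<lambda>_. K)"
    by (intro integral_le_finite_except[of _ 0 1 _ "{0, 1}"] C1_curve_speed_integrable[OF C1]) auto
  then have len: "curve_length A g \<gamma> \<le> K" by (simp add: curve_length_def speed_def[abs_def])
  have "rdist A g (ex x) (ex (x + w)) \<le> ereal (curve_length A g \<gamma>)"
    unfolding rdist_def by (rule INF_lower) (use pw in \<open>simp add: \<gamma>_def l_def\<close>)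
  also have "\<dots> \<le> ereal K" using len by simp
  finally show ?thesis .
qed

end

section \<open>Comparison of distances\<close>

context normal_coordinates
begin

text \<open>The bounds are uniform over all pairs of points in the ball and the factor depends on
  \<open>r\<close> alone, which later makes the error term independent of \<open>u\<close>.\<close>

lemma rdist_normal_coordinates:
  assumes e: "e > 0"
  shows "\<forall>\<^sub>F r in at_right 0. rcball A g p r \<subseteq> Q \<and>
    (\<forall>u\<in>rcball A g p r. \<forall>q\<in>rcball A g p r.
       ereal (N (nc u - nc q) / (1 + e * r)) \<le> rdist A g u q \<and>
       rdist A g u q \<le> ereal ((1 + e * r) * N (nc u - nc q)))"
proof -
  \<comment> \<open>The metric is compared on a ball of radius \<open>10 * r\<close>, where the
    tolerance \<open>e / 10\<close> produces exactly the factor \<open>1 + e * r\<close>.\<close>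
  have e10: "e / 10 > 0" using e by simp
  obtain d where d: "d > 0" "\<And>a. N a < d \<Longrightarrow> a \<in> W"
    "\<And>r a b. r < d \<Longrightarrow> N a \<le> r \<Longrightarrow> N b \<le> (1 + e / 10 * r) * sqrt (gmat c (E a) (dE a b) (dE a b))"
    "\<And>r a b. r < d \<Longrightarrow> N a \<le> r \<Longrightarrow> sqrt (gmat c (E a) (dE a b) (dE a b)) \<le> (1 + e / 10 * r) * N b"
    by (rule normal_metric_estimate[OF e10]) (rule that)
  \<comment> \<open>\<open>d / 10\<close> puts the ball of radius \<open>10 * r\<close> inside the
    domain of the estimate, and \<open>1 / (4 * e)\<close> gives
    \<open>K \<le> 5 / 4\<close>.\<close>
  define r0 where "r0 = min (d / 10) (1 / (4 * e))"
  have r0: "r0 > 0" using d e by (simp add: r0_def)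
  have main: "rcball A g p r \<subseteq> Q \<and>
    (\<forall>u\<in>rcball A g p r. \<forall>q\<in>rcball A g p r.
       ereal (N (nc u - nc q) / (1 + e * r)) \<le> rdist A g u q \<and>
       rdist A g u q \<le> ereal ((1 + e * r) * N (nc u - nc q)))" if r: "0 < r" "r < r0" for r
  proof -
    define K where "K = 1 + e * r"
    have rd: "10 * r < d" using r by (simp add: r0_def)
    have "e * r < e * (1 / (4 * e))" using r e by (intro mult_strict_left_mono) (auto simp: r0_def)
    then have "K \<le> 5 / 4" using e by (simp add: K_def)
    moreover have "K \<ge> 1" using e r by (simp add: K_def)
    ultimately have K: "K \<ge> 0" "K > 0" "K \<le> 5 / 4" by auto
    have inW: "a \<in> W" if "N a < 10 * r" for a using d(2)[of a] that rd by simp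
    have low: "N b \<le> K * sqrt (gmat c (E a) (dE a b) (dE a b))" if "N a < 10 * r" for a b
      using d(3)[OF rd, of a b] that by (simp add: K_def)
    have up: "sqrt (gmat c (E a) (dE a b) (dE a b)) \<le> K * N b" if "N a < 10 * r" for a b
      using d(4)[OF rd, of a b] that by (simp add: K_def)
    have N0: "N 0 = 0" using N_scale[of 0 0] by simp
    have coord: "\<exists>x. N x < 2 * r \<and> u = ex x" if u: "u \<in> rcball A g p r" for u
    proof -
      have "rdist A g p u \<le> ereal r" using u by (simp add: rcball_def)
      \<comment> \<open>The infimum need not be attained, so curves slightly longer than
        \<open>r\<close> must be allowed. The value 3/2 works because 5/4 times 3/2 is less than
        2.\<close>
      also have "\<dots> < ereal (3 / 2 * r)" using r by simp
      finally obtain \<gamma> where \<gamma>: "piecewise_C1_curve A \<gamma> 0 1" "\<gamma> 0 = p" "\<gamma> 1 = u"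
        "curve_length A g \<gamma> < 3 / 2 * r"
        unfolding rdist_def INF_less_iff by auto
      have "K * curve_length A g \<gamma> < K * (3 / 2 * r)" using \<gamma>(4) K by (intro mult_strict_left_mono)
      also have "\<dots> \<le> 5 / 4 * (3 / 2 * r)" using K r by (intro mult_right_mono) auto
      also have "\<dots> < 2 * r" using r by simp
      finally have short: "N 0 + K * curve_length A g \<gamma> < 2 * r" by (simp add: N0)
      have start: "\<gamma> 0 = ex 0" using \<gamma>(2) ex_0 by simp
      have inW2: "a \<in> W" if "N a < 2 * r" for a using inW that r by simp
      have low2: "N b \<le> K * sqrt (gmat c (E a) (dE a b) (dE a b))" if "N a < 2 * r" for a b
        using low that r by simp
      obtain x1 where "N x1 < 2 * r" "\<gamma> 1 = ex x1" "N (x1 - 0) \<le> K * curve_length A g \<gamma>"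
        by (rule short_curve_stays[OF \<gamma>(1) K(1) inW2 low2 start short]) (assumption | rule that)+
      then show ?thesis using \<gamma>(3) by blast
    qed
    have pair: "ereal (N (x - y) / K) \<le> rdist A g (ex x) (ex y) \<and> rdist A g (ex x) (ex y) \<le> ereal (K * N (x - y))"
      if x: "N x < 2 * r" and y: "N y < 2 * r" for x y
    proof
      have yW: "y \<in> W" using inW y r by simp
      \<comment> \<open>A curve too long for \<open>short_curve_stays\<close> has \<open>K\<close>
        times its length at least \<open>10 * r - N x\<close>, which exceeds \<open>8 * r\<close>
        and hence this bound.\<close>
      have Nxy: "N (x - y) < 4 * r"
        using N_triangle[of x "- y"] N_scale[of "-1" y] x y by simp
      show "ereal (N (x - y) / K) \<le> rdist A g (ex x) (ex y)"
        unfolding rdist_def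
      proof (rule INF_greatest)
        fix \<gamma> assume "\<gamma> \<in> {\<gamma>. piecewise_C1_curve A \<gamma> 0 1 \<and> \<gamma> 0 = ex x \<and> \<gamma> 1 = ex y}"
        then have \<gamma>: "piecewise_C1_curve A \<gamma> 0 1" "\<gamma> 0 = ex x" "\<gamma> 1 = ex y" by auto
        have "N (x - y) \<le> K * curve_length A g \<gamma>"
        proof (cases "N x + K * curve_length A g \<gamma> < 10 * r")
          case True
          obtain x1 where x1: "N x1 < 10 * r" "\<gamma> 1 = ex x1" "N (x1 - x) \<le> K * curve_length A g \<gamma>"
            by (rule short_curve_stays[OF \<gamma>(1) K(1) inW low \<gamma>(2) True]) (assumption | rule that)+
          have "x1 = y" using nc_ex[OF inW[OF x1(1)]] nc_ex[OF yW] x1(2) \<gamma>(3) by simp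
          then show ?thesis using x1(3) by (simp add: N_minus_commute)
        next
          case False
          then show ?thesis using x Nxy r by simp
        qed
        then show "ereal (N (x - y) / K) \<le> ereal (curve_length A g \<gamma>)"
          using K by (simp add: field_simps)
      qed
      have seg: "N (x + t *\<^sub>R (y - x)) < 10 * r" if t: "t \<in> {0..1}" for t
      proof -
        have "x + t *\<^sub>R (y - x) = (1 - t) *\<^sub>R x + t *\<^sub>R y" by (simp add: algebra_simps)
        then have "N (x + t *\<^sub>R (y - x)) \<le> (1 - t) * N x + t * N y"
          using N_triangle[of "(1 - t) *\<^sub>R x" "t *\<^sub>R y"] t by (simp add: N_scale)
        also have "\<dots> \<le> (1 - t) * (2 * r) + t * (2 * r)"
          using x y t by (intro add_mono mult_left_mono) auto
        also have "\<dots> < 10 * r" using r by (simp add: algebra_simps)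
        finally show ?thesis .
      qed
      have "rdist A g (ex x) (ex (x + (y - x))) \<le> ereal (K * N (y - x))"
        by (rule segment_curve) (use inW seg up in auto)
      then show "rdist A g (ex x) (ex y) \<le> ereal (K * N (x - y))" by (simp add: N_minus_commute)
    qed
    show ?thesis
    proof (intro conjI ballI subsetI)
      show "u \<in> Q" if "u \<in> rcball A g p r" for u
        using coord[OF that] inW r ex_W by force
      fix u q assume "u \<in> rcball A g p r" "q \<in> rcball A g p r"
      then obtain x y where xy: "N x < 2 * r" "u = ex x" "N y < 2 * r" "q = ex y" using coord by blast
      then have "nc u = x" "nc q = y" using nc_ex inW r by auto
      then show "ereal (N (nc u - nc q) / (1 + e * r)) \<le> rdist A g u q"
        "rdist A g u q \<le> ereal ((1 + e * r) * N (nc u - nc q))"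
        using pair[OF xy(1,3)] xy by (auto simp: K_def)
    qed
  qed
  show ?thesis
    unfolding eventually_at_right_field using r0 main by (intro exI[of _ r0]) auto
qed

lemma tdist_exp_inv:
  assumes "u \<in> Q" "q \<in> Q"
  shows "tdist g p (exp_inv A g p U u) (exp_inv A g p U q) = ereal (N (nc u - nc q))"
proof -
  have "exp_inv A g p U v = tvec_of A p c (nc v)" if "v \<in> Q" for v
    using exp_inv_ex[of "nc v"] nc_W[OF that] ex_nc[OF that] by (simp add: W_def)
  then show ?thesis using assms by (simp add: tdist_def N_def tvec_of_diff[OF c])
qed

end

text \<open>Two-sided bounds with a constant factor pass through infima. Extended reals cover the
  empty set too, where both distances are infinite.\<close>

lemma set_dist_comparison:
  assumes K: "K > 0"
    and low: "\<And>a. a \<in> S \<Longrightarrow> ereal (t a / K) \<le> d u a" and up: "\<And>a. a \<in> S \<Longrightarrow> d u a \<le> ereal (K * t a)"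
    and t: "\<And>a. a \<in> S \<Longrightarrow> d' (f u) (f a) = ereal (t a)"
  shows "set_dist d' (f u) (f ` S) / ereal K \<le> set_dist d u S \<and>
    set_dist d u S \<le> ereal K * set_dist d' (f u) (f ` S)"
proof
  have eq: "set_dist d' (f u) (f ` S) = (INF a\<in>S. d' (f u) (f a))"
    by (simp add: set_dist_def image_image)
  show "set_dist d' (f u) (f ` S) / ereal K \<le> set_dist d u S"
    unfolding set_dist_def[of d]
  proof (rule INF_greatest)
    fix a assume a: "a \<in> S"
    have "set_dist d' (f u) (f ` S) \<le> ereal (t a)"
      unfolding eq using INF_lower[OF a, of "\<lambda>a. d' (f u) (f a)"] t[OF a] by simp
    then have "set_dist d' (f u) (f ` S) / ereal K \<le> ereal (t a) / ereal K"
      using K by (intro ereal_divide_right_mono) auto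
    also have "\<dots> = ereal (t a / K)" using K by simp
    also have "\<dots> \<le> d u a" by (rule low[OF a])
    finally show "set_dist d' (f u) (f ` S) / ereal K \<le> d u a" .
  qed
  \<comment> \<open>Dividing by \<open>K\<close> first leaves a bare infimum on the right, so that a
    bound for each point of \<open>S\<close> is enough.\<close>
  have "set_dist d u S / ereal K \<le> set_dist d' (f u) (f ` S)"
    unfolding eq
  proof (rule INF_greatest)
    fix a assume a: "a \<in> S"
    have "set_dist d u S \<le> ereal (K * t a)"
      unfolding set_dist_def using INF_lower[OF a, of "d u"] up[OF a] by simp
    then have "set_dist d u S / ereal K \<le> ereal (K * t a) / ereal K"
      using K by (intro ereal_divide_right_mono) auto
    also have "\<dots> = d' (f u) (f a)" using K t[OF a] by simp
    finally show "set_dist d u S / ereal K \<le> d' (f u) (f a)" .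
  qed
  then show "set_dist d u S \<le> ereal K * set_dist d' (f u) (f ` S)"
    using K by (simp add: ereal_divide_le_pos)
qed

theorem lemma4p1:
  fixes A :: "('m::t2_space, 'h::{real_inner, banach}) chart set"
    and g :: "('m, 'h) metric"
    and \<Omega> :: "'m set" and p :: 'm and U :: "('m, 'h) tvec set"
  assumes "riemannian_manifold A g"
    and "p \<in> closure \<Omega>"
    and "exp_diffeo_nbhd A g p U"
  shows "\<exists>\<rho> :: real \<Rightarrow> real. ((\<lambda>r. \<rho> r / r) \<longlongrightarrow> 0) (at_right 0) \<and>
    (\<forall>\<^sub>F r in at_right 0.
       rcball A g p r \<subseteq> exp_map A g p ` U \<and>
       (\<forall>u\<in>rcball A g p r.
          set_dist (tdist g p) (exp_inv A g p U u) (exp_inv A g p U ` (\<Omega> \<inter> rcball A g p r))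
              / ereal (1 + \<bar>\<rho> r\<bar>)
            \<le> set_dist (rdist A g) u (\<Omega> \<inter> rcball A g p r) \<and>
          set_dist (rdist A g) u (\<Omega> \<inter> rcball A g p r)
            \<le> ereal (1 + \<bar>\<rho> r\<bar>)
              * set_dist (tdist g p) (exp_inv A g p U u)
                  (exp_inv A g p U ` (\<Omega> \<inter> rcball A g p r))))"
proof -
  interpret riemannian_manifold A g by fact
  \<comment> \<open>Any chart at \<open>p\<close> will do: \<open>exp_inv\<close> and
    \<open>tdist\<close> are defined without reference to it.\<close>
  obtain c where "c \<in> charts_at A p" using ex_chart_at by blast
  then interpret normal_coordinates A g p U c by unfold_locales (use assms(3) in auto)
  \<comment> \<open>All pairs of points in the ball are quantified inside \<open>P\<close>, so the
    function extracted from it depends on \<open>r\<close> alone; the set \<open>\<Omega>\<close>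
    enters only afterwards.\<close>
  define P where "P r \<delta> \<longleftrightarrow> rcball A g p r \<subseteq> Q \<and>
    (\<forall>u\<in>rcball A g p r. \<forall>q\<in>rcball A g p r.
       ereal (N (nc u - nc q) / (1 + \<delta>)) \<le> rdist A g u q \<and>
       rdist A g u q \<le> ereal ((1 + \<delta>) * N (nc u - nc q)))" for r \<delta>
  have mono: "P r \<delta>'" if P: "P r \<delta>" and \<delta>: "0 < \<delta>" "\<delta> \<le> \<delta>'" for r \<delta> \<delta>'
    unfolding P_def
  proof (intro conjI ballI)
    show "rcball A g p r \<subseteq> Q" using P by (simp add: P_def)
    fix u q assume uq: "u \<in> rcball A g p r" "q \<in> rcball A g p r"
    let ?n = "N (nc u - nc q)"
    have "ereal (?n / (1 + \<delta>')) \<le> ereal (?n / (1 + \<delta>))"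
      using \<delta> N_nonneg by (simp add: divide_left_mono)
    also have "\<dots> \<le> rdist A g u q" using P uq by (simp add: P_def)
    finally show "ereal (?n / (1 + \<delta>')) \<le> rdist A g u q" .
    have "rdist A g u q \<le> ereal ((1 + \<delta>) * ?n)" using P uq by (simp add: P_def)
    also have "\<dots> \<le> ereal ((1 + \<delta>') * ?n)" using \<delta> N_nonneg by (simp add: mult_right_mono)
    finally show "rdist A g u q \<le> ereal ((1 + \<delta>') * ?n)" .
  qed
  obtain \<rho> where \<rho>: "((\<lambda>r. \<rho> r / r) \<longlongrightarrow> 0) (at_right 0)" "\<And>r. r > 0 \<Longrightarrow> 0 \<le> \<rho> r"
    "\<forall>\<^sub>F r in at_right 0. P r (\<rho> r)"
  proof (rule little_o_witness[of P])
    show "\<forall>\<^sub>F r in at_right 0. P r (e * r)" if "e > 0" for e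
      using rdist_normal_coordinates[OF that] by (simp add: P_def)
  qed (use mono in auto)
  have "\<forall>\<^sub>F r::real in at_right 0. r > 0" by (simp add: eventually_at_right_less)
  with \<rho>(3) have "\<forall>\<^sub>F r in at_right 0.
       rcball A g p r \<subseteq> exp_map A g p ` U \<and>
       (\<forall>u\<in>rcball A g p r.
          set_dist (tdist g p) (exp_inv A g p U u) (exp_inv A g p U ` (\<Omega> \<inter> rcball A g p r))
              / ereal (1 + \<bar>\<rho> r\<bar>)
            \<le> set_dist (rdist A g) u (\<Omega> \<inter> rcball A g p r) \<and>
          set_dist (rdist A g) u (\<Omega> \<inter> rcball A g p r)
            \<le> ereal (1 + \<bar>\<rho> r\<bar>)
              * set_dist (tdist g p) (exp_inv A g p U u)
                  (exp_inv A g p U ` (\<Omega> \<inter> rcball A g p r)))"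
  proof eventually_elim
    case (elim r)
    have sub: "rcball A g p r \<subseteq> Q" using elim(1) by (simp add: P_def)
    have abs: "\<bar>\<rho> r\<bar> = \<rho> r" using \<rho>(2)[OF elim(2)] by simp
    show ?case unfolding abs
    proof (intro conjI ballI)
      show "rcball A g p r \<subseteq> exp_map A g p ` U" using sub by (auto simp: Q_def)
      fix u assume u: "u \<in> rcball A g p r"
      note td = tdist_exp_inv[OF subsetD[OF sub u] subsetD[OF sub]]
      note comp = set_dist_comparison[where K="1 + \<rho> r" and S="\<Omega> \<inter> rcball A g p r" and d="rdist A g"
          and d'="tdist g p" and f="exp_inv A g p U" and u=u and t="\<lambda>a. N (nc u - nc a)"]
      show "set_dist (tdist g p) (exp_inv A g p U u) (exp_inv A g p U ` (\<Omega> \<inter> rcball A g p r)) / ereal (1 + \<rho> r)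
            \<le> set_dist (rdist A g) u (\<Omega> \<inter> rcball A g p r)"
        by (rule comp[THEN conjunct1]) (use elim u sub \<rho>(2)[OF elim(2)] td in \<open>auto simp: P_def\<close>)
      show "set_dist (rdist A g) u (\<Omega> \<inter> rcball A g p r) \<le> ereal (1 + \<rho> r)
              * set_dist (tdist g p) (exp_inv A g p U u) (exp_inv A g p U ` (\<Omega> \<inter> rcball A g p r))"
        by (rule comp[THEN conjunct2]) (use elim u sub \<rho>(2)[OF elim(2)] td in \<open>auto simp: P_def\<close>)
    qed
  qed
  then show ?thesis using \<rho>(1) by blast
qed

end
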